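(* Let $N \ge 1$ be an integer and $1 \le p < +\infty$. There exists a constant $C_{N,p}>0$, depending only on $N$ and $p$, such that for every $\gamma$ with $-p \le \gamma \le -1$ and every $u \in L^p(\mathbb{R}^N)$, $$C_{N,p}\, \Phi(u) \le \liminf_{\lambda \to 0_+} \Phi_\lambda(u).$$ In particular, if the right-hand side is finite, then $u \in W^{1,p}(\mathbb{R}^N)$ if $p>1$, and $u \in BV(\mathbb{R}^N)$ if $p=1$.
   Context: Functions are real-valued. For $u \in L^p(\mathbb{R}^N)$: if $p>1$, $\Phi(u) = \int_{\mathbb{R}^N} |\nabla u|^p\,dx$ when $u \in W^{1,p}(\mathbb{R}^N)$ and $\Phi(u)=+\infty$ otherwise; if $p=1$, $\Phi(u) = \|\nabla u\|_{\mathcal{M}(\mathbb{R}^N)} := \sup\{ |\int_{\mathbb{R}^N} u\, \mathrm{div}\,\varphi\,dx| : \varphi \in C_c^\infty(\mathbb{R}^N;\mathbb{R}^N),\ \|\varphi\|_{L^\infty} \le 1\}$ (the total variation), which is $+\infty$ when $u \notin BV(\mathbb{R}^N)$. For $\lambda>0$, and for the given $p$ and $\gamma$, $$\Phi_\lambda(u) = \lambda^p \iint_{\{(x,y)\in \mathbb{R}^N\times\mathbb{R}^N:\ |u(x)-u(y)|/|x-y|^{1+\gamma/p} > \lambda\}} |x-y|^{-N+\gamma}\,dx\,dy \in [0,+\infty].$$ *)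

theory Defs
  imports "HOL-Analysis.Analysis"
begin

text \<open>Elements of \<open>L\<^sup>p\<close> are represented by Lebesgue measurable functions; all notions below
  are insensitive to changes on null sets.\<close>

definition Lp :: "real \<Rightarrow> ('a::euclidean_space \<Rightarrow> 'b::euclidean_space) set" where
  "Lp p = {u. u \<in> borel_measurable lebesgue \<and> integrable lebesgue (\<lambda>x. norm (u x) powr p)}"

primrec Ck :: "nat \<Rightarrow> ('a::euclidean_space \<Rightarrow> 'b::euclidean_space) \<Rightarrow> bool" where
  "Ck 0 f \<longleftrightarrow> continuous_on UNIV f"
| "Ck (Suc k) f \<longleftrightarrow> f differentiable_on UNIV \<and> (\<forall>v. Ck k (\<lambda>x. frechet_derivative f (at x) v))"

definition test_functions :: "('a::euclidean_space \<Rightarrow> 'b::euclidean_space) set" where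
  "test_functions = {\<phi>. (\<forall>k. Ck k \<phi>) \<and> compact (closure {x. \<phi> x \<noteq> 0})}"

definition divergence :: "('a::euclidean_space \<Rightarrow> 'a) \<Rightarrow> 'a \<Rightarrow> real" where
  "divergence \<phi> x = (\<Sum>i\<in>Basis. frechet_derivative \<phi> (at x) i \<bullet> i)"

text \<open>Only meaningful for locally integrable \<open>u\<close> and \<open>g\<close> (the Bochner integral of a
  non-integrable function is \<open>0\<close>); below both always lie in \<open>L\<^sup>p\<close> with \<open>p \<ge> 1\<close>.\<close>

definition is_weak_gradient :: "('a::euclidean_space \<Rightarrow> real) \<Rightarrow> ('a \<Rightarrow> 'a) \<Rightarrow> bool" where
  "is_weak_gradient u g \<longleftrightarrow> (\<forall>\<phi>\<in>test_functions. \<forall>i\<in>Basis.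
     (LINT x|lebesgue. u x * frechet_derivative \<phi> (at x) i) = - (LINT x|lebesgue. (g x \<bullet> i) * \<phi> x))"

definition W1p :: "real \<Rightarrow> ('a::euclidean_space \<Rightarrow> real) set" where
  "W1p p = {u \<in> Lp p. \<exists>g\<in>Lp p. is_weak_gradient u g}"

text \<open>The weak gradient is unique up to null sets, so the choice of representative is immaterial.\<close>

definition weak_gradient :: "real \<Rightarrow> ('a::euclidean_space \<Rightarrow> real) \<Rightarrow> 'a \<Rightarrow> 'a" where
  "weak_gradient p u = (SOME g. g \<in> Lp p \<and> is_weak_gradient u g)"

text \<open>Test fields are continuous, so their essential supremum norm is the pointwise supremum of
  the Euclidean norm.\<close>

definition total_variation :: "('a::euclidean_space \<Rightarrow> real) \<Rightarrow> ennreal" where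
  "total_variation u =
     (SUP \<phi>\<in>{\<phi> \<in> test_functions. \<forall>x. norm (\<phi> x) \<le> 1}.
        ennreal \<bar>LINT x|lebesgue. u x * divergence \<phi> x\<bar>)"

definition BV :: "('a::euclidean_space \<Rightarrow> real) set" where
  "BV = {u \<in> Lp 1. total_variation u < \<infinity>}"

definition Phi :: "real \<Rightarrow> ('a::euclidean_space \<Rightarrow> real) \<Rightarrow> ennreal" where
  "Phi p u =
     (if p = 1 then total_variation u
      else if u \<in> W1p p then (\<integral>\<^sup>+x. ennreal (norm (weak_gradient p u x) powr p) \<partial>lebesgue)
      else \<infinity>)"

text \<open>The diagonal \<open>x = y\<close>, where \<open>0 powr a = 0\<close>, is a null set of the product space and hence
  does not contribute.\<close>

definition Phi_lambda :: "real \<Rightarrow> real \<Rightarrow> real \<Rightarrow> ('a::euclidean_space \<Rightarrow> real) \<Rightarrow> ennreal" where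
  "Phi_lambda p \<gamma> l u = ennreal (l powr p) *
     (\<integral>\<^sup>+z\<in>{(x, y). \<bar>u x - u y\<bar> / norm (x - y) powr (1 + \<gamma> / p) > l}.
        (case z of (x, y) \<Rightarrow> ennreal (norm (x - y) powr (\<gamma> - real DIM('a))))
      \<partial>(lebesgue :: ('a \<times> 'a) measure))"

end

theory Submission
  imports Defs
begin

text \<open>
  Let \<open>N\<close> be the dimension, \<open>b = - \<gamma> / p \<in> [1/p, 1]\<close> and write \<open>\<lambda> = s \<rho> powr b\<close>. If \<open>\<bar>x - y\<bar> < \<rho>\<close> and
  \<open>\<bar>u x - u y\<bar> > s \<rho>\<close>, then \<open>(x, y)\<close> belongs to the domain of integration of \<open>\<Phi>\<^sub>\<lambda>(u)\<close>, and there the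
  integrand, with its factor \<open>\<lambda> powr p\<close>, is at least \<open>s powr p * \<rho> / \<bar>x - y\<bar> ^ (N + 1)\<close>.

  Call \<open>x\<close> rough at the scale \<open>\<rho> / 2 ^ i\<close> if such \<open>y\<close> have positive density in the ball of that
  radius. Two points that are not rough at a scale comparable to their distance have \<open>u\<close>-values within
  \<open>2 s \<rho>\<close>, because a third point is good for both. Along a segment of length \<open>\<tau>\<close> one
  therefore joins the ends by a chain of good points, passing to finer scales wherever the coarse
  ones leave a gap; the number of steps is \<open>O(\<tau> / \<rho>)\<close> plus the measure of the rough sets
  weighted by \<open>2 ^ i / \<rho>\<close>, and this weighted measure is controlled by \<open>\<Phi>\<^sub>\<lambda>\<close>. Letting \<open>\<lambda>\<close> tend to \<open>0\<close> along
  a sequence, optimising in \<open>s\<close> and integrating gives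
  \<open>\<integral> \<bar>u (x + \<tau> e) - u x\<bar> powr p dx \<le> C * \<tau> powr p * liminf \<Phi>\<^sub>\<lambda>(u)\<close> for all unit vectors \<open>e\<close>. By duality this
  bounds the total variation for \<open>p = 1\<close>; for \<open>p > 1\<close> the difference quotients have a weak limit, the
  weak gradient.
\<close>

subsection \<open>Chains of good points on a line\<close>

text \<open>Uniformity in \<open>\<gamma>\<close> comes from comparing every kernel with the one for
  \<open>\<gamma> = - 1\<close>: within distance \<open>\<rho>\<close>, the bound
  \<open>\<gamma> \<le> - 1\<close> makes the scaled kernel the larger one, and
  \<open>- p \<le> \<gamma>\<close> makes the threshold on the difference grow with the distance.
  The obstacle is the end points of the segment: for fixed \<open>\<rho>\<close> a set of positive
  measure may be rough at coarse scales. An end point is therefore only required to be good from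
  scale \<open>\<rho> / 2 ^ K\<close> on. This adds a cost of order \<open>K * s * \<rho>\<close>,
  while the excluded set has measure of order \<open>1 / 2 ^ K\<close>. With \<open>K = j\<close>
  for the j-th \<open>\<lambda>\<close>, which is at most \<open>1 / (j + 1) ^ 2\<close>, the
  measures are summable and the extra cost tends to \<open>0\<close>; by Borel-Cantelli almost every
  segment can be joined for all large j. What remains is \<open>8 * s * \<tau>\<close> plus a
  constant times \<open>s powr (1 - p)\<close> times a lower limit of energies along the segment.
  The best \<open>s\<close> is proportional to the increment over \<open>\<tau>\<close> and so
  depends on the point, which is why the estimate is first made for countably many
  \<open>s\<close>.\<close>

lemma fmeasurable_interval_Diff [intro]:
  "G \<in> sets borel \<Longrightarrow> {x<..y::real} - G \<in> fmeasurable lborel"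
  by (rule fmeasurableI2[of "{x..y}"]) (auto simp: fmeasurable_def emeasure_lborel_Icc_eq)

text \<open>Steps of length between \<open>h\<close> and \<open>2 * h\<close> inside \<open>G\<close> cost \<open>d\<close> each. A step that no point of \<open>G\<close> permits
  crosses a gap whose length is at most three times the measure it misses; its cost is \<open>gap\<close>.\<close>

lemma one_scale_chain:
  fixes v :: "real \<Rightarrow> real"
  assumes h: "h > 0" and d: "d \<ge> 0"
    and close: "\<And>x y. x \<in> G \<Longrightarrow> y \<in> G \<Longrightarrow> \<bar>x - y\<bar> \<le> 2 * h \<Longrightarrow> \<bar>v x - v y\<bar> \<le> d"
    and Q0: "\<And>x y. Q x y \<ge> 0"
    and Qadd: "\<And>x y z. x \<le> y \<Longrightarrow> y \<le> z \<Longrightarrow> Q x y + Q y z \<le> (Q x z :: real)"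
    and G: "G \<in> sets borel"
    and gap: "\<And>x y. x \<in> G \<Longrightarrow> y \<in> G \<Longrightarrow> 2 * h \<le> y - x \<Longrightarrow>
      y - x \<le> 3 * measure lborel ({x<..y} - G) \<Longrightarrow> \<bar>v y - v x\<bar> \<le> d * ((y - x) / h + Q x y)"
    and "a \<in> G" "b \<in> G" "a \<le> b"
  shows "\<bar>v b - v a\<bar> \<le> d * (1 + (b - a) / h + Q a b)"
proof -
  \<comment> \<open>Every step advances by at least \<open>h\<close>, so any \<open>n\<close> with
    \<open>b - a \<le> n * h\<close> bounds the number of steps; the induction moves the left end
    and keeps \<open>b\<close> fixed.\<close>
  have "a \<in> G \<Longrightarrow> a \<le> b \<Longrightarrow> b - a \<le> real n * h \<Longrightarrow> \<bar>v b - v a\<bar> \<le> d * (1 + (b - a) / h + Q a b)" for n a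
  proof (induction n arbitrary: a)
    case 0
    then show ?case using d Q0[of a a] by auto
  next
    case (Suc n)
    show ?case
    proof (cases "b - a \<le> 2 * h")
      case True
      have "\<bar>v b - v a\<bar> \<le> d" using close[of b a] True Suc.prems \<open>b \<in> G\<close> by auto
      also have "d * 1 \<le> d * (1 + (b - a) / h + Q a b)"
        using d h Q0[of a b] Suc.prems by (intro mult_left_mono) auto
      finally show ?thesis by simp
    next
      case far: False
      have split: "\<bar>v b - v a\<bar> \<le> d * (1 + (b - a) / h + Q a b)"
        if q: "q \<in> G" "a + h \<le> q" "q \<le> b" and s: "\<bar>v q - v a\<bar> \<le> d * ((q - a) / h + Q a q)" for q
      proof -
        have "b - q \<le> real n * h" using Suc.prems(3) q by (simp add: algebra_simps)
        then have "\<bar>v b - v q\<bar> \<le> d * (1 + (b - q) / h + Q q b)" using Suc.IH[of q] q by auto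
        with s have "\<bar>v b - v a\<bar> \<le> d * (1 + (b - q) / h + Q q b) + d * ((q - a) / h + Q a q)" by linarith
        also have "\<dots> = d * (1 + (b - a) / h + (Q a q + Q q b))"
          by (simp add: field_simps diff_divide_distrib)
        \<comment> \<open>Superadditivity of \<open>Q\<close> lets the costs of consecutive pieces
          be added without loss.\<close>
        also have "\<dots> \<le> d * (1 + (b - a) / h + Q a b)"
          using d h q Qadd[of a q b] by (intro mult_left_mono) auto
        finally show ?thesis .
      qed
      show ?thesis
      proof (cases "\<exists>q\<in>G. a + h \<le> q \<and> q \<le> a + 2 * h")
        case True
        then obtain q where q: "q \<in> G" "a + h \<le> q" "q \<le> a + 2 * h" by auto
        have "\<bar>v q - v a\<bar> \<le> d" using close[of q a] q Suc.prems h by auto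
        also have "d * 1 \<le> d * ((q - a) / h + Q a q)"
          using d h Q0[of a q] q by (intro mult_left_mono) (auto simp: field_simps add_nonneg_pos intro!: add_increasing2)
        finally show ?thesis using split[of q] q far by auto
      next
        case False
        \<comment> \<open>The infimum of the later points need not lie in \<open>G\<close>, so
          \<open>q\<close> is chosen within \<open>h\<close> of it. The missed length
          \<open>m = q0 - (a + h)\<close> is at least \<open>h\<close>, and \<open>q - a\<close> is
          below \<open>m + 2 * h\<close>, hence at most \<open>3 * m\<close>: this is the factor
          \<open>3\<close> of \<open>gap\<close>.\<close>
        define S where "S = G \<inter> {a + 2 * h..b}"
        have bS: "b \<in> S" using \<open>b \<in> G\<close> far by (auto simp: S_def)
        have bdd: "bdd_below S" by (auto simp: S_def)
        define q0 where "q0 = Inf S"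
        have q0: "a + 2 * h \<le> q0" unfolding q0_def using bS by (intro cInf_greatest) (auto simp: S_def)
        obtain q where q: "q \<in> S" "q < q0 + h"
          using cInf_lessD[of S "q0 + h"] bS h by (auto simp: q0_def)
        have q0q: "q0 \<le> q" unfolding q0_def using q bdd by (intro cInf_lower) auto
        have sub: "{a + h..<q0} \<subseteq> {a<..q} - G"
        proof
          fix x assume x: "x \<in> {a + h..<q0}"
          have "x \<notin> G"
          proof
            assume "x \<in> G"
            with False x have "x > a + 2 * h" by auto
            moreover have "x \<le> b" using x q0q q by (auto simp: S_def)
            ultimately have "x \<in> S" using \<open>x \<in> G\<close> by (auto simp: S_def)
            then have "q0 \<le> x" unfolding q0_def using bdd by (intro cInf_lower) auto
            with x show False by auto
          qed
          then show "x \<in> {a<..q} - G" using x h q0q by auto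
        qed
        have "q0 - (a + h) = measure lborel {a + h..<q0}" using q0 h by simp
        also have "\<dots> \<le> measure lborel ({a<..q} - G)"
          using sub G by (intro measure_mono_fmeasurable) auto
        finally have "q0 - (a + h) \<le> measure lborel ({a<..q} - G)" .
        then have "\<bar>v q - v a\<bar> \<le> d * ((q - a) / h + Q a q)"
          using gap[of a q] Suc.prems q q0 q0q by (auto simp: S_def)
        then show ?thesis using split[of q] q h by (auto simp: S_def)
      qed
    qed
  qed
  moreover obtain n where "(b - a) / h \<le> real n" using real_arch_simple by blast
  ultimately show ?thesis using assms(8-10) h by (simp add: field_simps)
qed

text \<open>Induction from the finest scale downwards: a gap at level \<open>k\<close> is bridged by
  a chain of level \<open>Suc k\<close>, whose step length is half as large. If the gap has length
  \<open>t\<close> in units of \<open>h / 2 ^ k\<close> and misses measure \<open>m\<close> in these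
  units, then \<open>1 \<le> t\<close> and \<open>t \<le> 3 * m\<close>, so the bridging cost
  \<open>1 + 2 * t\<close> is at most \<open>t + 6 * m\<close>. This is the origin of the factor
  \<open>6\<close>.\<close>

lemma multi_scale_chain:
  fixes v :: "real \<Rightarrow> real" and h :: real and G :: "nat \<Rightarrow> real set"
  defines "M \<equiv> \<lambda>l x y. measure lborel ({x<..y} - G l) * 2 ^ l / h"
  assumes h: "h > 0" and d: "d \<ge> 0"
    and close: "\<And>l x y. x \<in> G l \<Longrightarrow> y \<in> G l \<Longrightarrow> \<bar>x - y\<bar> \<le> 2 * h / 2 ^ l \<Longrightarrow> \<bar>v x - v y\<bar> \<le> d"
    and mono: "\<And>l. G l \<subseteq> G (Suc l)"
    and G: "\<And>l. G l \<in> sets borel" "\<And>l. G l \<subseteq> {\<alpha>..\<beta>}"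
    and last: "measure lborel ({\<alpha><..\<beta>} - G K) < h / 2 ^ K / 2"
    and "k \<le> K" "a \<in> G k" "b \<in> G k" "a \<le> b"
  shows "\<bar>v b - v a\<bar> \<le> d * (1 + (b - a) * 2 ^ k / h + 6 * (\<Sum>l=k..<K. M l a b))"
  using assms(9-12)
proof (induction k arbitrary: a b rule: inc_induct)
  case base
  have "\<bar>v b - v a\<bar> \<le> d * (1 + (b - a) / (h / 2 ^ K) + 0)"
  proof (rule one_scale_chain[of _ _ "G K"])
    fix x y assume *: "x \<in> G K" "y \<in> G K" "2 * (h / 2 ^ K) \<le> y - x" 
      "y - x \<le> 3 * measure lborel ({x<..y} - G K)"
    \<comment> \<open>At the finest scale no gap can occur: its length would be at least
      \<open>2 * h / 2 ^ K\<close>, but at most three times a measure below half of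
      \<open>h / 2 ^ K\<close>.\<close>
    have "{x<..y} - G K \<subseteq> {\<alpha><..\<beta>} - G K" using subsetD[OF G(2) *(1)] subsetD[OF G(2) *(2)] by auto
    then have "measure lborel ({x<..y} - G K) \<le> measure lborel ({\<alpha><..\<beta>} - G K)"
      using G by (intro measure_mono_fmeasurable) auto
    moreover have "0 < h / 2 ^ K" using h by simp
    ultimately show "\<bar>v y - v x\<bar> \<le> d * ((y - x) / (h / 2 ^ K) + 0)" using *(3,4) last by argo
  qed (use h d G close base in auto)
  then show ?case by simp
next
  case (step k)
  have M0: "M l x y \<ge> 0" for l x y using h by (simp add: M_def)
  have Madd: "M l x y + M l y z = M l x z" if "x \<le> y" "y \<le> z" for l x y z
  proof -
    have "{x<..z} - G l = ({x<..y} - G l) \<union> ({y<..z} - G l)" using that by auto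
    then have "measure lborel ({x<..z} - G l) = measure lborel ({x<..y} - G l) + measure lborel ({y<..z} - G l)"
      using G that by (auto intro!: measure_Un_AE)
    then show ?thesis by (simp add: M_def field_simps add_divide_distrib)
  qed
  have "\<bar>v b - v a\<bar> \<le> d * (1 + (b - a) / (h / 2 ^ k) + 6 * (\<Sum>l=k..<K. M l a b))"
  proof (rule one_scale_chain[of _ _ "G k"])
    fix x y assume *: "x \<in> G k" "y \<in> G k" "2 * (h / 2 ^ k) \<le> y - x" 
      "y - x \<le> 3 * measure lborel ({x<..y} - G k)"
    have xy: "x \<le> y" using * h by (smt (verit) divide_pos_pos zero_less_power)
    have "\<bar>v y - v x\<bar> \<le> d * (1 + (y - x) * 2 ^ Suc k / h + 6 * (\<Sum>l=Suc k..<K. M l x y))"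
      using step.IH[of x y] * mono[of k] xy by auto
    also have "\<dots> \<le> d * ((y - x) / (h / 2 ^ k) + 6 * (\<Sum>l=k..<K. M l x y))"
    proof (intro mult_left_mono)
      define t where "t = (y - x) * 2 ^ k / h"
      have arith: "1 + 2 * t + 6 * r \<le> t + 6 * (m + r)" if "1 \<le> t" "t \<le> 3 * m" for t m r :: real
        using that by (simp add: algebra_simps)
      have "1 \<le> t" using *(3) h by (simp add: t_def field_simps)
      moreover have "t \<le> 3 * M k x y" using mult_right_mono[OF *(4), of "2 ^ k / h"] h
        by (simp add: t_def M_def)
      moreover have "(\<Sum>l=k..<K. M l x y) = M k x y + (\<Sum>l=Suc k..<K. M l x y)"
        using step.hyps by (simp add: sum.atLeast_Suc_lessThan)
      moreover have "(y - x) * 2 ^ Suc k / h = 2 * t" "(y - x) / (h / 2 ^ k) = t" by (auto simp: t_def)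
      ultimately show "1 + (y - x) * 2 ^ Suc k / h + 6 * (\<Sum>l=Suc k..<K. M l x y)
          \<le> (y - x) / (h / 2 ^ k) + 6 * (\<Sum>l=k..<K. M l x y)"
        using arith[of t "M k x y"] by (simp only:)
    qed (use d in auto)
    finally show "\<bar>v y - v x\<bar> \<le> d * ((y - x) / (h / 2 ^ k) + 6 * (\<Sum>l=k..<K. M l x y))" .
  next
    fix x y show "6 * (\<Sum>l=k..<K. M l x y) \<ge> 0" using M0 by (simp add: sum_nonneg)
  next
    fix x y z :: real assume "x \<le> y" "y \<le> z"
    then show "6 * (\<Sum>l=k..<K. M l x y) + 6 * (\<Sum>l=k..<K. M l y z) \<le> 6 * (\<Sum>l=k..<K. M l x z)"
      by (simp add: Madd flip: distrib_left sum.distrib)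
  qed (use h d G close step.prems in auto)
  then show ?case by simp
qed


text \<open>The end points need only lie in \<open>G K\<close>: for \<open>l < K\<close> they are added to \<open>G l\<close> after a
  neighbourhood of radius \<open>2 * h / 2 ^ l\<close> of each has been removed, which costs \<open>O(d)\<close> per scale.\<close>

lemma chain_between_fine_points:
  fixes v :: "real \<Rightarrow> real" and h :: real and G :: "nat \<Rightarrow> real set"
  assumes h: "h > 0" and d: "d \<ge> 0"
    and close: "\<And>l x y. x \<in> G l \<Longrightarrow> y \<in> G l \<Longrightarrow> \<bar>x - y\<bar> \<le> 2 * h / 2 ^ l \<Longrightarrow> \<bar>v x - v y\<bar> \<le> d"
    and mono: "\<And>l. G l \<subseteq> G (Suc l)"
    and G: "\<And>l. G l \<in> sets borel"
    and ab: "a \<in> G K" "b \<in> G K" "2 * h < b - a"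
    and S: "\<And>n. (\<Sum>l<n. 2 ^ l * measure lborel ({a<..b} - G l)) \<le> S"
  shows "\<bar>v b - v a\<bar> \<le> d * (1 + (b - a) / h + 24 * real K + 6 * S / h)"
proof -
  define G' where "G' l = (if l < K then (G l \<inter> {a + 2 * h / 2 ^ l<..<b - 2 * h / 2 ^ l}) \<union> {a, b}
    else G l \<inter> {a..b})" for l
  define m where "m l = 2 ^ l * measure lborel ({a<..b} - G l)" for l
  have m0: "m l \<ge> 0" for l by (simp add: m_def)
  have Gmono: "G l \<subseteq> G n" if "l \<le> n" for l n using lift_Suc_mono_le[of G, OF mono that] .
  have hl: "2 * h / 2 ^ l \<le> 2 * h" for l
    using h by (simp add: divide_le_eq)
  \<comment> \<open>Convergence of the weighted series yields a level \<open>L \<ge> K\<close> at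
    which the missed measure is below half the scale, as required of the finest level of the
    chain.\<close>
  have "summable m" using S m0 by (intro summableI_nonneg_bounded[of m S]) (auto simp: m_def)
  then have "m \<longlonglongrightarrow> 0" by (rule summable_LIMSEQ_zero)
  then have "\<forall>\<^sub>F l in sequentially. m l < h / 2 \<and> l \<ge> K"
    using h by (intro eventually_conj order_tendstoD(2)[of m 0] eventually_ge_at_top) auto
  then obtain L where L: "m L < h / 2" "K \<le> L" by (auto simp: eventually_sequentially)
  have borel': "G' l \<in> sets borel" for l using G by (auto simp: G'_def)
  have "\<bar>v b - v a\<bar> \<le> d * (1 + (b - a) * 2 ^ 0 / h +
      6 * (\<Sum>l=0..<L. measure lborel ({a<..b} - G' l) * 2 ^ l / h))"
  proof (rule multi_scale_chain[where \<alpha> = a and \<beta> = b])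
    fix l x y assume *: "x \<in> G' l" "y \<in> G' l" "\<bar>x - y\<bar> \<le> 2 * h / 2 ^ l"
    show "\<bar>v x - v y\<bar> \<le> d"
    proof (cases "l < K")
      case True
      \<comment> \<open>Below level \<open>K\<close> an end point is farther than
        \<open>2 * h / 2 ^ l\<close> from every other point of \<open>G' l\<close>, so it is only
        ever compared with itself.\<close>
      show ?thesis using * True hl[of l] ab(3) d close[of x l y]
        by (auto simp: G'_def abs_le_iff)
    next
      case False
      with * close[of x l y] show ?thesis by (auto simp: G'_def)
    qed
  next
    fix l
    have *: "2 * h / 2 ^ Suc l \<le> 2 * h / 2 ^ l" using h by (intro divide_left_mono) auto
    show "G' l \<subseteq> G' (Suc l)"
    proof
      fix x assume x: "x \<in> G' l"
      have "0 < 2 * h / 2 ^ l" using h by simp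
      then show "x \<in> G' (Suc l)"
        using x * mono[of l] ab Gmono[of K "Suc l"] h
        by (auto simp: G'_def split: if_splits)
    qed
  next
    fix l
    have e: "0 < 2 * h / 2 ^ l" using h by simp
    show "G' l \<subseteq> {a..b}"
    proof
      fix x assume "x \<in> G' l"
      moreover have "x \<in> {a..b}" if "a + 2 * h / 2 ^ l < x" "x < b - 2 * h / 2 ^ l" for x
        using that e by auto
      ultimately show "x \<in> {a..b}" using ab h by (auto simp: G'_def split: if_splits)
    qed
  next
    have "{a<..b} - G' L = {a<..b} - G L" using L by (auto simp: G'_def)
    then show "measure lborel ({a<..b} - G' L) < h / 2 ^ L / 2"
      using L(1) by (simp add: m_def field_simps)
  next
    show "a \<in> G' 0" "b \<in> G' 0" using ab h by (auto simp: G'_def)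
  qed (use h d borel' ab in auto)
  also have "\<dots> \<le> d * (1 + (b - a) / h + 24 * real K + 6 * S / h)"
  proof (rule mult_left_mono)
    \<comment> \<open>Two removed neighbourhoods of length \<open>2 * h / 2 ^ l\<close> contribute
      \<open>4\<close> after weighting by \<open>2 ^ l / h\<close>; the factor \<open>6\<close> of
      the multi-scale bound turns this into \<open>24\<close> per scale.\<close>
    have "measure lborel ({a<..b} - G' l) * 2 ^ l / h \<le> m l / h + (if l < K then 4 else 0)" for l
    proof (cases "l < K")
      case True
      define e where "e = 2 * h / 2 ^ l"
      have e: "e > 0" using h by (simp add: e_def)
      have *: "{a<..a + e} \<in> fmeasurable lborel" "{b - e<..b} \<in> fmeasurable lborel"
        "{b - e} \<in> fmeasurable lborel"
        using fmeasurable_interval_Diff[of "{}"] by (auto intro: fmeasurableI)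
      have "measure lborel ({a<..b} - G' l) \<le>
          measure lborel ((({a<..b} - G l) \<union> {a<..a + e}) \<union> ({b - e<..b} \<union> {b - e}))"
        using True h * G borel' by (intro measure_mono_fmeasurable fmeasurable.Un)
           (auto simp: G'_def e_def)
      also have "\<dots> \<le> (measure lborel ({a<..b} - G l) + measure lborel {a<..a + e}) +
          (measure lborel {b - e<..b} + measure lborel {b - e})"
        using * G by (intro order.trans[OF measure_Un_le] add_mono) (auto intro!: measure_Un_le)
      also have "\<dots> = measure lborel ({a<..b} - G l) + 2 * e" using e by simp
      finally have "measure lborel ({a<..b} - G' l) * 2 ^ l / h \<le>
          (measure lborel ({a<..b} - G l) + 2 * e) * 2 ^ l / h"
        using h by (intro divide_right_mono mult_right_mono) auto
      also have "\<dots> = m l / h + 4" using h by (simp add: m_def e_def field_simps)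
      finally show ?thesis using True by simp
    next
      case False
      then have "{a<..b} - G' l = {a<..b} - G l" by (auto simp: G'_def)
      with False show ?thesis by (simp add: m_def mult.commute)
    qed
    then have "(\<Sum>l=0..<L. measure lborel ({a<..b} - G' l) * 2 ^ l / h) \<le>
        (\<Sum>l<L. m l / h + (if l < K then 4 else 0))"
      unfolding atLeast0LessThan by (rule sum_mono)
    also have "\<dots> = (\<Sum>l<L. m l) / h + (\<Sum>l<L. if l < K then 4 else 0)"
      by (simp add: sum.distrib sum_divide_distrib)
    also have "(\<Sum>l<L. if l < K then 4 else 0) = (\<Sum>l\<in>{..<L} \<inter> {..<K}. 4::real)"
      by (subst sum.inter_restrict) auto
    also have "\<dots> = 4 * real K" using L(2) by (simp add: Int_absorb1 Iio_Int_singleton)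
    also have "(\<Sum>l<L. m l) / h \<le> S / h" using S[of L] h by (simp add: m_def divide_right_mono)
    finally show "1 + (b - a) * 2 ^ 0 / h + 6 * (\<Sum>l=0..<L. measure lborel ({a<..b} - G' l) * 2 ^ l / h)
        \<le> 1 + (b - a) / h + 24 * real K + 6 * S / h" by simp
  qed (use d in auto)
  finally show ?thesis .
qed

subsection \<open>Rough points\<close>

definition bad_points :: "('a::euclidean_space \<Rightarrow> real) \<Rightarrow> real \<Rightarrow> real \<Rightarrow> 'a \<Rightarrow> 'a set" where
  "bad_points u t r x = {y. dist x y < r \<and> t < \<bar>u x - u y\<bar>}"

text \<open>Half the proportion of a ball filled by a ball of half the radius, so that the bad points of two
  neighbours cannot cover the common part of their balls.\<close>

definition density_threshold :: "'a::euclidean_space itself \<Rightarrow> real" where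
  "density_threshold _ = unit_ball_vol (real DIM('a)) / 2 ^ Suc DIM('a)"

definition rough_set :: "('a::euclidean_space \<Rightarrow> real) \<Rightarrow> real \<Rightarrow> real \<Rightarrow> nat \<Rightarrow> 'a set" where
  "rough_set u t \<rho> i = {x. ennreal (density_threshold TYPE('a) * (\<rho> / 2 ^ i) ^ DIM('a))
     \<le> emeasure lborel (bad_points u t (\<rho> / 2 ^ i) x)}"

text \<open>Goodness is demanded at all scales from \<open>k\<close> on, so that these sets increase
  with \<open>k\<close>, as the multi-scale chain requires.\<close>

definition fine_set :: "('a::euclidean_space \<Rightarrow> real) \<Rightarrow> real \<Rightarrow> real \<Rightarrow> nat \<Rightarrow> 'a set" where
  "fine_set u t \<rho> k = {x. \<forall>i\<ge>k. x \<notin> rough_set u t \<rho> i}"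

text \<open>The kernel is that of the functional for \<open>\<gamma> = - 1\<close>, times
  \<open>\<rho>\<close>. It is what results from summing the densities of the bad points over all
  dyadic scales with weights \<open>2 ^ i\<close>, up to a constant.\<close>

definition oscillation :: "('a::euclidean_space \<Rightarrow> real) \<Rightarrow> real \<Rightarrow> real \<Rightarrow> 'a \<Rightarrow> ennreal" where
  "oscillation u t \<rho> x = (\<integral>\<^sup>+y\<in>bad_points u t \<rho> x. ennreal (\<rho> / dist x y ^ Suc DIM('a)) \<partial>lborel)"

lemma density_threshold_pos: "density_threshold TYPE('a::euclidean_space) > 0"
  by (simp add: density_threshold_def)

lemma bad_points_borel [measurable]:
  "u \<in> borel_measurable borel \<Longrightarrow> bad_points u t r x \<in> sets borel"
  unfolding bad_points_def by measurable

lemma measurable_nn_integral_bad_points: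
  assumes [measurable]: "u \<in> borel_measurable borel" "case_prod f \<in> borel_measurable (borel \<Otimes>\<^sub>M borel)"
  shows "(\<lambda>x::'a::euclidean_space. \<integral>\<^sup>+y\<in>bad_points u t r x. f x y \<partial>lborel) \<in> borel_measurable borel"
  unfolding bad_points_def indicator_def by measurable

lemma borel_measurable_oscillation [measurable]:
  fixes u :: "'a::euclidean_space \<Rightarrow> real"
  assumes "u \<in> borel_measurable borel"
  shows "oscillation u t \<rho> \<in> borel_measurable borel"
proof -
  have "(\<lambda>(x::'a, y). ennreal (\<rho> / dist x y ^ Suc DIM('a))) \<in> borel_measurable (borel \<Otimes>\<^sub>M borel)"
    unfolding split_beta' by measurable
  then show ?thesis
    unfolding oscillation_def[abs_def] by (intro measurable_nn_integral_bad_points assms)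
qed

lemma rough_set_borel [measurable]:
  assumes [measurable]: "u \<in> borel_measurable borel"
  shows "rough_set u t \<rho> i \<in> sets borel"
proof -
  have "(\<lambda>x. \<integral>\<^sup>+y\<in>bad_points u t (\<rho> / 2 ^ i) x. 1 \<partial>lborel) \<in> borel_measurable borel"
    by (intro measurable_nn_integral_bad_points) auto
  then have [measurable]: "(\<lambda>x. emeasure lborel (bad_points u t (\<rho> / 2 ^ i) x)) \<in> borel_measurable borel"
    by simp
  show ?thesis unfolding rough_set_def by measurable
qed

lemma fine_set_borel [measurable]:
  assumes [measurable]: "u \<in> borel_measurable borel"
  shows "fine_set u t \<rho> k \<in> sets borel"
proof -
  have "fine_set u t \<rho> k = - (\<Union>i\<in>{k..}. rough_set u t \<rho> i)" by (auto simp: fine_set_def)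
  also have "\<dots> \<in> sets borel" by measurable
  finally show ?thesis .
qed

lemma fine_set_mono: "k \<le> l \<Longrightarrow> fine_set u t \<rho> k \<subseteq> fine_set u t \<rho> l"
  by (auto simp: fine_set_def)

lemma fine_set_close:
  fixes u :: "'a::euclidean_space \<Rightarrow> real"
  assumes [measurable]: "u \<in> borel_measurable borel" and \<rho>: "\<rho> > 0"
    and x: "x \<in> fine_set u t \<rho> k" "z \<in> fine_set u t \<rho> k" and xz: "dist x z \<le> \<rho> / 2 ^ k / 2"
  shows "\<bar>u x - u z\<bar> \<le> 2 * t"
proof (rule ccontr)
  assume far: "\<not> ?thesis"
  define r where "r = \<rho> / 2 ^ k"
  have r: "r > 0" using \<rho> by (simp add: r_def)
  define \<kappa> where "\<kappa> = density_threshold TYPE('a) * r ^ DIM('a)"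
  have \<kappa>: "\<kappa> \<ge> 0" using density_threshold_pos[where 'a='a] r by (simp add: \<kappa>_def)
  \<comment> \<open>If \<open>u x\<close> and \<open>u z\<close> differ by more than
    \<open>2 * t\<close>, no value \<open>u y\<close> is within \<open>t\<close> of both, so each
    \<open>y\<close> of the small ball is bad for one of them.\<close>
  have sub: "ball x (r / 2) \<subseteq> bad_points u t r x \<union> bad_points u t r z"
  proof
    fix y assume y: "y \<in> ball x (r / 2)"
    have "dist x y < r" using y r by auto
    moreover have "dist z y < r"
      using y xz dist_triangle[of z y x] by (auto simp: r_def dist_commute)
    ultimately show "y \<in> bad_points u t r x \<union> bad_points u t r z"
      using far by (auto simp: bad_points_def)
  qed
  have "ennreal (2 * \<kappa>) = emeasure lborel (ball x (r / 2))"
    using r by (simp add: emeasure_ball \<kappa>_def density_threshold_def power_divide)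
  also have "\<dots> \<le> emeasure lborel (bad_points u t r x \<union> bad_points u t r z)"
    using sub by (intro emeasure_mono) auto
  also have "\<dots> \<le> emeasure lborel (bad_points u t r x) + emeasure lborel (bad_points u t r z)"
    by (intro emeasure_subadditive) auto
  also have "\<dots> < ennreal \<kappa> + ennreal \<kappa>"
    using x by (intro add_strict_mono) (auto simp: fine_set_def rough_set_def r_def \<kappa>_def not_le)
  also have "\<dots> = ennreal (2 * \<kappa>)" using \<kappa> by (simp flip: ennreal_plus)
  finally show False by simp
qed

section \<open>Weighted sums over dyadic scales\<close>

lemma geometric_sum_le_last:
  fixes q :: real
  assumes "q \<ge> 2"
  shows "(\<Sum>i\<le>n. q ^ i) \<le> 2 * q ^ n"
proof (induction n)
  case (Suc n)
  have "2 * q ^ n \<le> q * q ^ n" using assms by (intro mult_right_mono) auto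
  with Suc show ?case by simp
qed auto

text \<open>A geometric sum with ratio at least \<open>2\<close> is at most twice its last term, so
  the last index satisfying \<open>P\<close> decides; the induction searches for it from
  above.\<close>

lemma truncated_geometric_sum_le:
  fixes q B :: real
  assumes "q \<ge> 2" "B \<ge> 0" and "\<And>i. P i \<Longrightarrow> q ^ i \<le> B"
  shows "(\<Sum>i<n. if P i then q ^ i else 0) \<le> 2 * B"
proof (induction n)
  case (Suc n)
  show ?case
  proof (cases "P n")
    case True
    have "(\<Sum>i<Suc n. if P i then q ^ i else 0) \<le> (\<Sum>i\<le>n. q ^ i)"
      unfolding lessThan_Suc_atMost using assms(1) by (intro sum_mono) auto
    also have "\<dots> \<le> 2 * q ^ n" by (rule geometric_sum_le_last) fact
    also have "\<dots> \<le> 2 * B" using assms(3)[OF True] by simp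
    finally show ?thesis .
  qed (use Suc in simp)
qed (use assms in simp)

text \<open>At a rough point the measure of the bad points divided by the threshold is at least
  \<open>1\<close>. After exchanging sum and integral, a fixed \<open>y\<close> at distance
  \<open>r\<close> is counted only at scales \<open>\<rho> / 2 ^ i > r\<close>. The resulting series
  has ratio \<open>2 ^ Suc N\<close> and is controlled by \<open>(\<rho> / r) ^ Suc N\<close>;
  dividing by \<open>\<kappa> * \<rho> ^ N\<close> leaves the kernel of
  \<open>oscillation\<close>.\<close>

lemma rough_sets_sum_le:
  fixes u :: "'a::euclidean_space \<Rightarrow> real"
  assumes [measurable]: "u \<in> borel_measurable borel" and \<rho>: "\<rho> > 0" and t: "t \<ge> 0"
  shows "(\<Sum>i<n. ennreal (2 ^ i) * indicator (rough_set u t \<rho> i) x)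
    \<le> ennreal (2 / density_threshold TYPE('a)) * oscillation u t \<rho> x"
proof -
  define N where "N = DIM('a)"
  define \<kappa> where "\<kappa> = density_threshold TYPE('a)"
  have \<kappa>: "\<kappa> > 0" unfolding \<kappa>_def by (rule density_threshold_pos)
  define c where "c i = (2 ^ i / (\<kappa> * (\<rho> / 2 ^ i) ^ N) :: real)" for i
  have c: "c i > 0" for i using \<kappa> \<rho> by (simp add: c_def)
  have c_eq: "c i = (2 ^ Suc N) ^ i / (\<kappa> * \<rho> ^ N)" for i
    by (simp add: c_def field_simps power_mult_distrib flip: power_mult)
  have "(\<Sum>i<n. ennreal (2 ^ i) * indicator (rough_set u t \<rho> i) x)
      \<le> (\<Sum>i<n. ennreal (c i) * emeasure lborel (bad_points u t (\<rho> / 2 ^ i) x))"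
  proof (rule sum_mono)
    fix i
    have "ennreal (2 ^ i) \<le> ennreal (c i) * emeasure lborel (bad_points u t (\<rho> / 2 ^ i) x)"
      if "x \<in> rough_set u t \<rho> i"
    proof -
      have "ennreal (2 ^ i) = ennreal (c i) * ennreal (\<kappa> * (\<rho> / 2 ^ i) ^ N)"
        using \<kappa> \<rho> c[of i] by (subst ennreal_mult[symmetric]) (auto simp: c_def)
      also have "\<dots> \<le> ennreal (c i) * emeasure lborel (bad_points u t (\<rho> / 2 ^ i) x)"
        using that by (intro mult_left_mono) (auto simp: rough_set_def N_def \<kappa>_def)
      finally show ?thesis .
    qed
    then show "ennreal (2 ^ i) * indicator (rough_set u t \<rho> i) x
        \<le> ennreal (c i) * emeasure lborel (bad_points u t (\<rho> / 2 ^ i) x)"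
      by (auto simp: indicator_def)
  qed
  also have "\<dots> = (\<integral>\<^sup>+y. (\<Sum>i<n. ennreal (c i) * indicator (bad_points u t (\<rho> / 2 ^ i) x) y) \<partial>lborel)"
    by (subst nn_integral_sum) (auto simp: nn_integral_cmult)
  also have "\<dots> \<le> (\<integral>\<^sup>+y. ennreal (2 / \<kappa>) *
      (ennreal (\<rho> / dist x y ^ Suc N) * indicator (bad_points u t \<rho> x) y) \<partial>lborel)"
  proof (rule nn_integral_mono)
    fix y
    show "(\<Sum>i<n. ennreal (c i) * indicator (bad_points u t (\<rho> / 2 ^ i) x) y) \<le> ennreal (2 / \<kappa>) *
      (ennreal (\<rho> / dist x y ^ Suc N) * indicator (bad_points u t \<rho> x) y)"
    proof (cases "y \<in> bad_points u t \<rho> x")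
      case True
      then have xy: "dist x y > 0" using t by (auto simp: bad_points_def)
      define R where "R = (\<rho> / dist x y) ^ Suc N"
      have "(\<Sum>i<n. if dist x y < \<rho> / 2 ^ i then (2 ^ Suc N) ^ i else 0) \<le> 2 * R"
      proof (rule truncated_geometric_sum_le)
        fix i :: nat assume "dist x y < \<rho> / 2 ^ i"
        then have "2 ^ i \<le> \<rho> / dist x y" using xy by (simp add: field_simps)
        then have "(2 ^ i) ^ Suc N \<le> R" unfolding R_def by (intro power_mono) auto
        then show "(2 ^ Suc N) ^ i \<le> R" by (simp only: mult.commute flip: power_mult)
      qed (use \<rho> xy in \<open>auto simp: R_def\<close>)
      then have *: "(\<Sum>i<n. if dist x y < \<rho> / 2 ^ i then (2 ^ Suc N) ^ i else 0) / (\<kappa> * \<rho> ^ N)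
          \<le> 2 * R / (\<kappa> * \<rho> ^ N)"
        using \<kappa> \<rho> by (intro divide_right_mono) auto
      have "(\<Sum>i<n. ennreal (c i) * indicator (bad_points u t (\<rho> / 2 ^ i) x) y)
          = (\<Sum>i<n. ennreal (if dist x y < \<rho> / 2 ^ i then c i else 0))"
        using True by (intro sum.cong) (auto simp: bad_points_def indicator_def)
      also have "\<dots> = ennreal (\<Sum>i<n. if dist x y < \<rho> / 2 ^ i then c i else 0)"
        using c by (intro sum_ennreal) (auto simp: less_imp_le)
      also have "(\<Sum>i<n. if dist x y < \<rho> / 2 ^ i then c i else 0)
          = (\<Sum>i<n. if dist x y < \<rho> / 2 ^ i then (2 ^ Suc N) ^ i else 0) / (\<kappa> * \<rho> ^ N)"
        unfolding sum_divide_distrib by (intro sum.cong) (auto simp: c_eq)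
      also have "ennreal \<dots> \<le> ennreal (2 * R / (\<kappa> * \<rho> ^ N))" using * by (rule ennreal_leI)
      also have "2 * R / (\<kappa> * \<rho> ^ N) = (2 / \<kappa>) * (\<rho> / dist x y ^ Suc N)"
        using \<rho> by (simp add: R_def field_simps)
      also have "ennreal \<dots> = ennreal (2 / \<kappa>) * ennreal (\<rho> / dist x y ^ Suc N)"
        using \<kappa> \<rho> by (intro ennreal_mult) auto
      finally show ?thesis using True by simp
    next
      case False
      have "\<rho> / 2 ^ i \<le> \<rho>" for i using \<rho> by (simp add: divide_le_eq)
      then have "y \<notin> bad_points u t (\<rho> / 2 ^ i) x" for i
        using False order.strict_trans2 by (auto simp: bad_points_def)
      then show ?thesis using False by simp
    qed
  qed
  also have "\<dots> = ennreal (2 / \<kappa>) * oscillation u t \<rho> x"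
    unfolding oscillation_def N_def
    by (intro nn_integral_cmult) (auto simp: bad_points_def intro!: borel_measurable_times_ennreal)
  finally show ?thesis by (simp add: \<kappa>_def)
qed

text \<open>Only the last index \<open>k\<close> at which \<open>x\<close> is not fine matters:
  \<open>x\<close> is then rough at some \<open>i \<ge> k\<close>, and all terms together are at
  most \<open>2 * 2 ^ k \<le> 2 * 2 ^ i\<close>, twice a single term of the sum over rough
  sets.\<close>

lemma fine_sets_sum_le:
  fixes u :: "'a::euclidean_space \<Rightarrow> real"
  assumes "u \<in> borel_measurable borel" "\<rho> > 0" "t \<ge> 0"
  shows "(\<Sum>k<n. ennreal (2 ^ k) * indicator (- fine_set u t \<rho> k) x)
    \<le> ennreal (4 / density_threshold TYPE('a)) * oscillation u t \<rho> x"
proof (induction n)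
  case (Suc n)
  show ?case
  proof (cases "x \<in> fine_set u t \<rho> n")
    case False
    then obtain i where i: "i \<ge> n" "x \<in> rough_set u t \<rho> i" by (auto simp: fine_set_def)
    have "(\<Sum>k<Suc n. ennreal (2 ^ k) * indicator (- fine_set u t \<rho> k) x) \<le> (\<Sum>k\<le>n. ennreal (2 ^ k) * 1)"
      unfolding lessThan_Suc_atMost by (intro sum_mono mult_left_mono) (auto simp: indicator_def)
    also have "\<dots> = ennreal (\<Sum>k\<le>n. 2 ^ k)" by simp
    also have "\<dots> \<le> ennreal (2 * 2 ^ i)"
      by (intro ennreal_leI order.trans[OF geometric_sum_le_last] mult_left_mono power_increasing i) auto
    also have "\<dots> = 2 * (ennreal (2 ^ i) * indicator (rough_set u t \<rho> i) x)"
      using i by (simp add: ennreal_mult)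
    also have "\<dots> \<le> 2 * (\<Sum>i<Suc i. ennreal (2 ^ i) * indicator (rough_set u t \<rho> i) x)"
      by (intro mult_left_mono member_le_sum) auto
    also have "\<dots> \<le> 2 * (ennreal (2 / density_threshold TYPE('a)) * oscillation u t \<rho> x)"
      by (intro mult_left_mono rough_sets_sum_le assms) auto
    also have "\<dots> = ennreal (4 / density_threshold TYPE('a)) * oscillation u t \<rho> x"
      using density_threshold_pos[where 'a='a] by (simp add: mult.assoc[symmetric] ennreal_mult[symmetric] flip: ennreal_numeral)
    finally show ?thesis .
  qed (use Suc in simp)
qed auto

text \<open>Provides the decay \<open>2 ^ - k\<close> of the exceptional sets that makes
  Borel-Cantelli applicable to the end points of segments.\<close>

lemma emeasure_fine_set_compl_le:
  fixes u :: "'a::euclidean_space \<Rightarrow> real"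
  assumes [measurable]: "u \<in> borel_measurable borel" and "\<rho> > 0" "t \<ge> 0"
  shows "ennreal (2 ^ k) * emeasure lborel (- fine_set u t \<rho> k)
    \<le> ennreal (4 / density_threshold TYPE('a)) * (\<integral>\<^sup>+x. oscillation u t \<rho> x \<partial>lborel)"
proof -
  have "ennreal (2 ^ k) * emeasure lborel (- fine_set u t \<rho> k)
      = (\<integral>\<^sup>+x. ennreal (2 ^ k) * indicator (- fine_set u t \<rho> k) x \<partial>lborel)"
    by (simp add: nn_integral_cmult)
  also have "\<dots> \<le> (\<integral>\<^sup>+x. ennreal (4 / density_threshold TYPE('a)) * oscillation u t \<rho> x \<partial>lborel)"
  proof (rule nn_integral_mono)
    fix x
    have "ennreal (2 ^ k) * indicator (- fine_set u t \<rho> k) x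
        \<le> (\<Sum>k<Suc k. ennreal (2 ^ k) * indicator (- fine_set u t \<rho> k) x)"
      by (intro member_le_sum) auto
    also have "\<dots> \<le> ennreal (4 / density_threshold TYPE('a)) * oscillation u t \<rho> x"
      by (rule fine_sets_sum_le) fact+
    finally show "ennreal (2 ^ k) * indicator (- fine_set u t \<rho> k) x
        \<le> ennreal (4 / density_threshold TYPE('a)) * oscillation u t \<rho> x" .
  qed
  also have "\<dots> = ennreal (4 / density_threshold TYPE('a)) * (\<integral>\<^sup>+x. oscillation u t \<rho> x \<partial>lborel)"
    by (intro nn_integral_cmult) auto
  finally show ?thesis .
qed

text \<open>The sets of parameters \<open>r\<close> with \<open>x + r *\<^sub>R e\<close> fine form
  the hierarchy for the chain, and their weighted missed measure on the segment is bounded by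
  integrating the pointwise sum over scales. The constants are
  \<open>2 * t * \<tau> / (\<rho> / 4) = 8 * s * \<tau>\<close> and
  \<open>2 * t * 6 / (\<rho> / 4) * 4 = 192 * s\<close>, with \<open>t = s * \<rho>\<close>.\<close>

lemma increment_le_oscillation_on_segment:
  fixes u :: "'a::euclidean_space \<Rightarrow> real"
  assumes [measurable]: "u \<in> borel_measurable borel" and \<rho>: "\<rho> > 0" "\<rho> < 2 * \<tau>" and s: "s > 0"
    and e: "norm e = 1"
    and x: "x \<in> fine_set u (s * \<rho>) \<rho> K" "x + \<tau> *\<^sub>R e \<in> fine_set u (s * \<rho>) \<rho> K"
  shows "ennreal \<bar>u (x + \<tau> *\<^sub>R e) - u x\<bar> \<le> ennreal (2 * s * \<rho> * (1 + 24 * real K) + 8 * s * \<tau>)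
    + ennreal (192 * s / density_threshold TYPE('a)) *
      (\<integral>\<^sup>+r\<in>{0<..\<tau>}. oscillation u (s * \<rho>) \<rho> (x + r *\<^sub>R e) \<partial>lborel)"
proof -
  define \<kappa> where "\<kappa> = density_threshold TYPE('a)"
  have \<kappa>: "\<kappa> > 0" unfolding \<kappa>_def by (rule density_threshold_pos)
  define I where "I = (\<integral>\<^sup>+r\<in>{0<..\<tau>}. oscillation u (s * \<rho>) \<rho> (x + r *\<^sub>R e) \<partial>lborel)"
  define t where "t = s * \<rho>"
  have t: "t > 0" using s \<rho> by (simp add: t_def)
  define G where "G l = {r. x + r *\<^sub>R e \<in> fine_set u t \<rho> l}" for l
  have [measurable]: "G l \<in> sets borel" for l unfolding G_def by measurable
  show ?thesis
  proof (cases "I = \<infinity>")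
    case True
    then show ?thesis using \<kappa> s unfolding I_def[symmetric] \<kappa>_def[symmetric]
      by (simp add: ennreal_mult_top)
  next
    case False
    define S where "S = enn2real (ennreal (4 / \<kappa>) * I)"
    have S: "ennreal S = ennreal (4 / \<kappa>) * I"
      using False by (simp add: S_def ennreal_enn2real ennreal_mult_less_top less_top)
    have "(\<Sum>l<n. 2 ^ l * measure lborel ({0<..\<tau>} - G l)) \<le> S" for n
    proof -
      have "ennreal (\<Sum>l<n. 2 ^ l * measure lborel ({0<..\<tau>} - G l))
          = (\<Sum>l<n. ennreal (2 ^ l) * emeasure lborel ({0<..\<tau>} - G l))"
        by (subst sum_ennreal[symmetric])
           (auto simp: ennreal_mult emeasure_eq_measure2 fmeasurable_interval_Diff)
      also have "\<dots> = (\<integral>\<^sup>+r. (\<Sum>l<n. ennreal (2 ^ l) * indicator ({0<..\<tau>} - G l) r) \<partial>lborel)"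
        by (subst nn_integral_sum) (auto simp: nn_integral_cmult)
      also have "\<dots> \<le> (\<integral>\<^sup>+r. ennreal (4 / \<kappa>) * (oscillation u t \<rho> (x + r *\<^sub>R e) * indicator {0<..\<tau>} r) \<partial>lborel)"
      proof (rule nn_integral_mono)
        fix r
        show "(\<Sum>l<n. ennreal (2 ^ l) * indicator ({0<..\<tau>} - G l) r)
          \<le> ennreal (4 / \<kappa>) * (oscillation u t \<rho> (x + r *\<^sub>R e) * indicator {0<..\<tau>} r)"
        proof (cases "r \<in> {0<..\<tau>}")
          case True
          then have "(\<Sum>l<n. ennreal (2 ^ l) * indicator ({0<..\<tau>} - G l) r)
            = (\<Sum>l<n. ennreal (2 ^ l) * indicator (- fine_set u t \<rho> l) (x + r *\<^sub>R e))"
            by (intro sum.cong) (auto simp: G_def indicator_def)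
          also have "\<dots> \<le> ennreal (4 / \<kappa>) * oscillation u t \<rho> (x + r *\<^sub>R e)"
            unfolding \<kappa>_def using t \<rho> by (intro fine_sets_sum_le) auto
          finally show ?thesis using True by simp
        qed auto
      qed
      also have "\<dots> = ennreal S"
        unfolding S I_def t_def by (intro nn_integral_cmult) measurable
      finally show ?thesis by (simp add: S_def)
    qed
    \<comment> \<open>Fine points of level \<open>l\<close> are comparable up to distance
      \<open>\<rho> / 2 ^ l / 2\<close>, which is \<open>2 * h / 2 ^ l\<close> for
      \<open>h = \<rho> / 4\<close>; each step costs \<open>d = 2 * t\<close>. The zero multiple of
      \<open>e\<close> makes the left end an instance of the parametrisation.\<close>
    then have "\<bar>u (x + \<tau> *\<^sub>R e) - u (x + 0 *\<^sub>R e)\<bar> \<le>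
        (2 * t) * (1 + (\<tau> - 0) / (\<rho> / 4) + 24 * real K + 6 * S / (\<rho> / 4))"
    proof (intro chain_between_fine_points[where G = G and v = "\<lambda>r. u (x + r *\<^sub>R e)"])
      fix l r r' assume *: "r \<in> G l" "r' \<in> G l" "\<bar>r - r'\<bar> \<le> 2 * (\<rho> / 4) / 2 ^ l"
      have "dist (x + r *\<^sub>R e) (x + r' *\<^sub>R e) = \<bar>r - r'\<bar>"
        using e by (simp add: dist_norm flip: scaleR_diff_left)
      with * show "\<bar>u (x + r *\<^sub>R e) - u (x + r' *\<^sub>R e)\<bar> \<le> 2 * t"
        using \<rho> by (intro fine_set_close[of u \<rho> _ _ l]) (auto simp: G_def)
    next
      fix l show "G l \<subseteq> G (Suc l)" using fine_set_mono[of l "Suc l" u t \<rho>] by (auto simp: G_def)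
    qed (use x \<rho> t in \<open>auto simp: G_def t_def\<close>)
    also have "\<dots> = 2 * s * \<rho> * (1 + 24 * real K) + 8 * s * \<tau> + 48 * s * S"
      using \<rho> by (simp add: t_def field_simps)
    finally have "ennreal \<bar>u (x + \<tau> *\<^sub>R e) - u x\<bar>
        \<le> ennreal (2 * s * \<rho> * (1 + 24 * real K) + 8 * s * \<tau> + 48 * s * S)" by (intro ennreal_leI) simp
    also have "\<dots> = ennreal (2 * s * \<rho> * (1 + 24 * real K) + 8 * s * \<tau>) + ennreal (48 * s) * ennreal S"
      using s \<rho> by (simp add: ennreal_mult S_def)
    also have "ennreal (48 * s) * ennreal S = ennreal (192 * s / \<kappa>) * I"
      using s \<kappa> by (simp add: S mult.assoc[symmetric] ennreal_mult[symmetric])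
    finally show ?thesis by (simp add: I_def \<kappa>_def)
  qed
qed

subsection \<open>Increments in a fixed direction\<close>

definition inner_energy :: "real \<Rightarrow> real \<Rightarrow> real \<Rightarrow> ('a::euclidean_space \<Rightarrow> real) \<Rightarrow> 'a \<Rightarrow> ennreal" where
  "inner_energy p \<gamma> l u x = ennreal (l powr p) *
     (\<integral>\<^sup>+y\<in>{y. \<bar>u x - u y\<bar> / norm (x - y) powr (1 + \<gamma> / p) > l}.
        ennreal (norm (x - y) powr (\<gamma> - real DIM('a))) \<partial>lborel)"

lemma borel_measurable_inner_energy [measurable]:
  fixes u :: "'a::euclidean_space \<Rightarrow> real"
  assumes [measurable]: "u \<in> borel_measurable borel"
  shows "inner_energy p \<gamma> l u \<in> borel_measurable borel"
  unfolding inner_energy_def[abs_def] indicator_def by measurable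

text \<open>For Borel \<open>u\<close> the integrand is Borel on the product space, so the completed
  measure may be replaced by the product of the two Borel measures, and Tonelli applies.\<close>

lemma Phi_lambda_eq_inner_energy:
  fixes u :: "'a::euclidean_space \<Rightarrow> real"
  assumes [measurable]: "u \<in> borel_measurable borel"
  shows "Phi_lambda p \<gamma> l u = (\<integral>\<^sup>+x. inner_energy p \<gamma> l u x \<partial>lborel)"
proof -
  define S where "S = {(x, y). \<bar>u x - u y\<bar> / norm (x - y) powr (1 + \<gamma> / p) > l}"
  define f where "f = (\<lambda>z::'a \<times> 'a. (case z of (x, y) \<Rightarrow> ennreal (norm (x - y) powr (\<gamma> - real DIM('a)))) * indicator S z)"
  have [measurable]: "f \<in> borel_measurable (lborel \<Otimes>\<^sub>M lborel)"
    unfolding f_def S_def split_beta' indicator_def by measurable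
  have "Phi_lambda p \<gamma> l u = ennreal (l powr p) * (\<integral>\<^sup>+z. f z \<partial>lebesgue)"
    by (simp add: Phi_lambda_def f_def S_def)
  also have "(\<integral>\<^sup>+z. f z \<partial>lebesgue) = (\<integral>\<^sup>+z. f z \<partial>(lborel \<Otimes>\<^sub>M lborel))"
    by (simp add: nn_integral_completion lborel_prod)
  also have "\<dots> = (\<integral>\<^sup>+x. \<integral>\<^sup>+y. f (x, y) \<partial>lborel \<partial>lborel)"
    by (rule lborel.nn_integral_fst[symmetric]) measurable
  also have "ennreal (l powr p) * \<dots> = (\<integral>\<^sup>+x. ennreal (l powr p) * (\<integral>\<^sup>+y. f (x, y) \<partial>lborel) \<partial>lborel)"
    by (rule nn_integral_cmult[symmetric]) measurable
  also have "\<dots> = (\<integral>\<^sup>+x. inner_energy p \<gamma> l u x \<partial>lborel)"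
    by (simp add: inner_energy_def f_def S_def indicator_def)
  finally show ?thesis .
qed

text \<open>The integrands differ only where one of the two coordinates lies in a null set of the
  factor, and such pairs form a null set of the product.\<close>

lemma Phi_lambda_cong_AE:
  fixes u v :: "'a::euclidean_space \<Rightarrow> real"
  assumes "AE x in lborel. u x = v x"
  shows "Phi_lambda p \<gamma> l u = Phi_lambda p \<gamma> l v"
proof -
  obtain N where N: "N \<in> null_sets lborel" "{x. u x \<noteq> v x} \<subseteq> N"
    using assms by (auto elim!: AE_E2 simp: eventually_ae_filter)
  then have [measurable]: "N \<in> sets borel" by auto
  have "AE z in lborel \<Otimes>\<^sub>M lborel. fst z \<notin> N \<and> snd z \<notin> N"
  proof (rule lborel_pair.AE_pair_measure)
    show "AE x in lborel. AE y in lborel. fst (x, y) \<notin> N \<and> snd (x, y) \<notin> N"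
      by (rule eventually_mono[OF AE_not_in[OF N(1)]]) (use AE_not_in[OF N(1)] in simp)
  qed measurable
  then have "AE z in lebesgue. fst z \<notin> N \<and> snd z \<notin> N"
    unfolding lborel_prod by (rule AE_completion)
  then have "AE z in lebesgue. u (fst z) = v (fst z) \<and> u (snd z) = v (snd z)"
    by (rule AE_mp) (use N(2) in auto)
  then show ?thesis
    unfolding Phi_lambda_def by (intro arg_cong2[where f = "(*)"] refl nn_integral_cong_AE) (auto simp: indicator_def)
qed

text \<open>Both bounds on \<open>\<gamma>\<close> enter here. For \<open>r < \<rho>\<close> the
  exponent \<open>1 + \<gamma> / p\<close> is nonnegative, so
  \<open>l * r powr (1 + \<gamma> / p) \<le> s * \<rho>\<close> and bad points lie in the domain of
  integration. Since \<open>\<rho> / r > 1\<close> and \<open>- \<gamma> \<ge> 1\<close>, also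
  \<open>\<rho> / r \<le> (\<rho> / r) powr (- \<gamma>)\<close>, and
  \<open>s powr p * \<rho> powr (- \<gamma>)\<close> is exactly \<open>l powr p\<close>. No constant
  depending on \<open>\<gamma>\<close> is lost.\<close>

lemma oscillation_le_inner_energy:
  fixes u :: "'a::euclidean_space \<Rightarrow> real"
  assumes [measurable]: "u \<in> borel_measurable borel" and p: "1 \<le> p" "- p \<le> \<gamma>" "\<gamma> \<le> -1"
    and \<rho>: "\<rho> > 0" and s: "s > 0" and l: "l = s * \<rho> powr (- \<gamma> / p)"
  shows "ennreal (s powr p) * oscillation u (s * \<rho>) \<rho> x \<le> inner_energy p \<gamma> l u x"
proof -
  define N where "N = DIM('a)"
  have "ennreal (s powr p) * oscillation u (s * \<rho>) \<rho> x = (\<integral>\<^sup>+y. ennreal (s powr p) *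
     (ennreal (\<rho> / dist x y ^ Suc N) * indicator (bad_points u (s * \<rho>) \<rho> x) y) \<partial>lborel)"
    unfolding oscillation_def N_def by (subst nn_integral_cmult) auto
  also have "\<dots> \<le> (\<integral>\<^sup>+y. ennreal (l powr p) * (ennreal (norm (x - y) powr (\<gamma> - real N)) *
      indicator {y. \<bar>u x - u y\<bar> / norm (x - y) powr (1 + \<gamma> / p) > l} y) \<partial>lborel)"
  proof (rule nn_integral_mono)
    fix y
    show "ennreal (s powr p) * (ennreal (\<rho> / dist x y ^ Suc N) * indicator (bad_points u (s * \<rho>) \<rho> x) y)
      \<le> ennreal (l powr p) * (ennreal (norm (x - y) powr (\<gamma> - real N)) *
        indicator {y. \<bar>u x - u y\<bar> / norm (x - y) powr (1 + \<gamma> / p) > l} y)"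
    proof (cases "y \<in> bad_points u (s * \<rho>) \<rho> x")
      case True
      define r where "r = norm (x - y)"
      have y: "r < \<rho>" "s * \<rho> < \<bar>u x - u y\<bar>" using True by (auto simp: bad_points_def r_def dist_norm)
      have "0 < s * \<rho>" using s \<rho> by simp
      then have "x \<noteq> y" using y(2) by (metis abs_zero diff_self less_asym)
      then have r: "r > 0" by (simp add: r_def)
      have "l * r powr (1 + \<gamma> / p) \<le> s * \<rho> powr (- \<gamma> / p) * \<rho> powr (1 + \<gamma> / p)"
        unfolding l using p r y s by (intro mult_left_mono powr_mono2) (auto simp: field_simps)
      also have "\<dots> = s * \<rho>" using \<rho> by (simp add: mult.assoc flip: powr_add)
      also note y(2)
      finally have mem: "\<bar>u x - u y\<bar> / r powr (1 + \<gamma> / p) > l" using r by (simp add: pos_less_divide_eq)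
      have "\<rho> / r ^ Suc N = (\<rho> / r) powr 1 * r powr (- real N)"
        using r \<rho> by (simp add: powr_minus powr_realpow divide_simps)
      also have "\<dots> \<le> (\<rho> / r) powr (- \<gamma>) * r powr (- real N)"
        using r \<rho> y p by (intro mult_right_mono powr_mono) auto
      also have "\<dots> = \<rho> powr (- \<gamma>) * r powr (\<gamma> - real N)"
        using r \<rho> by (simp add: powr_divide powr_diff powr_minus field_simps)
      finally have "s powr p * (\<rho> / r ^ Suc N) \<le> s powr p * (\<rho> powr (- \<gamma>) * r powr (\<gamma> - real N))"
        by (intro mult_left_mono) auto
      also have "\<dots> = l powr p * r powr (\<gamma> - real N)"
        using s \<rho> p by (simp add: l powr_mult powr_powr)
      finally have "ennreal (s powr p * (\<rho> / r ^ Suc N)) \<le> ennreal (l powr p * r powr (\<gamma> - real N))"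
        by (rule ennreal_leI)
      then have "ennreal (s powr p) * ennreal (\<rho> / r ^ Suc N) \<le> ennreal (l powr p) * ennreal (r powr (\<gamma> - real N))"
        using \<rho> r by (subst (1 2) ennreal_mult[symmetric]) auto
      then show ?thesis using True mem by (simp add: r_def dist_norm)
    qed simp
  qed
  also have "\<dots> = inner_energy p \<gamma> l u x"
    unfolding inner_energy_def N_def indicator_def by (rule nn_integral_cmult) measurable
  finally show ?thesis .
qed

section \<open>Translations and the passage to the limit along segments\<close>

lemma AE_shift:
  fixes c :: "'a::euclidean_space"
  assumes "AE x in lborel. P x"
  shows "AE x in lborel. P (x + c)"
proof -
  obtain N where N: "N \<in> null_sets lborel" "{x. \<not> P x} \<subseteq> N"
    using assms by (auto simp: eventually_ae_filter)
  then have [measurable]: "N \<in> sets borel" by auto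
  have "AE x in distr lborel borel ((+) c). x \<notin> N" using AE_not_in[OF N(1)] by (subst lborel_distr_plus)
  then have "AE x in lborel. c + x \<notin> N" by (subst (asm) AE_distr_iff) auto
  then show ?thesis by (rule AE_mp) (use N(2) in \<open>auto simp: add.commute\<close>)
qed

lemma nn_integral_shift:
  fixes c :: "'a::euclidean_space"
  assumes [measurable]: "f \<in> borel_measurable borel"
  shows "(\<integral>\<^sup>+x. f (x + c) \<partial>lborel) = (\<integral>\<^sup>+x. f x \<partial>lborel)"
proof -
  have "(\<integral>\<^sup>+x. f x \<partial>lborel) = (\<integral>\<^sup>+x. f x \<partial>distr lborel borel ((+) c))"
    by (simp add: lborel_distr_plus)
  also have "\<dots> = (\<integral>\<^sup>+x. f (c + x) \<partial>lborel)" by (intro nn_integral_distr) auto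
  finally show ?thesis by (simp add: add.commute)
qed

lemma ennreal_le_add_cmult_liminf:
  fixes a :: "nat \<Rightarrow> real" and X :: "nat \<Rightarrow> ennreal"
  assumes ev: "\<forall>\<^sub>F j in sequentially. D \<le> ennreal (a j) + ennreal c * X j"
    and a: "a \<longlonglongrightarrow> a0" and a0: "a0 \<ge> 0"
  shows "D \<le> ennreal a0 + ennreal c * liminf X"
proof (rule ennreal_le_epsilon)
  fix \<epsilon> :: real assume \<epsilon>: "\<epsilon> > 0"
  have "\<forall>\<^sub>F j in sequentially. a j < a0 + \<epsilon>" using a \<epsilon> by (intro order_tendstoD) auto
  with ev have "\<forall>\<^sub>F j in sequentially. D \<le> ennreal (a0 + \<epsilon>) + ennreal c * X j"
  proof eventually_elim
    case (elim j)
    then have "ennreal (a j) \<le> ennreal (a0 + \<epsilon>)" by (intro ennreal_leI) auto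
    with elim(1) show ?case by (meson add_right_mono order_trans)
  qed
  then have "D \<le> liminf (\<lambda>j. ennreal (a0 + \<epsilon>) + ennreal c * X j)" by (rule Liminf_bounded)
  also have "\<dots> = ennreal (a0 + \<epsilon>) + liminf (\<lambda>j. ennreal c * X j)"
    by (rule Liminf_const_add) simp
  also have "liminf (\<lambda>j. ennreal c * X j) = ennreal c * liminf X"
    by (intro Liminf_compose_continuous_mono[where f = "\<lambda>x. ennreal c * x"] monoI mult_left_mono)
       (auto intro!: ennreal_continuous_on_cmult)
  finally show "D \<le> ennreal a0 + ennreal c * liminf X + ennreal \<epsilon>"
    using a0 \<epsilon> by (simp add: ac_simps)
qed

text \<open>The chain estimate is used at scale \<open>\<rho> j\<close> with end points fine at
  level \<open>K = j\<close>. The exceptional sets have measure at most \<open>B / 2 ^ j\<close>, so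
  almost every \<open>x\<close> and its translate are both eventually admissible, while the
  end-point cost tends to \<open>0\<close>. The exceptional null set depends on
  \<open>s\<close>.\<close>

lemma AE_increment_le_liminf:
  fixes u :: "'a::euclidean_space \<Rightarrow> real" and l :: "nat \<Rightarrow> real"
  assumes [measurable]: "u \<in> borel_measurable borel" and p: "1 \<le> p" "- p \<le> \<gamma>" "\<gamma> \<le> -1"
    and l: "\<And>j. 0 < l j" "\<And>j. l j \<le> 1 / real (Suc j) ^ 2"
    and A: "A < \<infinity>" "\<And>j. Phi_lambda p \<gamma> (l j) u \<le> A"
    and e: "norm e = 1" and \<tau>: "\<tau> > 0" and s: "s > 0"
  shows "AE x in lborel. ennreal \<bar>u (x + \<tau> *\<^sub>R e) - u x\<bar> \<le> ennreal (8 * s * \<tau>)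
    + ennreal (192 / density_threshold TYPE('a) * s powr (1 - p)) *
      liminf (\<lambda>j. \<integral>\<^sup>+r\<in>{0<..\<tau>}. inner_energy p \<gamma> (l j) u (x + r *\<^sub>R e) \<partial>lborel)"
proof -
  define \<kappa> where "\<kappa> = density_threshold TYPE('a)"
  have \<kappa>: "\<kappa> > 0" unfolding \<kappa>_def by (rule density_threshold_pos)
  define b where "b = - \<gamma> / p"
  have b: "0 < b" "b \<le> 1" using p by (auto simp: b_def field_simps)
  \<comment> \<open>Solves \<open>l j = s * \<rho> j powr b\<close>. As \<open>1 / b \<ge> 1\<close>
    and \<open>l j \<le> 1\<close>, the scales are bounded by a constant times \<open>l j\<close>
    and inherit its quadratic decay.\<close>
  define \<rho> where "\<rho> j = (l j / s) powr (1 / b)" for j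
  have \<rho>: "\<rho> j > 0" for j using l(1)[of j] s by (simp add: \<rho>_def)
  have l_eq: "l j = s * \<rho> j powr (- \<gamma> / p)" for j
    unfolding b_def[symmetric] using b(1) s l(1)[of j] by (simp add: \<rho>_def powr_powr)
  have osc: "oscillation u (s * \<rho> j) (\<rho> j) x \<le> ennreal (s powr - p) * inner_energy p \<gamma> (l j) u x" for j x
  proof -
    have "oscillation u (s * \<rho> j) (\<rho> j) x
        = ennreal (s powr - p) * (ennreal (s powr p) * oscillation u (s * \<rho> j) (\<rho> j) x)"
      using s by (simp add: mult.assoc[symmetric] ennreal_mult[symmetric] flip: powr_add)
    also have "\<dots> \<le> ennreal (s powr - p) * inner_energy p \<gamma> (l j) u x"
      by (intro mult_left_mono oscillation_le_inner_energy p \<rho> s l_eq) auto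
    finally show ?thesis .
  qed
  have \<rho>_le: "\<rho> j \<le> (1 / s) powr (1 / b) / real (Suc j) ^ 2" for j
  proof -
    have "\<rho> j = (1 / s) powr (1 / b) * l j powr (1 / b)"
      using s l(1)[of j] by (simp add: \<rho>_def powr_divide)
    also have "l j powr (1 / b) \<le> l j powr 1"
    proof (rule powr_mono')
      have "1 / real (Suc j) ^ 2 \<le> 1" by (simp add: divide_le_eq)
      then show "l j \<le> 1" using l(2)[of j] by linarith
    qed (use b l(1)[of j] in auto)
    also have "\<dots> \<le> 1 / real (Suc j) ^ 2" using l[of j] by simp
    finally show ?thesis by (simp add: mult_left_mono)
  qed
  \<comment> \<open>The end-point cost for \<open>K = j\<close>: the quadratic decay of the scales
    beats the linear growth of the number of extra steps.\<close>
  have lim1: "(\<lambda>j. 2 * s * \<rho> j * (1 + 24 * real j)) \<longlonglongrightarrow> 0"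
  proof (rule tendsto_sandwich[OF _ _ tendsto_const])
    show "\<forall>\<^sub>F j in sequentially. 0 \<le> 2 * s * \<rho> j * (1 + 24 * real j)"
      using s \<rho> by (auto simp: less_imp_le)
    define c where "c = 48 * s * (1 / s) powr (1 / b)"
    show "\<forall>\<^sub>F j in sequentially. 2 * s * \<rho> j * (1 + 24 * real j) \<le> c * (1 / real (Suc j))"
    proof (rule always_eventually, rule allI)
      fix j
      have "2 * s * \<rho> j * (1 + 24 * real j) \<le> 2 * s * ((1 / s) powr (1 / b) / real (Suc j) ^ 2) * (24 * real (Suc j))"
        using s \<rho>_le[of j] by (intro mult_mono mult_left_mono) auto
      also have "\<dots> = c * (1 / real (Suc j))"
        by (simp add: c_def power2_eq_square del: of_nat_Suc)
      finally show "2 * s * \<rho> j * (1 + 24 * real j) \<le> c * (1 / real (Suc j))" .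
    qed
    show "(\<lambda>j. c * (1 / real (Suc j))) \<longlonglongrightarrow> 0"
      by (rule tendsto_mult_right_zero) (use LIMSEQ_inverse_real_of_nat in \<open>simp add: inverse_eq_divide\<close>)
  qed
  have lim0: "\<rho> \<longlonglongrightarrow> 0"
  proof (rule tendsto_sandwich[OF _ _ tendsto_const])
    show "\<forall>\<^sub>F j in sequentially. 0 \<le> \<rho> j" using \<rho> by (auto simp: less_imp_le)
    show "\<forall>\<^sub>F j in sequentially. \<rho> j \<le> 2 * s * \<rho> j * (1 + 24 * real j) * (1 / (2 * s))"
      using s \<rho> by (auto simp: algebra_simps less_imp_le)
    show "(\<lambda>j. 2 * s * \<rho> j * (1 + 24 * real j) * (1 / (2 * s))) \<longlonglongrightarrow> 0"
      using tendsto_mult_left_zero[OF lim1, of "1 / (2 * s)"] by simp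
  qed
  define B where "B = 4 / \<kappa> * s powr - p * enn2real A"
  have meas_le: "emeasure lborel (- fine_set u (s * \<rho> j) (\<rho> j) j) \<le> ennreal (B * (1 / 2) ^ j)" for j
  proof -
    have "(\<integral>\<^sup>+x. oscillation u (s * \<rho> j) (\<rho> j) x \<partial>lborel)
        \<le> (\<integral>\<^sup>+x. ennreal (s powr - p) * inner_energy p \<gamma> (l j) u x \<partial>lborel)"
      by (intro nn_integral_mono osc)
    also have "\<dots> = ennreal (s powr - p) * Phi_lambda p \<gamma> (l j) u"
      by (subst nn_integral_cmult) (auto simp: Phi_lambda_eq_inner_energy)
    also have "\<dots> \<le> ennreal (s powr - p) * A" by (intro mult_left_mono A) auto
    also have "A = ennreal (enn2real A)" using A by (simp add: ennreal_enn2real less_top)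
    finally have *: "ennreal (4 / \<kappa>) * (\<integral>\<^sup>+x. oscillation u (s * \<rho> j) (\<rho> j) x \<partial>lborel)
      \<le> ennreal (4 / \<kappa>) * (ennreal (s powr - p) * ennreal (enn2real A))"
      by (intro mult_left_mono) auto
    have "emeasure lborel (- fine_set u (s * \<rho> j) (\<rho> j) j)
       = ennreal ((1 / 2) ^ j) * (ennreal (2 ^ j) * emeasure lborel (- fine_set u (s * \<rho> j) (\<rho> j) j))"
      by (simp add: mult.assoc[symmetric] ennreal_mult[symmetric] flip: power_mult_distrib)
    also have "\<dots> \<le> ennreal ((1 / 2) ^ j) * (ennreal (4 / \<kappa>) * (ennreal (s powr - p) * ennreal (enn2real A)))"
    proof (intro mult_left_mono)
      have "ennreal (2 ^ j) * emeasure lborel (- fine_set u (s * \<rho> j) (\<rho> j) j)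
          \<le> ennreal (4 / \<kappa>) * (\<integral>\<^sup>+x. oscillation u (s * \<rho> j) (\<rho> j) x \<partial>lborel)"
        unfolding \<kappa>_def using \<rho>[of j] s by (intro emeasure_fine_set_compl_le) auto
      with * show "ennreal (2 ^ j) * emeasure lborel (- fine_set u (s * \<rho> j) (\<rho> j) j)
          \<le> ennreal (4 / \<kappa>) * (ennreal (s powr - p) * ennreal (enn2real A))" by order
    qed auto
    also have "\<dots> = ennreal (B * (1 / 2) ^ j)"
      using \<kappa> by (simp add: B_def ennreal_mult[symmetric] ac_simps)
    finally show ?thesis .
  qed
  have "AE x in lborel. \<forall>\<^sub>F j in sequentially. x \<in> space lborel - (- fine_set u (s * \<rho> j) (\<rho> j) j)"
  proof (rule borel_cantelli_AE1)
    fix j show "emeasure lborel (- fine_set u (s * \<rho> j) (\<rho> j) j) < \<infinity>"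
      using meas_le[of j] by (rule order.strict_trans1) simp
  next
    have B: "B \<ge> 0" using \<kappa> by (simp add: B_def)
    have "summable (\<lambda>j. B * (1 / 2) ^ j)" by (intro summable_mult summable_geometric) simp
    then show "summable (\<lambda>j. measure lborel (- fine_set u (s * \<rho> j) (\<rho> j) j))"
      using B meas_le by (rule_tac summable_comparison_test'[where N = 0 and g = "\<lambda>j. B * (1 / 2) ^ j"])
        (auto simp: measure_def intro!: enn2real_leI)
  qed auto
  then have fine: "AE x in lborel. \<forall>\<^sub>F j in sequentially. x \<in> fine_set u (s * \<rho> j) (\<rho> j) j" by simp
  from AE_shift[OF this, of "\<tau> *\<^sub>R e"] fine show ?thesis
  proof eventually_elim
    case (elim x)
    have "\<forall>\<^sub>F j in sequentially. \<rho> j < 2 * \<tau>" using lim0 \<tau> by (intro order_tendstoD(2)[of _ 0]) auto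
    with elim have "\<forall>\<^sub>F j in sequentially. ennreal \<bar>u (x + \<tau> *\<^sub>R e) - u x\<bar> \<le>
      ennreal (2 * s * \<rho> j * (1 + 24 * real j) + 8 * s * \<tau>)
      + ennreal (192 / \<kappa> * s powr (1 - p)) * (\<integral>\<^sup>+r\<in>{0<..\<tau>}. inner_energy p \<gamma> (l j) u (x + r *\<^sub>R e) \<partial>lborel)"
    proof eventually_elim
      case (elim j)
      have "(\<integral>\<^sup>+r\<in>{0<..\<tau>}. oscillation u (s * \<rho> j) (\<rho> j) (x + r *\<^sub>R e) \<partial>lborel) \<le>
        (\<integral>\<^sup>+r. ennreal (s powr - p) * (inner_energy p \<gamma> (l j) u (x + r *\<^sub>R e) * indicator {0<..\<tau>} r) \<partial>lborel)"
        using osc by (intro nn_integral_mono) (auto simp: indicator_def)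
      also have "\<dots> = ennreal (s powr - p) * (\<integral>\<^sup>+r\<in>{0<..\<tau>}. inner_energy p \<gamma> (l j) u (x + r *\<^sub>R e) \<partial>lborel)"
        by (rule nn_integral_cmult) measurable
      finally have "ennreal (192 * s / \<kappa>) *
          (\<integral>\<^sup>+r\<in>{0<..\<tau>}. oscillation u (s * \<rho> j) (\<rho> j) (x + r *\<^sub>R e) \<partial>lborel)
        \<le> ennreal (192 * s / \<kappa>) * (ennreal (s powr - p) *
          (\<integral>\<^sup>+r\<in>{0<..\<tau>}. inner_energy p \<gamma> (l j) u (x + r *\<^sub>R e) \<partial>lborel))"
        by (intro mult_left_mono) auto
      also have "\<dots> = ennreal (192 * s / \<kappa> * s powr - p) *
          (\<integral>\<^sup>+r\<in>{0<..\<tau>}. inner_energy p \<gamma> (l j) u (x + r *\<^sub>R e) \<partial>lborel)"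
        using s \<kappa> by (simp add: mult.assoc[symmetric] ennreal_mult[symmetric])
      also have "192 * s / \<kappa> * s powr - p = 192 / \<kappa> * s powr (1 - p)"
        using s by (simp add: powr_diff powr_minus divide_inverse)
      finally show ?case
        using increment_le_oscillation_on_segment[of u "\<rho> j" \<tau> s e x j] elim \<rho>[of j] s e
        by (auto simp: \<kappa>_def intro: order.trans add_left_mono)
    qed
    moreover have "(\<lambda>j. 2 * s * \<rho> j * (1 + 24 * real j) + 8 * s * \<tau>) \<longlonglongrightarrow> 8 * s * \<tau>"
      using tendsto_add[OF lim1 tendsto_const] by simp
    ultimately show ?case
      unfolding \<kappa>_def using s \<tau> by (intro ennreal_le_add_cmult_liminf) auto
  qed
qed

text \<open>Taking \<open>s\<close> slightly below \<open>D / (16 * \<tau>)\<close> absorbs the first term; rational \<open>s\<close> suffice, so the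
  bounds may hold almost everywhere for each \<open>s\<close>.\<close>

lemma powr_le_of_rational_bounds:
  fixes L :: ennreal
  assumes D: "D \<ge> 0" and c: "c > 0" and \<tau>: "\<tau> > 0" and p: "p \<ge> 1"
    and le: "\<And>s. s \<in> \<rat> \<Longrightarrow> s > 0 \<Longrightarrow> ennreal D \<le> ennreal (8 * s * \<tau>) + ennreal (c * s powr (1 - p)) * L"
  shows "ennreal (D powr p) \<le> ennreal (2 * c * (32 * \<tau>) powr (p - 1)) * L"
proof (cases "D = 0 \<or> L = \<infinity>")
  case True
  then show ?thesis using c \<tau> p by (auto simp: ennreal_mult_top)
next
  case False
  then have D: "D > 0" and "L \<noteq> \<infinity>" using D by auto
  then obtain M where M: "L = ennreal M" "M \<ge> 0" by (cases L) auto
  \<comment> \<open>The upper end gives \<open>8 * s * \<tau> \<le> D / 2\<close>, which is absorbed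
    on the left. The lower end gives \<open>D \<le> 32 * \<tau> * s\<close>, which converts the
    remaining power of \<open>s\<close> back into \<open>D powr (p - 1)\<close>.\<close>
  have "D / (32 * \<tau>) < D / (16 * \<tau>)" using D \<tau> by (intro divide_strict_left_mono) auto
  from Rats_dense_in_real[OF this] obtain s where s: "s \<in> \<rat>" "D / (32 * \<tau>) < s" "s < D / (16 * \<tau>)" by auto
  have "0 < D / (32 * \<tau>)" using D \<tau> by simp
  then have s0: "s > 0" using s by linarith
  have "D \<le> 8 * s * \<tau> + c * s powr (1 - p) * M"
    using le[OF s(1) s0] M c s0 \<tau> by (simp add: ennreal_mult[symmetric] ennreal_plus[symmetric] del: ennreal_plus)
  moreover have "8 * s * \<tau> \<le> D / 2" using s \<tau> by (simp add: field_simps)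
  ultimately have "D \<le> 2 * c * s powr (1 - p) * M" by linarith
  then have "D * s powr (p - 1) \<le> 2 * c * s powr (1 - p) * M * s powr (p - 1)"
    by (intro mult_right_mono) auto
  also have "\<dots> = 2 * c * M * (s powr (1 - p) * s powr (p - 1))" by (simp add: ac_simps)
  also have "\<dots> = 2 * c * M" using s0 by (simp flip: powr_add)
  finally have 1: "D * s powr (p - 1) \<le> 2 * c * M" .
  have "D powr p = D * D powr (p - 1)" using D by (simp add: powr_diff)
  also have "\<dots> \<le> D * (32 * \<tau> * s) powr (p - 1)"
    using D s \<tau> p by (intro mult_left_mono powr_mono2) (auto simp: field_simps)
  also have "\<dots> = (32 * \<tau>) powr (p - 1) * (D * s powr (p - 1))"
    using \<tau> s0 by (simp add: powr_mult)
  also have "\<dots> \<le> (32 * \<tau>) powr (p - 1) * (2 * c * M)" using 1 by (intro mult_left_mono) auto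
  finally have "ennreal (D powr p) \<le> ennreal (2 * c * (32 * \<tau>) powr (p - 1) * M)"
    by (intro ennreal_leI) (simp add: ac_simps)
  then show ?thesis using M c by (simp add: ennreal_mult)
qed

text \<open>Rational values of \<open>s\<close> leave a single null set, after which
  \<open>s\<close> may depend on the point. Fatou moves the lower limit outside. By Tonelli and
  translation invariance the energy of the segments integrates to \<open>\<tau>\<close> times the
  full energy, which completes \<open>\<tau> powr (p - 1)\<close> to
  \<open>\<tau> powr p\<close>.\<close>

lemma integral_increment_powr_le:
  fixes u :: "'a::euclidean_space \<Rightarrow> real" and l :: "nat \<Rightarrow> real"
  assumes [measurable]: "u \<in> borel_measurable borel" and p: "1 \<le> p" "- p \<le> \<gamma>" "\<gamma> \<le> -1"
    and l: "\<And>j. 0 < l j" "\<And>j. l j \<le> 1 / real (Suc j) ^ 2"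
    and A: "A < \<infinity>" "\<And>j. Phi_lambda p \<gamma> (l j) u \<le> A"
    and e: "norm e = 1" and \<tau>: "\<tau> > 0"
  shows "(\<integral>\<^sup>+x. ennreal (\<bar>u (x + \<tau> *\<^sub>R e) - u x\<bar> powr p) \<partial>lborel)
    \<le> ennreal (384 / density_threshold TYPE('a) * 32 powr (p - 1) * \<tau> powr p) * A"
proof -
  define c where "c = 192 / density_threshold TYPE('a)"
  have c: "c > 0" using density_threshold_pos[where 'a='a] by (simp add: c_def)
  define X where "X j x = (\<integral>\<^sup>+r\<in>{0<..\<tau>}. inner_energy p \<gamma> (l j) u (x + r *\<^sub>R e) \<partial>lborel)" for j x
  define C where "C = 2 * c * (32 * \<tau>) powr (p - 1)"
  have [measurable]: "X j \<in> borel_measurable borel" for j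
    unfolding X_def[abs_def] by measurable
  have "AE x in lborel. \<forall>s\<in>{s\<in>\<rat>. s > 0}. ennreal \<bar>u (x + \<tau> *\<^sub>R e) - u x\<bar> \<le> ennreal (8 * s * \<tau>)
    + ennreal (c * s powr (1 - p)) * liminf (\<lambda>j. X j x)"
    unfolding X_def c_def
  proof (rule AE_ball_countable')
    show "countable {s::real \<in> \<rat>. s > 0}" by (rule countable_subset[OF _ countable_rat]) auto
  qed (use AE_increment_le_liminf[OF assms] in auto)
  then have "AE x in lborel. ennreal (\<bar>u (x + \<tau> *\<^sub>R e) - u x\<bar> powr p) \<le> ennreal C * liminf (\<lambda>j. X j x)"
    unfolding C_def by eventually_elim (use c \<tau> p in \<open>intro powr_le_of_rational_bounds, auto\<close>)
  then have "(\<integral>\<^sup>+x. ennreal (\<bar>u (x + \<tau> *\<^sub>R e) - u x\<bar> powr p) \<partial>lborel)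
      \<le> (\<integral>\<^sup>+x. ennreal C * liminf (\<lambda>j. X j x) \<partial>lborel)" by (rule nn_integral_mono_AE)
  also have "\<dots> = ennreal C * (\<integral>\<^sup>+x. liminf (\<lambda>j. X j x) \<partial>lborel)"
    by (rule nn_integral_cmult) measurable
  also have "\<dots> \<le> ennreal C * liminf (\<lambda>j. \<integral>\<^sup>+x. X j x \<partial>lborel)"
    by (intro mult_left_mono nn_integral_liminf) auto
  also have "\<dots> \<le> ennreal C * (ennreal \<tau> * A)"
  proof (intro mult_left_mono)
    have "(\<integral>\<^sup>+x. X j x \<partial>lborel) \<le> ennreal \<tau> * A" for j
    proof -
      have "(\<integral>\<^sup>+x. X j x \<partial>lborel) =
          (\<integral>\<^sup>+r. (\<integral>\<^sup>+x. inner_energy p \<gamma> (l j) u (x + r *\<^sub>R e) * indicator {0<..\<tau>} r \<partial>lborel) \<partial>lborel)"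
        unfolding X_def by (rule lborel_pair.Fubini') measurable
      also have "\<dots> = (\<integral>\<^sup>+r. Phi_lambda p \<gamma> (l j) u * indicator {0<..\<tau>} r \<partial>lborel)"
      proof (rule nn_integral_cong)
        fix r
        have "(\<integral>\<^sup>+x. inner_energy p \<gamma> (l j) u (x + r *\<^sub>R e) * indicator {0<..\<tau>} r \<partial>lborel)
            = (\<integral>\<^sup>+x. inner_energy p \<gamma> (l j) u (x + r *\<^sub>R e) \<partial>lborel) * indicator {0<..\<tau>} r"
          by (rule nn_integral_multc) measurable
        also have "(\<integral>\<^sup>+x. inner_energy p \<gamma> (l j) u (x + r *\<^sub>R e) \<partial>lborel) = Phi_lambda p \<gamma> (l j) u"
          by (subst nn_integral_shift) (auto simp: Phi_lambda_eq_inner_energy)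
        finally show "(\<integral>\<^sup>+x. inner_energy p \<gamma> (l j) u (x + r *\<^sub>R e) * indicator {0<..\<tau>} r \<partial>lborel)
            = Phi_lambda p \<gamma> (l j) u * indicator {0<..\<tau>} r" .
      qed
      also have "\<dots> = Phi_lambda p \<gamma> (l j) u * ennreal \<tau>"
        using \<tau> by (subst nn_integral_cmult_indicator) auto
      also have "\<dots> \<le> A * ennreal \<tau>" by (intro mult_right_mono A) auto
      finally show ?thesis by (simp add: mult.commute)
    qed
    then show "liminf (\<lambda>j. \<integral>\<^sup>+x. X j x \<partial>lborel) \<le> ennreal \<tau> * A"
      by (intro order.trans[OF Liminf_mono Liminf_const[THEN eq_refl]]) auto
  qed auto
  also have "ennreal C * (ennreal \<tau> * A) = ennreal (C * \<tau>) * A"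
    using c \<tau> by (simp add: C_def mult.assoc[symmetric] ennreal_mult[symmetric])
  also have "C * \<tau> = 384 / density_threshold TYPE('a) * 32 powr (p - 1) * (\<tau> powr (p - 1) * \<tau>)"
    using \<tau> by (simp add: C_def c_def powr_mult)
  also have "\<tau> powr (p - 1) * \<tau> = \<tau> powr p" using \<tau> by (simp add: powr_diff)
  finally show ?thesis .
qed

subsection \<open>Difference quotients and test functions\<close>

text \<open>For \<open>p \<ge> 1\<close> one has
  \<open>\<bar>a\<bar> \<le> 1 + \<bar>a\<bar> powr p\<close>, and the summand \<open>1\<close> is
  integrable over the ball outside which \<open>g\<close> vanishes.\<close>

lemma integrable_mult_bounded_support:
  fixes u g :: "'a::euclidean_space \<Rightarrow> real"
  assumes [measurable]: "u \<in> borel_measurable borel" "g \<in> borel_measurable borel"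
    and p: "1 \<le> p" and u: "integrable lborel (\<lambda>x. \<bar>u x\<bar> powr p)"
    and g: "\<And>x. \<bar>g x\<bar> \<le> M" "\<And>x. norm x > R \<Longrightarrow> g x = 0"
  shows "integrable lborel (\<lambda>x. u x * g x)"
proof (rule Bochner_Integration.integrable_bound)
  show "integrable lborel (\<lambda>x. M * (indicator (cball 0 R) x + \<bar>u x\<bar> powr p))"
    using u emeasure_bounded_finite[of "cball (0::'a) R"]
    by (intro integrable_mult_right Bochner_Integration.integrable_add integrable_real_indicator) auto
  have M: "M \<ge> 0" using g(1)[of 0] by linarith
  have "\<bar>u x * g x\<bar> \<le> M * (indicator (cball 0 R) x + \<bar>u x\<bar> powr p)" for x
  proof (cases "norm x \<le> R")
    case True
    have "\<bar>u x\<bar> \<le> 1 + \<bar>u x\<bar> powr p"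
    proof (cases "\<bar>u x\<bar> \<le> 1")
      case False
      then have "\<bar>u x\<bar> powr 1 \<le> \<bar>u x\<bar> powr p" using p by (intro powr_mono) auto
      then show ?thesis using False by simp
    qed (simp add: add_increasing2)
    then have "\<bar>g x\<bar> * \<bar>u x\<bar> \<le> M * (1 + \<bar>u x\<bar> powr p)"
      using g(1)[of x] M by (intro mult_mono) auto
    then show ?thesis using True by (simp add: abs_mult mult.commute)
  next
    case False
    then show ?thesis using g(2)[of x] M by simp
  qed
  then show "AE x in lborel. norm (u x * g x) \<le> norm (M * (indicator (cball 0 R) x + \<bar>u x\<bar> powr p))"
    using M by (intro AE_I2) (auto intro: order.trans)
qed measurable

lemma integral_shift:
  fixes c :: "'a::euclidean_space" and f :: "'a \<Rightarrow> real"
  assumes [measurable]: "f \<in> borel_measurable borel"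
  shows "(\<integral>x. f (x + c) \<partial>lborel) = (\<integral>x. f x \<partial>lborel)"
proof -
  have "(\<integral>x. f x \<partial>lborel) = (\<integral>x. f x \<partial>distr lborel borel ((+) c))"
    by (simp add: lborel_distr_plus)
  also have "\<dots> = (\<integral>x. f (c + x) \<partial>lborel)" by (intro integral_distr) auto
  finally show ?thesis by (simp add: add.commute)
qed

lemma integrable_shift:
  fixes c :: "'a::euclidean_space" and f :: "'a \<Rightarrow> real"
  assumes "integrable lborel f"
  shows "integrable lborel (\<lambda>x. f (x + c))"
proof -
  have [measurable]: "f \<in> borel_measurable borel" using assms by auto
  have "integrable (distr lborel borel ((+) c)) f" using assms by (simp add: lborel_distr_plus)
  then have "integrable lborel (\<lambda>x. f (c + x))" by (subst (asm) integrable_distr_eq) auto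
  then show ?thesis by (simp add: add.commute)
qed

lemma bounded_support_of_compact:
  fixes f :: "'a::euclidean_space \<Rightarrow> 'b::real_normed_vector"
  assumes "compact (closure {x. f x \<noteq> 0})"
  obtains R where "R > 0" "\<And>x. norm x > R \<Longrightarrow> f x = 0"
proof -
  from compact_imp_bounded[OF assms] obtain R where R: "R > 0" "\<And>x. x \<in> closure {x. f x \<noteq> 0} \<Longrightarrow> norm x \<le> R"
    by (auto simp: bounded_pos)
  have "f x = 0" if "norm x > R" for x
    using R(2)[of x] closure_subset[of "{x. f x \<noteq> 0}"] that by force
  with R(1) show ?thesis by (rule that)
qed

lemma derivative_bounded_support:
  fixes f :: "'a::euclidean_space \<Rightarrow> 'b::real_normed_vector"
  assumes der: "\<And>x. (f has_derivative f' x) (at x)" and supp: "\<And>x. norm x > R \<Longrightarrow> f x = 0" and x: "norm x > R"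
  shows "f' x e = 0"
proof -
  have "open {x::'a. norm x > R}" by (intro open_Collect_less continuous_intros)
  then have "((\<lambda>_. 0) has_derivative f' x) (at x)"
    by (rule has_derivative_transform_within_open[OF der]) (use supp x in auto)
  then have "f' x = (\<lambda>_. 0)" by (rule has_derivative_unique) (rule has_derivative_const)
  then show ?thesis by (rule fun_cong)
qed

lemma continuous_bounded_support_bounded:
  fixes f :: "'a::euclidean_space \<Rightarrow> real"
  assumes "continuous_on UNIV f" "\<And>x. norm x > R \<Longrightarrow> f x = 0"
  obtains M where "M > 0" "\<And>x. \<bar>f x\<bar> \<le> M"
proof -
  have "compact (f ` cball 0 R)"
    by (rule compact_continuous_image[OF continuous_on_subset[OF assms(1)]]) auto
  from compact_imp_bounded[OF this] obtain M where M: "M > 0" "\<And>x. norm x \<le> R \<Longrightarrow> \<bar>f x\<bar> \<le> M"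
    by (auto simp: bounded_pos)
  have "\<bar>f x\<bar> \<le> M" for x using M assms(2)[of x] by (cases "norm x \<le> R") auto
  with M(1) show ?thesis by (rule that)
qed

text \<open>Summation by parts through translation invariance moves the difference quotient from
  \<open>u\<close> to \<open>\<phi>\<close>. There it converges pointwise, is bounded by the mean
  value theorem, and is supported in one fixed ball because \<open>t m \<le> 1\<close>, so dominated
  convergence applies.\<close>

lemma difference_quotient_tendsto_weak_derivative:
  fixes u \<phi> :: "'a::euclidean_space \<Rightarrow> real" and t :: "nat \<Rightarrow> real"
  assumes [measurable]: "u \<in> borel_measurable borel"
    and p: "1 \<le> p" and u: "integrable lborel (\<lambda>x. \<bar>u x\<bar> powr p)"
    and der: "\<And>x. (\<phi> has_derivative \<phi>' x) (at x)" and cont: "continuous_on UNIV (\<lambda>x. \<phi>' x e)"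
    and supp: "compact (closure {x. \<phi> x \<noteq> 0})"
    and t: "\<And>m. 0 < t m" "\<And>m. t m \<le> 1" "t \<longlonglongrightarrow> 0"
  shows "(\<lambda>m. \<integral>x. (u (x + t m *\<^sub>R e) - u x) / t m * \<phi> x \<partial>lborel) \<longlonglongrightarrow> - (\<integral>x. u x * \<phi>' x e \<partial>lborel)"
proof -
  obtain R where R: "R > 0" "\<And>x. norm x > R \<Longrightarrow> \<phi> x = 0" using supp by (rule bounded_support_of_compact) blast
  have R': "\<phi>' x e = 0" if "norm x > R" for x using derivative_bounded_support[OF der R(2) that] .
  have cont\<phi>: "continuous_on UNIV \<phi>"
    using der by (meson continuous_at_imp_continuous_on has_derivative_continuous)
  obtain M0 where M0: "\<And>x. \<bar>\<phi> x\<bar> \<le> M0"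
    using continuous_bounded_support_bounded[OF cont\<phi> R(2)] by blast
  obtain M where M: "M > 0" "\<And>x. \<bar>\<phi>' x e\<bar> \<le> M"
    using continuous_bounded_support_bounded[OF cont R'] by blast
  have [measurable]: "\<phi> \<in> borel_measurable borel" and \<phi>'m: "(\<lambda>x. \<phi>' x e) \<in> borel_measurable borel"
    using cont\<phi> cont by (auto intro: borel_measurable_continuous_onI)
  have line: "((\<lambda>r. \<phi> (x - r *\<^sub>R e)) has_real_derivative - \<phi>' (x - r *\<^sub>R e) e) (at r)" for x r
  proof -
    have "((\<lambda>r. \<phi> (x - r *\<^sub>R e)) has_derivative (\<lambda>h. \<phi>' (x - r *\<^sub>R e) (0 - h *\<^sub>R e))) (at r)"
      by (rule has_derivative_compose[where f = "\<lambda>r. x - r *\<^sub>R e" and g = \<phi>, OF _ der]) (auto intro!: derivative_eq_intros)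
    moreover have "\<phi>' (x - r *\<^sub>R e) (0 - h *\<^sub>R e) = - \<phi>' (x - r *\<^sub>R e) e * h" for h
      using linear_cmul[OF has_derivative_linear[OF der], of "x - r *\<^sub>R e" "- h" e] by simp
    ultimately show ?thesis by (simp only: has_field_derivative_def)
  qed
  define q where "q m x = (\<phi> (x - t m *\<^sub>R e) - \<phi> x) / t m" for m x
  have [measurable]: "q m \<in> borel_measurable borel" for m unfolding q_def[abs_def] by measurable
  have q_le: "\<bar>q m x\<bar> \<le> M" for m x
  proof -
    have "\<exists>z>0. z < t m \<and> \<phi> (x - t m *\<^sub>R e) - \<phi> (x - 0 *\<^sub>R e) = (t m - 0) * - \<phi>' (x - z *\<^sub>R e) e"
      by (rule MVT2) (use t line in auto)
    then obtain z where "\<phi> (x - t m *\<^sub>R e) - \<phi> x = t m * - \<phi>' (x - z *\<^sub>R e) e" by auto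
    then show ?thesis using t(1)[of m] M(2) by (simp add: q_def)
  qed
  have q_supp: "q m x = 0" if "norm x > R + norm e" for m x
  proof -
    have "norm x \<le> norm (x - t m *\<^sub>R e) + norm (t m *\<^sub>R e)" by (metis diff_add_cancel norm_triangle_ineq)
    moreover have "norm (t m *\<^sub>R e) \<le> norm e" using t(1,2)[of m] by (simp add: mult_left_le_one_le)
    moreover have "norm e \<ge> 0" by simp
    ultimately have "norm (x - t m *\<^sub>R e) > R" "norm x > R" using that by linarith+
    then show ?thesis by (simp add: q_def R(2))
  qed
  have q_lim: "(\<lambda>m. q m x) \<longlonglongrightarrow> - \<phi>' x e" for x
  proof -
    have "((\<lambda>h. (\<phi> (x - (0 + h) *\<^sub>R e) - \<phi> (x - 0 *\<^sub>R e)) / h) \<longlongrightarrow> - \<phi>' (x - 0 *\<^sub>R e) e) (at 0)"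
      using line[of x 0] unfolding DERIV_def .
    moreover have "filterlim t (at 0) sequentially"
    proof -
      have "t m \<noteq> 0" for m using t(1)[of m] by simp
      with t(3) show ?thesis by (simp add: filterlim_at)
    qed
    ultimately have "((\<lambda>m. (\<phi> (x - (0 + t m) *\<^sub>R e) - \<phi> (x - 0 *\<^sub>R e)) / t m) \<longlongrightarrow> - \<phi>' (x - 0 *\<^sub>R e) e) sequentially"
      by (rule filterlim_compose)
    then show ?thesis by (simp add: q_def)
  qed
  have eq: "(\<integral>x. (u (x + t m *\<^sub>R e) - u x) / t m * \<phi> x \<partial>lborel) = (\<integral>x. u x * q m x \<partial>lborel)" for m
  proof -
    \<comment> \<open>Its translate by \<open>t m *\<^sub>R e\<close> is the product of the shifted
      \<open>u\<close> with the unshifted \<open>\<phi>\<close>. Its integrability comes from the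
      identity \<open>a x = u x * \<phi> x + t m * (u x * q m x)\<close>.\<close>
    define a where "a x = u x * \<phi> (x - t m *\<^sub>R e)" for x
    have [measurable]: "a \<in> borel_measurable borel" unfolding a_def[abs_def] by measurable
    have i1: "integrable lborel (\<lambda>x. u x * \<phi> x)"
      by (rule integrable_mult_bounded_support[OF _ _ p u M0 R(2)]) auto
    have "integrable lborel (\<lambda>x. u x * q m x)"
      by (rule integrable_mult_bounded_support[OF _ _ p u q_le q_supp]) auto
    then have "integrable lborel (\<lambda>x. u x * \<phi> x + t m * (u x * q m x))"
      using i1 by (intro Bochner_Integration.integrable_add integrable_mult_right)
    also have "(\<lambda>x. u x * \<phi> x + t m * (u x * q m x)) = a"
      using t(1)[of m] by (intro ext) (simp add: a_def q_def right_diff_distrib diff_divide_distrib)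
    finally have i2: "integrable lborel a" .
    have "(\<integral>x. (u (x + t m *\<^sub>R e) - u x) / t m * \<phi> x \<partial>lborel)
       = (\<integral>x. (a (x + t m *\<^sub>R e) - u x * \<phi> x) / t m \<partial>lborel)"
      by (intro Bochner_Integration.integral_cong refl) (simp add: a_def left_diff_distrib)
    also have "\<dots> = ((\<integral>x. a (x + t m *\<^sub>R e) \<partial>lborel) - (\<integral>x. u x * \<phi> x \<partial>lborel)) / t m"
      using i1 integrable_shift[OF i2] by (simp add: Bochner_Integration.integral_diff)
    also have "(\<integral>x. a (x + t m *\<^sub>R e) \<partial>lborel) = (\<integral>x. a x \<partial>lborel)" by (rule integral_shift) measurable
    also have "((\<integral>x. a x \<partial>lborel) - (\<integral>x. u x * \<phi> x \<partial>lborel)) / t m = (\<integral>x. (a x - u x * \<phi> x) / t m \<partial>lborel)"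
      using i1 i2 by (simp add: Bochner_Integration.integral_diff)
    also have "\<dots> = (\<integral>x. u x * q m x \<partial>lborel)"
      by (intro Bochner_Integration.integral_cong refl) (simp add: a_def q_def right_diff_distrib)
    finally show ?thesis .
  qed
  have "(\<lambda>m. \<integral>x. u x * q m x \<partial>lborel) \<longlonglongrightarrow> (\<integral>x. u x * - \<phi>' x e \<partial>lborel)"
  proof (rule integral_dominated_convergence)
    define w where "w x = M * indicator (cball 0 (R + norm e)) x" for x :: 'a
    have wm [measurable]: "w \<in> borel_measurable borel" unfolding w_def[abs_def]
      by (intro borel_measurable_times borel_measurable_const borel_measurable_indicator) auto
    have w: "0 \<le> w x" "\<bar>w x\<bar> \<le> M" for x using M(1) by (auto simp: w_def indicator_def)
    have q_w: "\<bar>q m x\<bar> \<le> w x" for m x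
      using q_le[of m x] q_supp[of x m] by (cases "norm x \<le> R + norm e") (auto simp: w_def)
    have "integrable lborel (\<lambda>x. u x * w x)"
      by (rule integrable_mult_bounded_support[OF assms(1) wm p u w(2), where R = "R + norm e"]) (simp add: w_def)
    then show "integrable lborel (\<lambda>x. \<bar>u x * w x\<bar>)" by (rule integrable_abs)
    show "AE x in lborel. (\<lambda>m. u x * q m x) \<longlonglongrightarrow> u x * - \<phi>' x e"
      by (intro AE_I2 tendsto_mult tendsto_const q_lim)
    have "\<bar>u x * q m x\<bar> \<le> \<bar>u x * w x\<bar>" for m x
      using mult_left_mono[OF q_w, of "\<bar>u x\<bar>" m x] w(1)[of x] by (simp add: abs_mult)
    then show "AE x in lborel. norm (u x * q m x) \<le> \<bar>u x * w x\<bar>" for m by simp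
    show "(\<lambda>x. u x * - \<phi>' x e) \<in> borel_measurable lborel"
      using borel_measurable_times[OF assms(1) borel_measurable_uminus[OF \<phi>'m]] by simp
    show "(\<lambda>x. u x * q m x) \<in> borel_measurable lborel" for m by measurable
  qed
  then show ?thesis unfolding eq by simp
qed

subsection \<open>Weak limits of bounded sequences\<close>

text \<open>The strictly convex functional to be minimised is built from this function: linear
  growth keeps it finite for \<open>p\<close>-integrable functions against an integrable weight, and
  its convexity defect can be computed exactly.\<close>

definition bracket :: "real \<Rightarrow> real" where "bracket a = sqrt (1 + a\<^sup>2)"

lemma borel_measurable_bracket [measurable]: "bracket \<in> borel_measurable borel"
  unfolding bracket_def[abs_def] by measurable

lemma bracket_bounds: "1 \<le> bracket a" "\<bar>a\<bar> \<le> bracket a" "bracket a \<le> 1 + \<bar>a\<bar>"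
proof -
  show "1 \<le> bracket a" "\<bar>a\<bar> \<le> bracket a" by (auto simp: bracket_def intro: real_le_rsqrt)
  have "1 + a\<^sup>2 \<le> (1 + \<bar>a\<bar>)\<^sup>2" by (simp add: power2_sum)
  then show "bracket a \<le> 1 + \<bar>a\<bar>" unfolding bracket_def by (intro real_le_lsqrt) auto
qed

text \<open>Two identities carry the estimate. With \<open>X = bracket a * bracket b\<close>, the
  squares of \<open>bracket a + bracket b\<close> and of \<open>2 * bracket ((a + b) / 2)\<close>
  differ by \<open>2 * (X - (1 + a * b))\<close>, and the squares of \<open>X\<close> and
  \<open>1 + a * b\<close> differ by the square of \<open>a - b\<close>. Factoring both as
  differences of squares links \<open>a - b\<close> to the convexity defect.\<close>

lemma bracket_midpoint:
  assumes K: "bracket a \<le> K" "bracket b \<le> K"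
  shows "0 \<le> bracket a + bracket b - 2 * bracket ((a + b) / 2)"
    and "(a - b)\<^sup>2 \<le> 4 * K ^ 3 * (bracket a + bracket b - 2 * bracket ((a + b) / 2))"
proof -
  define S where "S = bracket a + bracket b"
  define Y where "Y = 2 * bracket ((a + b) / 2)"
  have sq: "(bracket c)\<^sup>2 = 1 + c\<^sup>2" for c by (simp add: bracket_def)
  have K1: "K \<ge> 1" using K bracket_bounds(1)[of a] by simp
  have Y2: "Y\<^sup>2 = 4 + (a + b)\<^sup>2" by (simp add: Y_def power_mult_distrib sq power_divide)
  have pos: "bracket a > 0" "bracket b > 0" "Y > 0"
    using bracket_bounds(1)[of a] bracket_bounds(1)[of b] bracket_bounds(1)[of "(a + b) / 2"] by (auto simp: Y_def)
  have prod2: "(bracket a * bracket b)\<^sup>2 = (1 + a * b)\<^sup>2 + (a - b)\<^sup>2"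
    unfolding power_mult_distrib sq by (simp add: power2_eq_square algebra_simps)
  have ab: "\<bar>1 + a * b\<bar> \<le> bracket a * bracket b"
  proof -
    have "(1 + a * b)\<^sup>2 \<le> (bracket a * bracket b)\<^sup>2" using prod2 by simp
    then have "\<bar>1 + a * b\<bar> \<le> \<bar>bracket a * bracket b\<bar>" by (simp only: abs_le_square_iff)
    then show ?thesis using pos by (simp add: abs_mult)
  qed
  have diff: "S\<^sup>2 - Y\<^sup>2 = 2 * (bracket a * bracket b - (1 + a * b))"
    unfolding S_def Y2 power2_sum sq by (simp add: power2_eq_square algebra_simps)
  then have "Y\<^sup>2 \<le> S\<^sup>2" using ab by simp
  then have YS: "Y \<le> S" by (rule power2_le_imp_le) (use pos in \<open>simp add: S_def\<close>)
  then show "0 \<le> bracket a + bracket b - 2 * bracket ((a + b) / 2)" by (simp add: S_def Y_def)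
  have "(a - b)\<^sup>2 = (bracket a * bracket b - (1 + a * b)) * (bracket a * bracket b + (1 + a * b))"
    using prod2 by (simp add: power2_eq_square algebra_simps)
  also have "\<dots> \<le> (bracket a * bracket b - (1 + a * b)) * (2 * K\<^sup>2)"
  proof (intro mult_left_mono)
    have "bracket a * bracket b \<le> K\<^sup>2" unfolding power2_eq_square using K pos K1 by (intro mult_mono) auto
    then show "bracket a * bracket b + (1 + a * b) \<le> 2 * K\<^sup>2" using ab by simp
  qed (use ab in simp)
  also have "\<dots> = K\<^sup>2 * (S\<^sup>2 - Y\<^sup>2)" by (simp add: diff)
  also have "S\<^sup>2 - Y\<^sup>2 = (S + Y) * (S - Y)" by (simp add: power2_eq_square algebra_simps)
  also have "K\<^sup>2 * ((S + Y) * (S - Y)) \<le> K\<^sup>2 * ((4 * K) * (S - Y))"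
  proof (intro mult_left_mono mult_right_mono)
    have "S \<le> 2 * K" using K by (simp add: S_def)
    with YS show "S + Y \<le> 4 * K" by linarith
  qed (use YS in simp_all)
  also have "\<dots> = 4 * K ^ 3 * (S - Y)" by (simp add: power3_eq_cube power2_eq_square)
  finally show "(a - b)\<^sup>2 \<le> 4 * K ^ 3 * (bracket a + bracket b - 2 * bracket ((a + b) / 2))"
    by (simp only: S_def Y_def)
qed

text \<open>Quantitative strict convexity of \<open>bracket\<close>, in a form that can be integrated: the three terms
  are small when, in this order, \<open>\<epsilon>\<close> is small, \<open>M\<close> is large, and the convexity defect is small.\<close>

lemma abs_diff_le_bracket_defect:
  assumes p: "p > 1" and M: "M > 0" and \<epsilon>: "\<epsilon> > 0"
  shows "\<bar>a - b\<bar> \<le> \<epsilon> + 4 * (1 + M) ^ 3 / \<epsilon> * (bracket a + bracket b - 2 * bracket ((a + b) / 2))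
    + 2 * M powr (1 - p) * (\<bar>a\<bar> powr p + \<bar>b\<bar> powr p)"
proof (cases "\<bar>a\<bar> \<le> M \<and> \<bar>b\<bar> \<le> M")
  case True
  define D where "D = bracket a + bracket b - 2 * bracket ((a + b) / 2)"
  have K: "bracket a \<le> 1 + M" "bracket b \<le> 1 + M" using True bracket_bounds(3)[of a] bracket_bounds(3)[of b] by auto
  \<comment> \<open>The defect controls only the square of the difference; splitting off
    \<open>\<epsilon>\<close> makes the bound linear, as needed for a weighted \<open>L1\<close>
    estimate.\<close>
  have "\<bar>a - b\<bar> * \<epsilon> \<le> \<epsilon>\<^sup>2 + (a - b)\<^sup>2"
  proof (cases "\<bar>a - b\<bar> \<le> \<epsilon>")
    case True
    then have "\<bar>a - b\<bar> * \<epsilon> \<le> \<epsilon> * \<epsilon>" using \<epsilon> by (intro mult_right_mono) auto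
    also have "\<dots> \<le> \<epsilon>\<^sup>2 + (a - b)\<^sup>2" by (simp add: power2_eq_square)
    finally show ?thesis .
  next
    case False
    then have "\<bar>a - b\<bar> * \<epsilon> \<le> \<bar>a - b\<bar> * \<bar>a - b\<bar>" by (intro mult_left_mono) auto
    also have "\<dots> \<le> \<epsilon>\<^sup>2 + (a - b)\<^sup>2" by (simp add: power2_eq_square)
    finally show ?thesis .
  qed
  also have "\<dots> \<le> \<epsilon>\<^sup>2 + 4 * (1 + M) ^ 3 * D" using bracket_midpoint(2)[OF K] by (simp add: D_def)
  finally have "\<bar>a - b\<bar> \<le> (\<epsilon>\<^sup>2 + 4 * (1 + M) ^ 3 * D) / \<epsilon>" using \<epsilon> by (simp add: pos_le_divide_eq)
  also have "\<dots> = \<epsilon> + 4 * (1 + M) ^ 3 / \<epsilon> * D" using \<epsilon> by (simp add: add_divide_distrib power2_eq_square)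
  finally have "\<bar>a - b\<bar> \<le> \<epsilon> + 4 * (1 + M) ^ 3 / \<epsilon> * D" .
  also have "\<dots> \<le> \<epsilon> + 4 * (1 + M) ^ 3 / \<epsilon> * D + 2 * M powr (1 - p) * (\<bar>a\<bar> powr p + \<bar>b\<bar> powr p)"
    by (intro le_add_same_cancel1[THEN iffD2] mult_nonneg_nonneg) auto
  finally show ?thesis unfolding D_def .
next
  case False
  \<comment> \<open>For large values convexity degenerates, and the \<open>p\<close>-th powers take
    over: \<open>c > M\<close> gives \<open>c \<le> M powr (1 - p) * c powr p\<close>, which is
    small on average because \<open>p > 1\<close>.\<close>
  define c where "c = max \<bar>a\<bar> \<bar>b\<bar>"
  have c: "c > M" using False by (auto simp: c_def)
  have "c powr p \<le> \<bar>a\<bar> powr p + \<bar>b\<bar> powr p" by (cases "\<bar>a\<bar> \<le> \<bar>b\<bar>") (auto simp: c_def)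
  moreover have "c \<le> M powr (1 - p) * c powr p"
  proof -
    have "c = c powr ((1 - p) + p)" using c M by simp
    also have "\<dots> = c powr (1 - p) * c powr p" by (rule powr_add)
    also have "\<dots> \<le> M powr (1 - p) * c powr p" using c M p by (intro mult_right_mono powr_mono2') auto
    finally show ?thesis .
  qed
  ultimately have "c \<le> M powr (1 - p) * (\<bar>a\<bar> powr p + \<bar>b\<bar> powr p)"
    by (meson mult_left_mono order.trans powr_ge_zero)
  moreover have "\<bar>a - b\<bar> \<le> 2 * c" by (auto simp: c_def)
  ultimately have "\<bar>a - b\<bar> \<le> 2 * M powr (1 - p) * (\<bar>a\<bar> powr p + \<bar>b\<bar> powr p)" by (simp only: mult.assoc)
  also have "\<dots> \<le> \<epsilon> + 4 * (1 + M) ^ 3 / \<epsilon> * (bracket a + bracket b - 2 * bracket ((a + b) / 2)) + \<dots>"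
    using M \<epsilon> bracket_midpoint(1)[OF max.cobounded1 max.cobounded2, of a b]
    by (intro le_add_same_cancel2[THEN iffD2] add_nonneg_nonneg mult_nonneg_nonneg divide_nonneg_nonneg) simp_all
  finally show ?thesis .
qed

text \<open>A weight makes constants and \<open>p\<close>-integrable functions integrable over the
  whole space. The lower bound on balls ensures that convergence in the weighted space still passes
  to integrals against functions of bounded support. The witness is a product of one-dimensional
  functions \<open>exp (- \<bar>t\<bar>)\<close>.\<close>

lemma exists_integrable_weight:
  obtains \<omega> :: "'a::euclidean_space \<Rightarrow> real"
  where "integrable lborel \<omega>" "\<And>x. 0 < \<omega> x" "\<And>x. \<omega> x \<le> 1" "\<And>R. \<exists>c>0. \<forall>x. norm x \<le> R \<longrightarrow> c \<le> \<omega> x"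
proof -
  define \<beta> where "\<beta> t = exp (- \<bar>t\<bar>)" for t :: real
  define \<omega> where "\<omega> x = (\<Prod>b\<in>Basis. \<beta> (x \<bullet> b))" for x :: 'a
  have [measurable]: "\<beta> \<in> borel_measurable borel" unfolding \<beta>_def[abs_def] by measurable
  have [measurable]: "\<omega> \<in> borel_measurable borel" unfolding \<omega>_def[abs_def] by measurable
  have one: "(\<integral>\<^sup>+t. ennreal (\<beta> t) \<partial>lborel) < \<infinity>"
  proof -
    have lim: "((\<lambda>t::real. - exp (- t)) \<longlongrightarrow> 0) at_top"
      using tendsto_minus[OF filterlim_compose[OF exp_at_bot filterlim_uminus_at_bot_at_top]] by simp
    have pos: "(\<integral>\<^sup>+t. ennreal (exp (- t)) * indicator {0..} t \<partial>lborel) = ennreal (0 - (- exp (- 0)))"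
      by (rule nn_integral_FTC_atLeast[where F = "\<lambda>t. - exp (- t)"])
         (auto intro!: derivative_eq_intros lim)
    have "(\<integral>\<^sup>+t. ennreal (\<beta> t) \<partial>lborel) \<le> (\<integral>\<^sup>+t. ennreal (exp (- t)) * indicator {0..} t
        + ennreal (exp (- (- t))) * indicator {0..} (- t) \<partial>lborel)"
      by (intro nn_integral_mono) (auto simp: \<beta>_def indicator_def)
    also have "\<dots> = (\<integral>\<^sup>+t. ennreal (exp (- t)) * indicator {0..} t \<partial>lborel)
        + (\<integral>\<^sup>+t. ennreal (exp (- (- t))) * indicator {0..} (- t) \<partial>lborel)"
      by (rule nn_integral_add) measurable
    also have "(\<integral>\<^sup>+t. ennreal (exp (- (- t))) * indicator {0..} (- t) \<partial>lborel)
        = (\<integral>\<^sup>+t. ennreal (exp (- t)) * indicator {0..} t \<partial>lborel)"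
      by (subst (2) nn_integral_real_affine[where c = "-1" and t = 0]) auto
    finally have "(\<integral>\<^sup>+t. ennreal (\<beta> t) \<partial>lborel) \<le> 2" by (simp add: pos)
    then show ?thesis by (rule order.strict_trans1) simp
  qed
  obtain c where c: "(\<integral>\<^sup>+t. ennreal (\<beta> t) \<partial>lborel) = ennreal c" "c \<ge> 0"
    using one by (cases "\<integral>\<^sup>+t. ennreal (\<beta> t) \<partial>lborel") auto
  have "(\<integral>\<^sup>+x. ennreal (\<omega> x) \<partial>lborel) = (\<integral>\<^sup>+x. (\<Prod>b\<in>Basis. ennreal (\<beta> (x \<bullet> b))) \<partial>(lborel :: 'a measure))"
    by (simp add: \<omega>_def prod_ennreal \<beta>_def)
  also have "\<dots> = (\<Prod>b\<in>(Basis :: 'a set). \<integral>\<^sup>+t. ennreal (\<beta> t) \<partial>lborel)"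
    by (rule nn_integral_lborel_prod) auto
  also have "\<dots> < \<infinity>" using c by (simp add: ennreal_power)
  finally have int: "integrable lborel \<omega>"
    by (intro integrableI_nonneg) (auto simp: \<omega>_def \<beta>_def intro!: prod_nonneg)
  have "\<exists>c>0. \<forall>x. norm x \<le> R \<longrightarrow> c \<le> \<omega> x" for R
  proof (intro exI[of _ "\<Prod>b\<in>(Basis :: 'a set). exp (- \<bar>R\<bar>)"] conjI allI impI)
    show "(\<Prod>b\<in>(Basis :: 'a set). exp (- \<bar>R\<bar>)) > 0" by (intro prod_pos) auto
    fix x :: 'a assume x: "norm x \<le> R"
    show "(\<Prod>b\<in>(Basis :: 'a set). exp (- \<bar>R\<bar>)) \<le> \<omega> x"
      unfolding \<omega>_def \<beta>_def
    proof (intro prod_mono conjI)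
      fix b :: 'a assume "b \<in> Basis"
      then have "\<bar>x \<bullet> b\<bar> \<le> \<bar>R\<bar>" using x Basis_le_norm[of b x] by linarith
      then show "exp (- \<bar>R\<bar>) \<le> exp (- \<bar>x \<bullet> b\<bar>)" by simp
    qed auto
  qed
  moreover have "0 < \<omega> x" for x by (auto simp: \<omega>_def \<beta>_def intro!: prod_pos)
  moreover have "\<omega> x \<le> 1" for x by (auto simp: \<omega>_def \<beta>_def intro!: prod_le_1)
  ultimately show ?thesis using int that by blast
qed

lemma midpoint_powr_le:
  fixes a b p :: real
  assumes p: "p \<ge> 1"
  shows "\<bar>(a + b) / 2\<bar> powr p \<le> (\<bar>a\<bar> powr p + \<bar>b\<bar> powr p) / 2"
proof -
  have "((c + d) / 2) powr p \<le> (c powr p + d powr p) / 2" if "c \<ge> 0" "d \<ge> 0" for c d :: real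
  proof (cases "c = 0 \<or> d = 0")
    case True
    have half: "(e / 2) powr p \<le> e powr p / 2" if "e \<ge> 0" for e :: real
    proof -
      have "e powr p / 2 powr p \<le> e powr p / 2 powr 1"
        using p by (intro divide_left_mono powr_mono) auto
      then show ?thesis using that by (simp add: powr_divide)
    qed
    show ?thesis using True half[OF that(1)] half[OF that(2)] p by auto
  next
    case False
    with that have "((1 - 1 / 2) *\<^sub>R c + (1 / 2) *\<^sub>R d) powr p \<le> (1 - 1 / 2) * c powr p + 1 / 2 * d powr p"
      by (intro convex_onD[OF powr_convex[OF p]]) auto
    then show ?thesis by (simp add: add_divide_distrib)
  qed
  from this[of "\<bar>a\<bar>" "\<bar>b\<bar>"] have "((\<bar>a\<bar> + \<bar>b\<bar>) / 2) powr p \<le> (\<bar>a\<bar> powr p + \<bar>b\<bar> powr p) / 2" by simp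
  moreover have "\<bar>(a + b) / 2\<bar> powr p \<le> ((\<bar>a\<bar> + \<bar>b\<bar>) / 2) powr p"
  proof (rule powr_mono2)
    show "\<bar>(a + b) / 2\<bar> \<le> (\<bar>a\<bar> + \<bar>b\<bar>) / 2"
      using abs_triangle_ineq[of a b] by (simp add: abs_divide)
  qed (use p in auto)
  ultimately show ?thesis by (rule order.trans[rotated])
qed

text \<open>Weak compactness without reflexivity: the midpoint-convex sets \<open>P n\<close> of functions that act on
  \<open>F\<close> at least as accurately as \<open>v m\<close> for all \<open>m \<ge> n\<close> decrease, and near-minimisers of a strictly convex functional
  on them form a Cauchy sequence in a weighted \<open>L\<^sup>1\<close>.\<close>

lemma weak_limit_of_Lp_bounded_sequence:
  fixes v :: "nat \<Rightarrow> 'a::euclidean_space \<Rightarrow> real"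
  assumes p: "p > 1"
    and v: "\<And>m. v m \<in> borel_measurable borel" "\<And>m. integrable lborel (\<lambda>x. \<bar>v m x\<bar> powr p)"
      "\<And>m. (\<integral>x. \<bar>v m x\<bar> powr p \<partial>lborel) \<le> B"
    and F: "\<And>\<phi>. \<phi> \<in> F \<Longrightarrow> \<phi> \<in> borel_measurable borel"
      "\<And>\<phi>. \<phi> \<in> F \<Longrightarrow> \<exists>M. \<forall>x. \<bar>\<phi> x\<bar> \<le> M" "\<And>\<phi>. \<phi> \<in> F \<Longrightarrow> \<exists>R. \<forall>x. norm x > R \<longrightarrow> \<phi> x = 0"
    and T: "\<And>\<phi>. \<phi> \<in> F \<Longrightarrow> (\<lambda>m. \<integral>x. v m x * \<phi> x \<partial>lborel) \<longlonglongrightarrow> T \<phi>"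
  obtains g where "g \<in> borel_measurable borel" "integrable lborel (\<lambda>x. \<bar>g x\<bar> powr p)"
    "(\<integral>x. \<bar>g x\<bar> powr p \<partial>lborel) \<le> B" "\<And>\<phi>. \<phi> \<in> F \<Longrightarrow> (\<integral>x. g x * \<phi> x \<partial>lborel) = T \<phi>"
proof -
  obtain \<omega> :: "'a \<Rightarrow> real" where \<omega>: "integrable lborel \<omega>" "\<And>x. 0 < \<omega> x" "\<And>x. \<omega> x \<le> 1"
    "\<And>R. \<exists>c>0. \<forall>x. norm x \<le> R \<longrightarrow> c \<le> \<omega> x"
    by (rule exists_integrable_weight) blast
  have [measurable]: "\<omega> \<in> borel_measurable borel" using \<omega>(1) by auto
  define W where "W = (\<integral>x. \<omega> x \<partial>lborel)"
  have W: "W \<ge> 0" unfolding W_def using \<omega>(2) by (intro Bochner_Integration.integral_nonneg) (auto simp: less_imp_le)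
  have "0 \<le> (\<integral>x. \<bar>v 0 x\<bar> powr p \<partial>lborel)" by simp
  then have B: "B \<ge> 0" using v(3)[of 0] by linarith
  define adm where "adm w \<longleftrightarrow> w \<in> borel_measurable borel \<and> integrable lborel (\<lambda>x. \<bar>w x\<bar> powr p)
    \<and> (\<integral>x. \<bar>w x\<bar> powr p \<partial>lborel) \<le> B" for w :: "'a \<Rightarrow> real"
  define J where "J w = (\<integral>x. \<omega> x * bracket (w x) \<partial>lborel)" for w
  have abs_le: "\<bar>a\<bar> \<le> 1 + \<bar>a\<bar> powr p" for a :: real
  proof (cases "\<bar>a\<bar> \<le> 1")
    case False
    then have "\<bar>a\<bar> powr 1 \<le> \<bar>a\<bar> powr p" using p by (intro powr_mono) auto
    then show ?thesis using False by simp
  qed (simp add: add_increasing2)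
  have bracket_le: "\<bar>\<omega> x * bracket a\<bar> \<le> 2 * \<omega> x + \<bar>a\<bar> powr p" for x a
  proof -
    have "bracket a \<le> 2 + \<bar>a\<bar> powr p" using bracket_bounds(3)[of a] abs_le[of a] by linarith
    then have "\<omega> x * bracket a \<le> \<omega> x * (2 + \<bar>a\<bar> powr p)" using \<omega>(2)[of x] by (intro mult_left_mono) auto
    moreover have "\<omega> x * \<bar>a\<bar> powr p \<le> 1 * \<bar>a\<bar> powr p" using \<omega>(3) by (intro mult_right_mono) auto
    ultimately show ?thesis using \<omega>(2)[of x] bracket_bounds(1)[of a] by (simp add: abs_mult algebra_simps)
  qed
  have int_bound: "integrable lborel (\<lambda>x. 2 * \<omega> x + \<bar>w x\<bar> powr p)" if "adm w" for w
    using that \<omega>(1) by (auto simp: adm_def)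
  have int_bracket: "integrable lborel (\<lambda>x. \<omega> x * bracket (w x))" if "adm w" for w
  proof (rule Bochner_Integration.integrable_bound[OF int_bound[OF that]])
    have [measurable]: "w \<in> borel_measurable borel" using that by (auto simp: adm_def)
    show "(\<lambda>x. \<omega> x * bracket (w x)) \<in> borel_measurable lborel" by measurable
    show "AE x in lborel. norm (\<omega> x * bracket (w x)) \<le> norm (2 * \<omega> x + \<bar>w x\<bar> powr p)"
      using bracket_le by (intro AE_I2) (auto intro: order.trans[OF _ abs_ge_self])
  qed
  have int_w: "integrable lborel (\<lambda>x. \<omega> x * w x)" if "adm w" for w
  proof (rule Bochner_Integration.integrable_bound[OF int_bracket[OF that]])
    have [measurable]: "w \<in> borel_measurable borel" using that by (auto simp: adm_def)
    show "(\<lambda>x. \<omega> x * w x) \<in> borel_measurable lborel" by measurable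
    show "AE x in lborel. norm (\<omega> x * w x) \<le> norm (\<omega> x * bracket (w x))"
      using bracket_bounds(2) \<omega>(2)
      by (intro AE_I2) (auto simp: abs_mult less_imp_le intro!: mult_left_mono order.trans[OF _ abs_ge_self])
  qed
  have J_le: "0 \<le> J w" "J w \<le> 2 * W + B" if "adm w" for w
  proof -
    show "0 \<le> J w" unfolding J_def
    proof (rule Bochner_Integration.integral_nonneg)
      fix x show "0 \<le> \<omega> x * bracket (w x)"
        using \<omega>(2)[of x] bracket_bounds(1)[of "w x"] by (intro mult_nonneg_nonneg) auto
    qed
    have "J w \<le> (\<integral>x. 2 * \<omega> x + \<bar>w x\<bar> powr p \<partial>lborel)" unfolding J_def
      by (intro integral_mono int_bracket int_bound that order.trans[OF abs_ge_self bracket_le])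
    also have "\<dots> = 2 * W + (\<integral>x. \<bar>w x\<bar> powr p \<partial>lborel)"
      using that \<omega>(1) by (simp add: adm_def W_def)
    finally show "J w \<le> 2 * W + B" using that by (simp add: adm_def)
  qed
  define mid where "mid w w' x = (w x + w' x) / 2" for w w' :: "'a \<Rightarrow> real" and x
  have adm_mid: "adm (mid w w')" if "adm w" "adm w'" for w w'
  proof -
    have [measurable]: "w \<in> borel_measurable borel" "w' \<in> borel_measurable borel" using that by (auto simp: adm_def)
    have i: "integrable lborel (\<lambda>x. (\<bar>w x\<bar> powr p + \<bar>w' x\<bar> powr p) / 2)"
      using that by (auto simp: adm_def)
    have m: "mid w w' \<in> borel_measurable borel" unfolding mid_def[abs_def] by measurable
    have mle: "\<bar>mid w w' x\<bar> powr p \<le> (\<bar>w x\<bar> powr p + \<bar>w' x\<bar> powr p) / 2" for x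
      unfolding mid_def using p by (intro midpoint_powr_le) auto
    have j: "integrable lborel (\<lambda>x. \<bar>mid w w' x\<bar> powr p)"
    proof (rule Bochner_Integration.integrable_bound[OF i])
      show "(\<lambda>x. \<bar>mid w w' x\<bar> powr p) \<in> borel_measurable lborel" using m by measurable
      show "AE x in lborel. norm (\<bar>mid w w' x\<bar> powr p) \<le> norm ((\<bar>w x\<bar> powr p + \<bar>w' x\<bar> powr p) / 2)"
        using mle by simp
    qed
    have "(\<integral>x. \<bar>mid w w' x\<bar> powr p \<partial>lborel) \<le> (\<integral>x. (\<bar>w x\<bar> powr p + \<bar>w' x\<bar> powr p) / 2 \<partial>lborel)"
      by (intro integral_mono i j mle)
    also have "\<dots> \<le> B" using that by (simp add: adm_def)
    finally show ?thesis using m j by (simp add: adm_def)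
  qed
  \<comment> \<open>Quantifying over every common bound \<open>c\<close> of the errors of the tail
    expresses comparison with their supremum. The conditions are preserved under midpoints, hold for
    \<open>v n\<close>, and force convergence to \<open>T \<phi>\<close> for any choice of
    \<open>w n \<in> P n\<close>.\<close>
  define P where "P n = {w. adm w \<and> (\<forall>\<phi>\<in>F. \<forall>c. (\<forall>m\<ge>n. \<bar>(\<integral>x. v m x * \<phi> x \<partial>lborel) - T \<phi>\<bar> \<le> c)
    \<longrightarrow> \<bar>(\<integral>x. w x * \<phi> x \<partial>lborel) - T \<phi>\<bar> \<le> c)}" for n
  have P_adm: "adm w" if "w \<in> P n" for w n using that by (simp add: P_def)
  have vP: "v n \<in> P n" for n using v by (auto simp: P_def adm_def)
  have P_mono: "P n \<subseteq> P m" if "m \<le> n" for m n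
    using that unfolding P_def by (auto dest: order.trans)
  have int_F: "integrable lborel (\<lambda>x. w x * \<phi> x)" if w: "adm w" and \<phi>: "\<phi> \<in> F" for w \<phi>
  proof -
    obtain M R where "\<And>x. \<bar>\<phi> x\<bar> \<le> M" "\<And>x. norm x > R \<Longrightarrow> \<phi> x = 0" using F(2,3)[OF \<phi>] by blast
    then show ?thesis using w \<phi> p F(1)
      by (intro integrable_mult_bounded_support[of w \<phi> p M R]) (auto simp: adm_def)
  qed
  have P_mid: "mid w w' \<in> P n" if w: "w \<in> P n" "w' \<in> P n" for w w' n
    unfolding P_def
  proof (intro CollectI conjI ballI allI impI)
    show "adm (mid w w')" using w by (intro adm_mid) (auto simp: P_def)
    fix \<phi> c assume *: "\<phi> \<in> F" "\<forall>m\<ge>n. \<bar>(\<integral>x. v m x * \<phi> x \<partial>lborel) - T \<phi>\<bar> \<le> c"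
    have "(\<integral>x. mid w w' x * \<phi> x \<partial>lborel) = (\<integral>x. (w x * \<phi> x + w' x * \<phi> x) / 2 \<partial>lborel)"
      by (simp add: mid_def distrib_right)
    also have "\<dots> = ((\<integral>x. w x * \<phi> x \<partial>lborel) + (\<integral>x. w' x * \<phi> x \<partial>lborel)) / 2"
      using int_F[OF P_adm[OF w(1)] *(1)] int_F[OF P_adm[OF w(2)] *(1)] by simp
    moreover have "\<bar>(\<integral>x. w x * \<phi> x \<partial>lborel) - T \<phi>\<bar> \<le> c" "\<bar>(\<integral>x. w' x * \<phi> x \<partial>lborel) - T \<phi>\<bar> \<le> c"
      using w * by (auto simp: P_def)
    moreover have "\<bar>(a + b) / 2 - t\<bar> \<le> c" if "\<bar>a - t\<bar> \<le> c" "\<bar>b - t\<bar> \<le> c" for a b t :: real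
      using that by (simp add: abs_le_iff field_simps)
    ultimately show "\<bar>(\<integral>x. mid w w' x * \<phi> x \<partial>lborel) - T \<phi>\<bar> \<le> c" by (simp only:)
  qed
  have P_ne: "P n \<noteq> {}" for n using vP by blast
  define I where "I n = (INF w\<in>P n. J w)" for n
  have bdd: "bdd_below (J ` P n)" for n using J_le(1) P_adm by (intro bdd_belowI[of _ 0]) auto
  have I_le: "I n \<le> J w" if "w \<in> P n" for n w unfolding I_def using that bdd by (intro cINF_lower)
  \<comment> \<open>The sets shrink, so their infima increase, and the uniform bound on
    \<open>J\<close> gives them a limit. This is what makes near-minimisers from different sets
    comparable.\<close>
  have "incseq I"
    unfolding incseq_def I_def by (intro allI impI cINF_superset_mono P_ne bdd P_mono) auto
  moreover have "I n \<le> 2 * W + B" for n using I_le[OF vP] J_le(2)[OF P_adm[OF vP]] by (rule order.trans)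
  ultimately obtain L where L: "I \<longlonglongrightarrow> L" "\<And>n. I n \<le> L"
    using incseq_convergent[of I "2 * W + B"] by blast
  have "\<exists>w\<in>P n. J w < I n + 1 / real (Suc n)" for n
  proof -
    have "I n < I n + 1 / real (Suc n)" by simp
    then show ?thesis unfolding I_def by (subst (asm) cINF_less_iff[OF P_ne bdd]) auto
  qed
  then obtain w where w: "\<And>n. w n \<in> P n" "\<And>n. J (w n) < I n + 1 / real (Suc n)" by metis
  have adm_w: "adm (w n)" for n using w(1) by (rule P_adm)
  have [measurable]: "w n \<in> borel_measurable borel" for n using adm_w[of n] by (simp add: adm_def)
  have cauchy: "\<exists>N. \<forall>i\<ge>N. \<forall>j\<ge>N. (\<integral>x. norm (\<omega> x * w i x - \<omega> x * w j x) \<partial>lborel) < e" if e: "e > 0" for e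
  proof -
    \<comment> \<open>Each of the three terms of the defect inequality is kept below or equal to
      \<open>e / 4\<close>: first by \<open>\<epsilon>\<close>, then the tail by \<open>M\<close>,
      then the convexity defect by \<open>N\<close>. The \<open>1\<close> added to \<open>W\<close>
      avoids a vanishing denominator.\<close>
    define \<epsilon> where "\<epsilon> = e / (4 * (W + 1))"
    have \<epsilon>: "\<epsilon> > 0" "\<epsilon> * W \<le> e / 4" using e W by (auto simp: \<epsilon>_def field_simps)
    have "((\<lambda>M. M powr (1 - p)) \<longlongrightarrow> 0) at_top"
      by (rule tendsto_neg_powr) (use p in \<open>auto intro: filterlim_ident\<close>)
    from tendsto_mult_right_zero[OF this, of "4 * B"]
    have "\<forall>\<^sub>F M in at_top. 4 * B * M powr (1 - p) < e / 4"
      by (rule order_tendstoD(2)) (use e in simp)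
    then have "\<forall>\<^sub>F M in at_top. 4 * B * M powr (1 - p) < e / 4 \<and> M > 0"
      by (rule eventually_conj) (rule eventually_gt_at_top)
    then obtain M where M: "4 * B * M powr (1 - p) < e / 4" "M > 0"
      using eventually_happens'[OF trivial_limit_at_top_linorder] by blast
    define c where "c = 4 * (1 + M) ^ 3 / \<epsilon>"
    have c: "c > 0" using M \<epsilon> by (simp add: c_def)
    have "(\<lambda>n. 1 / real (Suc n)) \<longlonglongrightarrow> 0"
      using LIMSEQ_inverse_real_of_nat by (simp add: inverse_eq_divide)
    then have "(\<lambda>n. c * (2 * (L - I n) + 2 * (1 / real (Suc n)))) \<longlonglongrightarrow> c * (2 * (L - L) + 2 * 0)"
      by (intro tendsto_mult tendsto_add tendsto_diff tendsto_const L(1))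
    then have "(\<lambda>n. c * (2 * (L - I n) + 2 * (1 / real (Suc n)))) \<longlonglongrightarrow> 0" by simp
    then have "\<forall>\<^sub>F n in sequentially. c * (2 * (L - I n) + 2 * (1 / real (Suc n))) < e / 4"
      by (rule order_tendstoD(2)) (use e in simp)
    then obtain N where N: "c * (2 * (L - I N) + 2 * (1 / real (Suc N))) < e / 4"
      using eventually_happens'[OF sequentially_bot] by blast
    have "(\<integral>x. norm (\<omega> x * w i x - \<omega> x * w j x) \<partial>lborel) < e" if ij: "i \<ge> N" "j \<ge> N" for i j
    proof -
      \<comment> \<open>The midpoint lies in \<open>P N\<close>, so \<open>J ?m \<ge> I N\<close>,
        whereas \<open>J (w i)\<close> and \<open>J (w j)\<close> are below
        \<open>L + 1 / real (Suc N)\<close>. The integrated convexity defect is therefore at most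
        \<open>2 * (L - I N) + 2 / real (Suc N)\<close>.\<close>
      let ?m = "mid (w i) (w j)"
      have m: "?m \<in> P N" using w(1) P_mono ij by (intro P_mid) blast+
      note ints = int_bracket[OF adm_w[of i]] int_bracket[OF adm_w[of j]] int_bracket[OF P_adm[OF m]]
      have powr_int: "integrable lborel (\<lambda>x. \<bar>w k x\<bar> powr p)" "(\<integral>x. \<bar>w k x\<bar> powr p \<partial>lborel) \<le> B" for k
        using adm_w[of k] by (auto simp: adm_def)
      define D where "D x = \<epsilon> * \<omega> x + c * (\<omega> x * bracket (w i x) + \<omega> x * bracket (w j x) - 2 * (\<omega> x * bracket (?m x)))
          + 2 * M powr (1 - p) * (\<bar>w i x\<bar> powr p + \<bar>w j x\<bar> powr p)" for x
      have "(\<integral>x. norm (\<omega> x * w i x - \<omega> x * w j x) \<partial>lborel) \<le> (\<integral>x. D x \<partial>lborel)"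
      proof (rule integral_mono)
        show "integrable lborel (\<lambda>x. norm (\<omega> x * w i x - \<omega> x * w j x))"
          by (intro integrable_norm Bochner_Integration.integrable_diff int_w adm_w)
        show "integrable lborel D" unfolding D_def
          by (intro Bochner_Integration.integrable_add Bochner_Integration.integrable_diff
              integrable_mult_right ints powr_int \<omega>(1))
        fix x
        have "norm (\<omega> x * w i x - \<omega> x * w j x) = \<omega> x * \<bar>w i x - w j x\<bar>"
          using \<omega>(2)[of x] by (simp add: abs_mult flip: right_diff_distrib)
        also have "\<dots> \<le> \<omega> x * (\<epsilon> + c * (bracket (w i x) + bracket (w j x) - 2 * bracket (?m x))
            + 2 * M powr (1 - p) * (\<bar>w i x\<bar> powr p + \<bar>w j x\<bar> powr p))"
          unfolding c_def mid_def using \<omega>(2)[of x] p M \<epsilon> by (intro mult_left_mono abs_diff_le_bracket_defect) auto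
        also have "\<dots> = \<epsilon> * \<omega> x + c * (\<omega> x * bracket (w i x) + \<omega> x * bracket (w j x) - 2 * (\<omega> x * bracket (?m x)))
            + \<omega> x * (2 * M powr (1 - p) * (\<bar>w i x\<bar> powr p + \<bar>w j x\<bar> powr p))"
          by (simp add: algebra_simps)
        also have "\<dots> \<le> D x" unfolding D_def
          using \<omega>(2,3)[of x] by (intro add_left_mono mult_left_le_one_le) auto
        finally show "norm (\<omega> x * w i x - \<omega> x * w j x) \<le> D x" .
      qed
      also have "(\<integral>x. D x \<partial>lborel) = \<epsilon> * W + c * (J (w i) + J (w j) - 2 * J ?m)
          + 2 * M powr (1 - p) * ((\<integral>x. \<bar>w i x\<bar> powr p \<partial>lborel) + (\<integral>x. \<bar>w j x\<bar> powr p \<partial>lborel))"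
        unfolding D_def J_def W_def using ints powr_int(1)[of i] powr_int(1)[of j] \<omega>(1) by simp
      also have "\<dots> \<le> e / 4 + c * (2 * (L - I N) + 2 * (1 / real (Suc N))) + 2 * M powr (1 - p) * (B + B)"
      proof (intro add_mono mult_left_mono powr_int(2))
        have "1 / real (Suc i) \<le> 1 / real (Suc N)" "1 / real (Suc j) \<le> 1 / real (Suc N)"
          using ij by (auto intro!: divide_left_mono)
        then show "J (w i) + J (w j) - 2 * J ?m \<le> 2 * (L - I N) + 2 * (1 / real (Suc N))"
          using w(2)[of i] w(2)[of j] L(2)[of i] L(2)[of j] I_le[OF m] by (simp only: right_diff_distrib)
      qed (use \<epsilon> c in auto)
      also have "2 * M powr (1 - p) * (B + B) = 4 * B * M powr (1 - p)" by simp
      also have "e / 4 + c * (2 * (L - I N) + 2 * (1 / real (Suc N))) + 4 * B * M powr (1 - p) < e / 4 + e / 4 + e / 4"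
        by (intro add_strict_mono add_le_less_mono N M(1) order_refl)
      also have "\<dots> \<le> e" using e by simp
      finally show ?thesis .
    qed
    then show ?thesis by blast
  qed
  obtain r where r: "strict_mono r" "AE x in lborel. Cauchy (\<lambda>k. \<omega> x * w (r k) x)"
    using cauchy_L1_AE_cauchy_subseq[of lborel "\<lambda>n x. \<omega> x * w n x", OF int_w[OF adm_w] cauchy] by blast
  \<comment> \<open>On the null set where the subsequence diverges, \<open>g\<close> takes whatever
    value \<open>lim\<close> returns; it is measurable all the same.\<close>
  define g where "g x = lim (\<lambda>k. w (r k) x)" for x
  have [measurable]: "g \<in> borel_measurable borel" unfolding g_def[abs_def] by measurable
  have g_lim: "AE x in lborel. (\<lambda>k. w (r k) x) \<longlonglongrightarrow> g x"
    using r(2)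
  proof eventually_elim
    case (elim x)
    then obtain l where "(\<lambda>k. \<omega> x * w (r k) x) \<longlonglongrightarrow> l" by (auto simp: Cauchy_convergent_iff convergent_def)
    from tendsto_mult_left[OF this, of "1 / \<omega> x"] have "(\<lambda>k. w (r k) x) \<longlonglongrightarrow> 1 / \<omega> x * l"
      using \<omega>(2)[of x] by simp
    then show ?case unfolding g_def by (simp add: limI)
  qed
  have g_norm: "(\<integral>\<^sup>+x. ennreal (\<bar>g x\<bar> powr p) \<partial>lborel) \<le> ennreal B"
  proof -
    have "(\<integral>\<^sup>+x. ennreal (\<bar>g x\<bar> powr p) \<partial>lborel) = (\<integral>\<^sup>+x. liminf (\<lambda>k. ennreal (\<bar>w (r k) x\<bar> powr p)) \<partial>lborel)"
    proof (rule nn_integral_cong_AE)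
      show "AE x in lborel. ennreal (\<bar>g x\<bar> powr p) = liminf (\<lambda>k. ennreal (\<bar>w (r k) x\<bar> powr p))"
        using g_lim
      proof eventually_elim
        case (elim x)
        then have "(\<lambda>k. ennreal (\<bar>w (r k) x\<bar> powr p)) \<longlonglongrightarrow> ennreal (\<bar>g x\<bar> powr p)"
          using p by (intro tendsto_intros tendsto_powr') auto
        then show ?case by (rule lim_imp_Liminf[OF sequentially_bot, symmetric])
      qed
    qed
    also have "\<dots> \<le> liminf (\<lambda>k. \<integral>\<^sup>+x. ennreal (\<bar>w (r k) x\<bar> powr p) \<partial>lborel)"
      by (rule nn_integral_liminf) measurable
    also have "\<dots> \<le> liminf (\<lambda>k. ennreal B)"
      using adm_w by (intro Liminf_mono always_eventually allI)
        (auto simp: adm_def nn_integral_eq_integral intro!: ennreal_leI)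
    finally show ?thesis by (simp add: Liminf_const)
  qed
  have g_int: "integrable lborel (\<lambda>x. \<bar>g x\<bar> powr p)"
    using g_norm by (intro integrableI_nonneg) (auto simp: less_top[symmetric] top_unique)
  have "ennreal (\<integral>x. \<bar>g x\<bar> powr p \<partial>lborel) \<le> ennreal B"
    using g_norm g_int by (simp add: nn_integral_eq_integral)
  then have g_adm: "adm g" using B g_int by (simp add: adm_def)
  \<comment> \<open>The Cauchy property with one index fixed and the other running through the
    subsequence gives, by Fatou, convergence of the whole sequence in the weighted space.\<close>
  have g_L1: "\<exists>N. \<forall>i\<ge>N. (\<integral>x. \<omega> x * \<bar>w i x - g x\<bar> \<partial>lborel) \<le> e" if e: "e > 0" for e
  proof -
    obtain N where N: "\<And>i j. i \<ge> N \<Longrightarrow> j \<ge> N \<Longrightarrow> (\<integral>x. norm (\<omega> x * w i x - \<omega> x * w j x) \<partial>lborel) < e"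
      using cauchy[OF e] by blast
    have "(\<integral>x. \<omega> x * \<bar>w i x - g x\<bar> \<partial>lborel) \<le> e" if i: "i \<ge> N" for i
    proof -
      have int: "integrable lborel (\<lambda>x. \<omega> x * \<bar>w i x - g x\<bar>)"
      proof -
        have "integrable lborel (\<lambda>x. \<bar>\<omega> x * w i x - \<omega> x * g x\<bar>)"
          by (intro integrable_abs Bochner_Integration.integrable_diff int_w adm_w g_adm)
        also have "(\<lambda>x. \<bar>\<omega> x * w i x - \<omega> x * g x\<bar>) = (\<lambda>x. \<omega> x * \<bar>w i x - g x\<bar>)"
          using \<omega>(2) by (auto simp: abs_mult less_imp_le simp flip: right_diff_distrib)
        finally show ?thesis .
      qed
      have "ennreal (\<integral>x. \<omega> x * \<bar>w i x - g x\<bar> \<partial>lborel) = (\<integral>\<^sup>+x. ennreal (\<omega> x * \<bar>w i x - g x\<bar>) \<partial>lborel)"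
        using int \<omega>(2) by (subst nn_integral_eq_integral) (auto simp: less_imp_le)
      also have "\<dots> = (\<integral>\<^sup>+x. liminf (\<lambda>k. ennreal (norm (\<omega> x * w i x - \<omega> x * w (r k) x))) \<partial>lborel)"
      proof (rule nn_integral_cong_AE)
        show "AE x in lborel. ennreal (\<omega> x * \<bar>w i x - g x\<bar>)
            = liminf (\<lambda>k. ennreal (norm (\<omega> x * w i x - \<omega> x * w (r k) x)))"
          using g_lim
        proof eventually_elim
          case (elim x)
          then have "(\<lambda>k. ennreal (norm (\<omega> x * w i x - \<omega> x * w (r k) x))) \<longlonglongrightarrow> ennreal (norm (\<omega> x * w i x - \<omega> x * g x))"
            by (intro tendsto_intros)
          from lim_imp_Liminf[OF sequentially_bot this, symmetric]
          have "ennreal (norm (\<omega> x * w i x - \<omega> x * g x))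
            = liminf (\<lambda>k. ennreal (norm (\<omega> x * w i x - \<omega> x * w (r k) x)))" .
          moreover have "norm (\<omega> x * w i x - \<omega> x * g x) = \<omega> x * \<bar>w i x - g x\<bar>"
            using \<omega>(2)[of x] by (simp add: abs_mult flip: right_diff_distrib)
          ultimately show ?case by (simp only:)
        qed
      qed
      also have "\<dots> \<le> liminf (\<lambda>k. \<integral>\<^sup>+x. ennreal (norm (\<omega> x * w i x - \<omega> x * w (r k) x)) \<partial>lborel)"
        by (rule nn_integral_liminf) measurable
      also have "\<dots> \<le> liminf (\<lambda>k. ennreal e)"
      proof (rule Liminf_mono)
        have "\<forall>\<^sub>F k in sequentially. k \<ge> N" by (rule eventually_ge_at_top)
        then show "\<forall>\<^sub>F k in sequentially. (\<integral>\<^sup>+x. ennreal (norm (\<omega> x * w i x - \<omega> x * w (r k) x)) \<partial>lborel) \<le> ennreal e"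
        proof eventually_elim
          case (elim k)
          then have "r k \<ge> N" using seq_suble[OF r(1), of k] by linarith
          with N[OF i] have "(\<integral>x. norm (\<omega> x * w i x - \<omega> x * w (r k) x) \<partial>lborel) \<le> e" by (simp add: less_imp_le)
          moreover have "integrable lborel (\<lambda>x. norm (\<omega> x * w i x - \<omega> x * w (r k) x))"
            by (intro integrable_norm Bochner_Integration.integrable_diff int_w adm_w)
          ultimately show ?case by (subst nn_integral_eq_integral) (auto intro!: ennreal_leI)
        qed
      qed
      finally show ?thesis using e by (simp add: Liminf_const)
    qed
    then show ?thesis by blast
  qed
  have "(\<integral>x. g x * \<phi> x \<partial>lborel) = T \<phi>" if \<phi>: "\<phi> \<in> F" for \<phi>
  proof -
    obtain M R where M: "\<And>x. \<bar>\<phi> x\<bar> \<le> M" and R: "\<And>x. norm x > R \<Longrightarrow> \<phi> x = 0" using F(2,3)[OF \<phi>] by blast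
    obtain c where c: "c > 0" "\<And>x. norm x \<le> R \<Longrightarrow> c \<le> \<omega> x" using \<omega>(4)[of R] by blast
    have M0: "M \<ge> 0" using M[of 0] by linarith
    \<comment> \<open>The quotient \<open>M / c\<close> dominates \<open>\<phi>\<close> by the
      weight on the ball; the added \<open>1\<close> keeps \<open>C\<close> positive also for
      \<open>M = 0\<close>, since the proof divides by \<open>C\<close>.\<close>
    define C where "C = M / c + 1"
    have C: "C > 0" using M0 c by (simp add: C_def add_nonneg_pos)
    have \<phi>_le: "\<bar>\<phi> x\<bar> \<le> C * \<omega> x" for x
    proof (cases "norm x \<le> R")
      case True
      have "\<bar>\<phi> x\<bar> \<le> M / c * c" using M[of x] c by simp
      also have "\<dots> \<le> C * \<omega> x" using c(2)[OF True] c(1) M0 by (intro mult_mono) (auto simp: C_def)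
      finally show ?thesis .
    next
      case False
      then show ?thesis using R[of x] C \<omega>(2)[of x] by simp
    qed
    have "\<bar>(\<integral>x. g x * \<phi> x \<partial>lborel) - T \<phi>\<bar> \<le> 0 + e" if e: "e > 0" for e
    proof -
      obtain N where N: "\<And>i. i \<ge> N \<Longrightarrow> (\<integral>x. \<omega> x * \<bar>w i x - g x\<bar> \<partial>lborel) \<le> e / (2 * C)"
        using g_L1[of "e / (2 * C)"] e C by auto
      have "\<forall>\<^sub>F m in sequentially. dist (\<integral>x. v m x * \<phi> x \<partial>lborel) (T \<phi>) < e / 2"
        using T[OF \<phi>] e by (intro tendstoD) auto
      then obtain N' where N': "\<And>m. m \<ge> N' \<Longrightarrow> \<bar>(\<integral>x. v m x * \<phi> x \<partial>lborel) - T \<phi>\<bar> \<le> e / 2"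
        unfolding eventually_sequentially dist_real_def by (meson less_imp_le)
      define i where "i = max N N'"
      have 1: "\<bar>(\<integral>x. w i x * \<phi> x \<partial>lborel) - T \<phi>\<bar> \<le> e / 2"
      proof -
        have "\<forall>m\<ge>i. \<bar>(\<integral>x. v m x * \<phi> x \<partial>lborel) - T \<phi>\<bar> \<le> e / 2" using N' by (simp add: i_def)
        with w(1)[of i] \<phi> show ?thesis unfolding P_def by blast
      qed
      have int: "integrable lborel (\<lambda>x. \<omega> x * \<bar>w i x - g x\<bar>)"
      proof -
        have "integrable lborel (\<lambda>x. \<bar>\<omega> x * w i x - \<omega> x * g x\<bar>)"
          by (intro integrable_abs Bochner_Integration.integrable_diff int_w adm_w g_adm)
        also have "(\<lambda>x. \<bar>\<omega> x * w i x - \<omega> x * g x\<bar>) = (\<lambda>x. \<omega> x * \<bar>w i x - g x\<bar>)"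
          using \<omega>(2) by (auto simp: abs_mult less_imp_le simp flip: right_diff_distrib)
        finally show ?thesis .
      qed
      have "\<bar>(\<integral>x. w i x * \<phi> x \<partial>lborel) - (\<integral>x. g x * \<phi> x \<partial>lborel)\<bar> = \<bar>\<integral>x. w i x * \<phi> x - g x * \<phi> x \<partial>lborel\<bar>"
        using int_F[OF adm_w \<phi>] int_F[OF g_adm \<phi>] by simp
      also have "\<dots> \<le> (\<integral>x. \<bar>w i x * \<phi> x - g x * \<phi> x\<bar> \<partial>lborel)" by (rule integral_abs_bound)
      also have "\<dots> \<le> (\<integral>x. C * (\<omega> x * \<bar>w i x - g x\<bar>) \<partial>lborel)"
      proof (rule integral_mono)
        show "integrable lborel (\<lambda>x. \<bar>w i x * \<phi> x - g x * \<phi> x\<bar>)"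
          by (intro integrable_abs Bochner_Integration.integrable_diff int_F adm_w g_adm \<phi>)
        show "integrable lborel (\<lambda>x. C * (\<omega> x * \<bar>w i x - g x\<bar>))" using int by (rule integrable_mult_right)
        fix x
        show "\<bar>w i x * \<phi> x - g x * \<phi> x\<bar> \<le> C * (\<omega> x * \<bar>w i x - g x\<bar>)"
        proof -
          have "\<bar>w i x * \<phi> x - g x * \<phi> x\<bar> = \<bar>\<phi> x\<bar> * \<bar>w i x - g x\<bar>"
            by (simp add: abs_mult[symmetric] right_diff_distrib mult.commute)
          also have "\<dots> \<le> C * \<omega> x * \<bar>w i x - g x\<bar>" by (intro mult_right_mono \<phi>_le) simp
          finally show ?thesis by (simp only: mult.assoc)
        qed
      qed
      also have "\<dots> = C * (\<integral>x. \<omega> x * \<bar>w i x - g x\<bar> \<partial>lborel)" by simp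
      also have "\<dots> \<le> C * (e / (2 * C))" using N[of i] C by (intro mult_left_mono) (auto simp: i_def)
      also have "\<dots> = e / 2" using C by simp
      finally show ?thesis using 1 by linarith
    qed
    then have "\<bar>(\<integral>x. g x * \<phi> x \<partial>lborel) - T \<phi>\<bar> \<le> 0" by (rule field_le_epsilon)
    then show ?thesis by simp
  qed
  with g_adm show ?thesis by (intro that[of g]) (auto simp: adm_def)
qed

subsection \<open>Uniqueness of weak derivatives\<close>

text \<open>The classical flat function is the case \<open>m = 0\<close>; the divisors
  \<open>t ^ m\<close> are included because differentiation produces them, and with them the linear
  span of the family is closed under derivatives.\<close>

definition flat_exp :: "nat \<Rightarrow> real \<Rightarrow> real" where
  "flat_exp m t = (if t > 0 then exp (- (1 / t)) / t ^ m else 0)"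

lemma power_div_fact_le_exp:
  fixes y :: real
  assumes "y \<ge> 0"
  shows "y ^ n / fact n \<le> exp y"
proof -
  have "(\<Sum>k\<in>{n}. y ^ k /\<^sub>R fact k) \<le> (\<Sum>k. y ^ k /\<^sub>R fact k)"
    using assms summable_exp_generic[of y] by (intro sum_le_suminf) auto
  then show ?thesis using exp_converges[of y] by (simp add: sums_iff divide_inverse mult.commute)
qed

text \<open>A quadratic bound at \<open>0\<close> yields the vanishing derivative there. It comes
  from the term of index \<open>m + 2\<close> of the exponential series at \<open>1 / t\<close>:
  \<open>m\<close> powers of \<open>t\<close> cancel the divisor and two remain.\<close>

lemma flat_exp_le_square: "\<bar>flat_exp m t\<bar> \<le> fact (m + 2) * t\<^sup>2"
proof (cases "t > 0")
  case True
  have "(1 / t) ^ (m + 2) / fact (m + 2) \<le> exp (1 / t)"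
    using True by (intro power_div_fact_le_exp) simp
  then have *: "1 \<le> exp (1 / t) * (fact (m + 2) * t ^ (m + 2))"
    using True by (simp add: power_one_over pos_divide_le_eq) (simp add: divide_simps mult.commute)
  have "exp (- (1 / t)) * 1 \<le> exp (- (1 / t)) * (exp (1 / t) * (fact (m + 2) * t ^ (m + 2)))"
    by (intro mult_left_mono *) simp
  also have "\<dots> = (exp (- (1 / t)) * exp (1 / t)) * (fact (m + 2) * t ^ (m + 2))" by (simp only: mult.assoc)
  also have "exp (- (1 / t)) * exp (1 / t) = 1" by (simp flip: exp_add)
  finally have "exp (- (1 / t)) \<le> fact (m + 2) * t\<^sup>2 * t ^ m"
    by (simp add: power_add power2_eq_square mult.assoc mult.commute[of "t ^ m"])
  then show ?thesis using True by (simp add: flat_exp_def pos_divide_le_eq)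
qed (simp add: flat_exp_def)

lemma flat_exp_has_derivative:
  "(flat_exp m has_real_derivative flat_exp (m + 2) t - real m * flat_exp (Suc m) t) (at t)"
proof -
  consider "t > 0" | "t = 0" | "t < 0" by linarith
  then show ?thesis
  proof cases
    case 1
    have "((\<lambda>t. exp (- (1 / t)) / t ^ m) has_real_derivative
      ((exp (- (1 / t)) * (1 / t\<^sup>2)) * t ^ m - exp (- (1 / t)) * (real m * t ^ (m - 1))) / (t ^ m * t ^ m)) (at t)"
      using 1 by (auto intro!: derivative_eq_intros simp: power2_eq_square)
    also have "((exp (- (1 / t)) * (1 / t\<^sup>2)) * t ^ m - exp (- (1 / t)) * (real m * t ^ (m - 1))) / (t ^ m * t ^ m)
      = flat_exp (m + 2) t - real m * flat_exp (Suc m) t"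
    proof (cases m)
      case (Suc k)
      then show ?thesis using 1 by (simp add: flat_exp_def field_simps power2_eq_square power_add)
    qed (use 1 in \<open>simp add: flat_exp_def power2_eq_square\<close>)
    finally show ?thesis
      by (rule has_field_derivative_transform_within_open[where S = "{0<..}"]) (use 1 in \<open>auto simp: flat_exp_def\<close>)
  next
    case 2
    have "((\<lambda>h. (flat_exp m (0 + h) - flat_exp m 0) / h) \<longlongrightarrow> 0) (at 0)"
    proof (rule Lim_null_comparison)
      show "\<forall>\<^sub>F h in at 0. norm ((flat_exp m (0 + h) - flat_exp m 0) / h) \<le> fact (m + 2) * \<bar>h\<bar>"
      \<comment> \<open>The bound holds for every \<open>h\<close>, including \<open>h = 0\<close>,
        where division by zero gives \<open>0\<close>.\<close>
      proof (rule always_eventually, rule allI)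
        fix h
        show "norm ((flat_exp m (0 + h) - flat_exp m 0) / h) \<le> fact (m + 2) * \<bar>h\<bar>"
        proof (cases "h = 0")
          case False
          have "\<bar>flat_exp m h\<bar> \<le> (fact (m + 2) * \<bar>h\<bar>) * \<bar>h\<bar>"
            using flat_exp_le_square[of m h] by (simp only: power2_eq_square abs_mult_self_eq mult.assoc)
          then have "\<bar>flat_exp m h\<bar> / \<bar>h\<bar> \<le> fact (m + 2) * \<bar>h\<bar>" using False by (subst pos_divide_le_eq) auto
          then show ?thesis by (simp add: flat_exp_def[of m 0])
        qed simp
      qed
      show "((\<lambda>h::real. fact (m + 2) * \<bar>h\<bar>) \<longlongrightarrow> 0) (at 0)"
        by (intro tendsto_mult_right_zero tendsto_rabs_zero tendsto_ident_at)
    qed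
    then show ?thesis using 2 by (simp add: DERIV_def flat_exp_def)
  next
    case 3
    have "((\<lambda>_. 0) has_real_derivative 0) (at t)" by simp
    then have "(flat_exp m has_real_derivative 0) (at t)"
      by (rule has_field_derivative_transform_within_open[where S = "{..<0}"]) (use 3 in \<open>auto simp: flat_exp_def\<close>)
    then show ?thesis using 3 by (simp add: flat_exp_def)
  qed
qed

text \<open>Closed under directional derivatives, hence smooth, and rich enough to contain approximate
  indicators of boxes.\<close>

inductive bump_algebra :: "('a::euclidean_space \<Rightarrow> real) \<Rightarrow> bool" where
  const: "bump_algebra (\<lambda>_. c)"
| flat: "bump_algebra (\<lambda>x. flat_exp m (x \<bullet> e + d))"
| add: "bump_algebra f \<Longrightarrow> bump_algebra g \<Longrightarrow> bump_algebra (\<lambda>x. f x + g x)"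
| mult: "bump_algebra f \<Longrightarrow> bump_algebra g \<Longrightarrow> bump_algebra (\<lambda>x. f x * g x)"

lemma bump_algebra_derivative:
  assumes "bump_algebra f"
  obtains f' where "\<And>x. (f has_derivative f' x) (at x)" "\<And>v. bump_algebra (\<lambda>x. f' x v)"
proof -
  from assms have "\<exists>f'. (\<forall>x. (f has_derivative f' x) (at x)) \<and> (\<forall>v. bump_algebra (\<lambda>x. f' x v))"
  proof induction
    case (const c)
    show ?case by (intro exI[of _ "\<lambda>_ _. 0"] conjI allI has_derivative_const bump_algebra.const)
  next
    case (flat m e d)
    \<comment> \<open>The subtraction is written as adding a multiple by \<open>- real m\<close>, so
      that the term is assembled by the introduction rules of the algebra.\<close>
    let ?f' = "\<lambda>x v. (v \<bullet> e) * (flat_exp (m + 2) (x \<bullet> e + d) + (- real m) * flat_exp (Suc m) (x \<bullet> e + d))"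
    show ?case
    proof (intro exI[of _ ?f'] conjI allI)
      fix x
      have "((\<lambda>x. x \<bullet> e + d) has_derivative (\<lambda>v. v \<bullet> e)) (at x)" by (auto intro!: derivative_eq_intros)
      from DERIV_compose_FDERIV[OF flat_exp_has_derivative this, of m]
      show "((\<lambda>x. flat_exp m (x \<bullet> e + d)) has_derivative ?f' x) (at x)" by simp
    next
      fix v show "bump_algebra (\<lambda>x. ?f' x v)" by (intro bump_algebra.intros)
    qed
  next
    case (add f g)
    then obtain f' g' where f': "\<forall>x. (f has_derivative f' x) (at x)" "\<forall>v. bump_algebra (\<lambda>x. f' x v)"
      and g': "\<forall>x. (g has_derivative g' x) (at x)" "\<forall>v. bump_algebra (\<lambda>x. g' x v)" by blast
    then show ?case
      by (intro exI[of _ "\<lambda>x v. f' x v + g' x v"] conjI allI has_derivative_add bump_algebra.add) blast+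
  next
    case (mult f g)
    then obtain f' g' where f': "\<forall>x. (f has_derivative f' x) (at x)" "\<forall>v. bump_algebra (\<lambda>x. f' x v)"
      and g': "\<forall>x. (g has_derivative g' x) (at x)" "\<forall>v. bump_algebra (\<lambda>x. g' x v)" by blast
    with mult.hyps show ?case
      by (intro exI[of _ "\<lambda>x v. f x * g' x v + f' x v * g x"] conjI allI has_derivative_mult bump_algebra.add bump_algebra.mult) blast+
  qed
  then show ?thesis using that by blast
qed

lemma bump_algebra_Ck: "bump_algebra f \<Longrightarrow> Ck k f"
proof (induction k arbitrary: f)
  case 0
  then obtain f' where "\<And>x. (f has_derivative f' x) (at x)" by (rule bump_algebra_derivative) blast
  then show ?case by (auto intro!: continuous_at_imp_continuous_on has_derivative_continuous)
next
  case (Suc k)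
  from Suc.prems obtain f' where f': "\<And>x. (f has_derivative f' x) (at x)" "\<And>v. bump_algebra (\<lambda>x. f' x v)"
    by (rule bump_algebra_derivative) blast
  have "frechet_derivative f (at x) = f' x" for x using frechet_derivative_at[OF f'(1)] by simp
  then show ?case using f' Suc.IH by (auto simp: differentiable_on_def differentiable_def intro: has_derivative_at_withinI)
qed

lemma bump_algebra_prod:
  "finite I \<Longrightarrow> (\<And>i. i \<in> I \<Longrightarrow> bump_algebra (f i)) \<Longrightarrow> bump_algebra (\<lambda>x. \<Prod>i\<in>I. f i x)"
  by (induction I rule: finite_induct) (auto intro: bump_algebra.intros)

text \<open>In each coordinate one factor cuts off at \<open>a\<close> and one at \<open>b\<close>;
  the dilation by \<open>Suc n\<close> drives both to \<open>1\<close> inside the box. Each argument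
  is written as an inner product plus a constant to match the generators of
  \<open>bump_algebra\<close>.\<close>

definition box_bump :: "'a::euclidean_space \<Rightarrow> 'a \<Rightarrow> nat \<Rightarrow> 'a \<Rightarrow> real" where
  "box_bump a b n x = (\<Prod>i\<in>Basis. flat_exp 0 (x \<bullet> (real (Suc n) *\<^sub>R i) + - (real (Suc n) * (a \<bullet> i)))
    * flat_exp 0 (x \<bullet> (- real (Suc n) *\<^sub>R i) + real (Suc n) * (b \<bullet> i)))"

lemma flat_exp_0_bounds: "0 \<le> flat_exp 0 t" "flat_exp 0 t \<le> 1"
  by (auto simp: flat_exp_def)

lemma box_bump_bounds: "0 \<le> box_bump a b n x" "box_bump a b n x \<le> 1"
  unfolding box_bump_def using flat_exp_0_bounds
  by (auto intro!: prod_nonneg prod_le_1 mult_le_one)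

lemma box_bump_support:
  assumes "box_bump a b n x \<noteq> 0" shows "x \<in> box a b"
proof -
  have "a \<bullet> i < x \<bullet> i \<and> x \<bullet> i < b \<bullet> i" if i: "i \<in> Basis" for i
  proof -
    define s where "s = real (Suc n)"
    have s: "s > 0" by (simp add: s_def)
    have "flat_exp 0 (x \<bullet> (s *\<^sub>R i) + - (s * (a \<bullet> i))) \<noteq> 0" "flat_exp 0 (x \<bullet> (- s *\<^sub>R i) + s * (b \<bullet> i)) \<noteq> 0"
      using assms i by (auto simp: box_bump_def s_def)
    then have "s * (a \<bullet> i) < s * (x \<bullet> i)" "s * (x \<bullet> i) < s * (b \<bullet> i)"
      by (auto simp: flat_exp_def split: if_splits)
    then show ?thesis using s by simp
  qed
  then show ?thesis by (simp add: mem_box)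
qed

lemma box_bump_test_function: "box_bump a b n \<in> test_functions"
proof -
  have "bump_algebra (box_bump a b n)" unfolding box_bump_def[abs_def]
    by (intro bump_algebra_prod bump_algebra.mult bump_algebra.flat) auto
  moreover have "bounded {x. box_bump a b n x \<noteq> 0}"
    using box_bump_support by (intro bounded_subset[OF bounded_box[of a b]]) auto
  ultimately show ?thesis by (simp add: test_functions_def bump_algebra_Ck compact_closure)
qed

lemma box_bump_tendsto: "(\<lambda>n. box_bump a b n x) \<longlonglongrightarrow> indicator (box a b) x"
proof (cases "x \<in> box a b")
  case True
  have lim: "(\<lambda>n. flat_exp 0 (real (Suc n) * s)) \<longlonglongrightarrow> 1" if s: "s > 0" for s
  proof -
    have "(\<lambda>n. exp (- (inverse (real (Suc n)) * (1 / s)))) \<longlonglongrightarrow> exp (- (0 * (1 / s)))"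
      by (intro tendsto_exp tendsto_minus tendsto_mult LIMSEQ_inverse_real_of_nat tendsto_const)
    moreover have "exp (- (inverse (real (Suc n)) * (1 / s))) = flat_exp 0 (real (Suc n) * s)" for n
      using s by (simp add: flat_exp_def divide_inverse del: of_nat_Suc)
    ultimately show ?thesis by simp
  qed
  have "(\<lambda>n. \<Prod>i\<in>Basis. flat_exp 0 (real (Suc n) * ((x - a) \<bullet> i)) * flat_exp 0 (real (Suc n) * ((b - x) \<bullet> i)))
      \<longlonglongrightarrow> (\<Prod>i\<in>(Basis :: 'a set). 1 * 1)"
    using True by (intro tendsto_prod tendsto_mult lim) (auto simp: mem_box inner_diff_left)
  moreover have "(\<Prod>i\<in>Basis. flat_exp 0 (real (Suc n) * ((x - a) \<bullet> i)) * flat_exp 0 (real (Suc n) * ((b - x) \<bullet> i)))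
      = box_bump a b n x" for n
    unfolding box_bump_def by (intro prod.cong) (simp_all add: inner_diff_left right_diff_distrib del: of_nat_Suc)
  ultimately show ?thesis using True by simp
next
  case False
  then have "box_bump a b n x = 0" for n using box_bump_support by blast
  then show ?thesis using False by simp
qed

text \<open>The positive and negative parts of \<open>f\<close> are densities of two measures that
  agree on boxes and are finite there. Boxes form an intersection-stable generator, so the measures
  coincide, and uniqueness of densities equates the two parts almost everywhere.\<close>

lemma AE_zero_if_box_integrals_zero:
  fixes f :: "'a::euclidean_space \<Rightarrow> real"
  assumes f: "f \<in> borel_measurable borel"
    and int: "\<And>a b. integrable lborel (\<lambda>x. f x * indicator (box a b) x)"
    and zero: "\<And>a b. (\<integral>x. f x * indicator (box a b) x \<partial>lborel) = 0"
  shows "AE x in lborel. f x = 0"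
proof -
  have f': "(\<lambda>x. - f x) \<in> borel_measurable borel" using f by (rule borel_measurable_uminus)
  have em: "emeasure (density lborel (\<lambda>x. ennreal (g x))) (box a b) = (\<integral>\<^sup>+x. ennreal (g x * indicator (box a b) x) \<partial>lborel)"
    if g: "g \<in> borel_measurable borel" for g :: "'a \<Rightarrow> real" and a b
  proof -
    have "emeasure (density lborel (\<lambda>x. ennreal (g x))) (box a b) = (\<integral>\<^sup>+x. ennreal (g x) * indicator (box a b) x \<partial>lborel)"
      using g by (intro emeasure_density) auto
    also have "\<dots> = (\<integral>\<^sup>+x. ennreal (g x * indicator (box a b) x) \<partial>lborel)"
      by (intro nn_integral_cong) (simp split: split_indicator)
    finally show ?thesis .
  qed
  have fin: "(\<integral>\<^sup>+x. ennreal (f x * indicator (box a b) x) \<partial>lborel) \<noteq> \<infinity>"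
    "(\<integral>\<^sup>+x. ennreal (- f x * indicator (box a b) x) \<partial>lborel) \<noteq> \<infinity>" for a b
    using int[of a b] by (simp_all add: real_integrable_def)
  have eq: "(\<integral>\<^sup>+x. ennreal (f x * indicator (box a b) x) \<partial>lborel)
      = (\<integral>\<^sup>+x. ennreal (- f x * indicator (box a b) x) \<partial>lborel)" for a b
  proof -
    have "x = y" if "enn2real x - enn2real y = 0" "x \<noteq> \<infinity>" "y \<noteq> \<infinity>" for x y :: ennreal
      using that by (cases x; cases y) auto
    from this[OF _ fin] show ?thesis
      using zero[of a b] by (simp add: real_lebesgue_integral_def[OF int])
  qed
  \<comment> \<open>\<open>ennreal\<close> maps negative numbers to \<open>0\<close>, so these are the positive and negative parts.\<close>
  have "density lborel (\<lambda>x. ennreal (f x)) = density lborel (\<lambda>x. ennreal (- f x))"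
  proof (rule measure_eqI_generator_eq)
    let ?E = "range (\<lambda>(a, b). box a b::'a set)"
    show "Int_stable ?E" by (auto simp: Int_stable_def box_Int_box)
    show "?E \<subseteq> Pow UNIV" "sets (density lborel (\<lambda>x. ennreal (f x))) = sigma_sets UNIV ?E"
      "sets (density lborel (\<lambda>x. ennreal (- f x))) = sigma_sets UNIV ?E"
      by (simp_all add: borel_eq_box)
    let ?A = "\<lambda>n::nat. box (- (real n *\<^sub>R One)) (real n *\<^sub>R One) :: 'a set"
    show "range ?A \<subseteq> ?E" "(\<Union>i. ?A i) = UNIV"
      unfolding UN_box_eq_UNIV by auto
    show "emeasure (density lborel (\<lambda>x. ennreal (f x))) (?A i) \<noteq> \<infinity>" for i
      unfolding em[OF f] by (rule fin(1))
    show "emeasure (density lborel (\<lambda>x. ennreal (f x))) X = emeasure (density lborel (\<lambda>x. ennreal (- f x))) X"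
      if "X \<in> ?E" for X
    proof -
      from that obtain a b where X: "X = box a b" by auto
      show ?thesis unfolding X em[OF f] em[OF f'] by (rule eq)
    qed
  qed
  moreover have "(\<lambda>x. ennreal (f x)) \<in> borel_measurable lborel" "(\<lambda>x. ennreal (- f x)) \<in> borel_measurable lborel"
    using f f' by auto
  ultimately have "AE x in lborel. ennreal (f x) = ennreal (- f x)"
    by (simp only: sigma_finite_measure.density_unique_iff[OF sigma_finite_lborel])
  then show ?thesis
  proof eventually_elim
    case (elim x)
    then show ?case by (cases "f x \<ge> 0") (auto simp: ennreal_eq_0_iff ennreal_neg)
  qed
qed

text \<open>The fundamental lemma of the calculus of variations: \<open>box_bump\<close>
  approximates the indicator of a box from below with support inside it, so dominated convergence
  reduces the claim to integrals over boxes.\<close>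

lemma AE_zero_if_test_integrals_zero:
  fixes f :: "'a::euclidean_space \<Rightarrow> real"
  assumes f [measurable]: "f \<in> borel_measurable borel"
    and loc: "\<And>R. integrable lborel (\<lambda>x. f x * indicator (cball 0 R) x)"
    and zero: "\<And>\<phi>. \<phi> \<in> test_functions \<Longrightarrow> (\<integral>x. f x * \<phi> x \<partial>lborel) = 0"
  shows "AE x in lborel. f x = 0"
proof -
  have box_int: "integrable lborel (\<lambda>x. f x * indicator (box a b) x)" for a b
  proof -
    obtain R where "\<forall>x\<in>box a b. norm x \<le> R" using bounded_box[of a b] unfolding bounded_iff by blast
    then have R: "box a b \<subseteq> cball 0 R" by auto
    have "integrable lborel (\<lambda>x. indicator (box a b) x *\<^sub>R (f x * indicator (cball 0 R) x))"
      by (rule integrable_mult_indicator[OF _ loc]) simp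
    also have "(\<lambda>x. indicator (box a b) x *\<^sub>R (f x * indicator (cball 0 R) x)) = (\<lambda>x. f x * indicator (box a b) x)"
    proof
      fix x show "indicator (box a b) x *\<^sub>R (f x * indicator (cball 0 R) x) = f x * indicator (box a b) x"
        using R by (cases "x \<in> box a b") auto
    qed
    finally show ?thesis .
  qed
  show ?thesis
  proof (rule AE_zero_if_box_integrals_zero[OF f box_int])
    fix a b :: 'a
    have "(\<lambda>n. \<integral>x. f x * box_bump a b n x \<partial>lborel) \<longlonglongrightarrow> (\<integral>x. f x * indicator (box a b) x \<partial>lborel)"
    proof (rule integral_dominated_convergence)
      have "continuous_on UNIV (box_bump a b n)" for n
        using box_bump_test_function[of a b n] by (auto simp: test_functions_def dest: spec[of _ 0])
      then have [measurable]: "box_bump a b n \<in> borel_measurable borel" for n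
        by (rule borel_measurable_continuous_onI)
      show "(\<lambda>x. f x * box_bump a b n x) \<in> borel_measurable lborel" for n by measurable
      show "(\<lambda>x. f x * indicator (box a b) x) \<in> borel_measurable lborel" by measurable
      show "integrable lborel (\<lambda>x. \<bar>f x * indicator (box a b) x\<bar>)" by (rule integrable_abs[OF box_int])
      show "AE x in lborel. (\<lambda>n. f x * box_bump a b n x) \<longlonglongrightarrow> f x * indicator (box a b) x"
        by (intro AE_I2 tendsto_mult tendsto_const box_bump_tendsto)
      have "norm (f x * box_bump a b n x) \<le> \<bar>f x * indicator (box a b) x\<bar>" for n x
      proof (cases "x \<in> box a b")
        case True
        then show ?thesis using box_bump_bounds[of a b n x]
          by (simp add: abs_mult mult_left_le)
      next
        case False
        then have "box_bump a b n x = 0" using box_bump_support by blast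
        then show ?thesis by simp
      qed
      then show "AE x in lborel. norm (f x * box_bump a b n x) \<le> \<bar>f x * indicator (box a b) x\<bar>" for n by simp
    qed
    then show "(\<integral>x. f x * indicator (box a b) x \<partial>lborel) = 0"
      using zero[OF box_bump_test_function] by (simp add: LIMSEQ_const_iff)
  qed
qed

subsection \<open>Total variation and weak gradients\<close>

lemma test_function_facts:
  assumes "\<phi> \<in> (test_functions :: ('a::euclidean_space \<Rightarrow> 'b::euclidean_space) set)"
  shows "(\<phi> has_derivative frechet_derivative \<phi> (at x)) (at x)"
    and "continuous_on UNIV \<phi>" and "continuous_on UNIV (\<lambda>x. frechet_derivative \<phi> (at x) e)"
    and "compact (closure {x. \<phi> x \<noteq> 0})"
proof -
  have Ck: "Ck k \<phi>" for k using assms by (simp add: test_functions_def)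
  have d: "\<phi> differentiable at x" for x using Ck[of 1] by (simp add: differentiable_on_def)
  then show "(\<phi> has_derivative frechet_derivative \<phi> (at x)) (at x)" by (simp add: frechet_derivative_works)
  show "continuous_on UNIV \<phi>" using Ck[of 0] by simp
  show "continuous_on UNIV (\<lambda>x. frechet_derivative \<phi> (at x) e)" using Ck[of 1] by simp
  show "compact (closure {x. \<phi> x \<noteq> 0})" using assms by (simp add: test_functions_def)
qed

lemma integral_lebesgue_eq_lborel:
  fixes f g :: "'a::euclidean_space \<Rightarrow> real"
  assumes f: "f \<in> borel_measurable lebesgue" and g: "g \<in> borel_measurable borel"
    and eq: "AE x in lborel. f x = g x"
  shows "(LINT x|lebesgue. f x) = (LINT x|lborel. g x)"
proof -
  have "g \<in> borel_measurable lebesgue" using g by (intro measurable_completion) simp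
  then have "(LINT x|lebesgue. f x) = (LINT x|lebesgue. g x)"
    using f AE_completion[OF eq] by (intro integral_cong_AE)
  also have "\<dots> = (LINT x|lborel. g x)" using g by (intro integral_completion) simp
  finally show ?thesis .
qed

text \<open>Tonelli and translations are applied to Borel functions, while membership in
  \<open>Lp\<close> only gives Lebesgue measurability; this is the bridge between the two.\<close>

lemma Lp_borel_representative:
  fixes u :: "'a::euclidean_space \<Rightarrow> real"
  assumes "u \<in> borel_measurable lebesgue" "integrable lebesgue (\<lambda>x. \<bar>u x\<bar> powr p)"
  obtains v where "v \<in> borel_measurable borel" "AE x in lborel. u x = v x" "integrable lborel (\<lambda>x. \<bar>v x\<bar> powr p)"
proof -
  obtain v where v: "v \<in> borel_measurable lborel" "AE x in lborel. u x = v x"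
    using completion_ex_borel_measurable_real[OF assms(1)] by blast
  have vp: "(\<lambda>x. \<bar>v x\<bar> powr p) \<in> borel_measurable lborel" using v(1) by measurable
  have "integrable lebesgue (\<lambda>x. \<bar>v x\<bar> powr p)"
  proof (rule integrable_cong_AE_imp[OF assms(2)])
    show "(\<lambda>x. \<bar>v x\<bar> powr p) \<in> borel_measurable lebesgue" using vp by (rule measurable_completion)
    show "AE x in lebesgue. \<bar>u x\<bar> powr p = \<bar>v x\<bar> powr p"
      by (rule AE_mp[OF AE_completion[OF v(2)]]) simp
  qed
  then have "integrable lborel (\<lambda>x. \<bar>v x\<bar> powr p)" using integrable_completion[OF vp] by simp
  with v show ?thesis by (intro that[of v]) simp_all
qed

text \<open>Each summand of the divergence is the limit of difference quotients of \<open>v\<close>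
  tested with \<open>\<phi> x \<bullet> e\<close>. Since this factor is at most \<open>1\<close> in
  modulus, the increment bound gives \<open>B\<close> for each direction, and the basis directions
  add up.\<close>

lemma total_variation_le:
  fixes u v :: "'a::euclidean_space \<Rightarrow> real"
  assumes u: "u \<in> borel_measurable lebesgue" and v [measurable]: "v \<in> borel_measurable borel"
    and uv: "AE x in lborel. u x = v x" and vint: "integrable lborel (\<lambda>x. \<bar>v x\<bar> powr 1)"
    and B: "B \<ge> 0" and diff: "\<And>e \<tau>. e \<in> Basis \<Longrightarrow> \<tau> > 0 \<Longrightarrow>
      (\<integral>\<^sup>+x. ennreal (\<bar>v (x + \<tau> *\<^sub>R e) - v x\<bar> powr 1) \<partial>lborel) \<le> ennreal (B * \<tau>)"
  shows "total_variation u \<le> ennreal (real DIM('a) * B)"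
  unfolding total_variation_def
proof (rule SUP_least)
  fix \<phi> :: "'a \<Rightarrow> 'a" assume "\<phi> \<in> {\<phi> \<in> test_functions. \<forall>x. norm (\<phi> x) \<le> 1}"
  then have \<phi>: "\<phi> \<in> test_functions" "\<And>x. norm (\<phi> x) \<le> 1" by auto
  define D where "D e x = frechet_derivative \<phi> (at x) e \<bullet> e" for e x
  have Dm: "D e \<in> borel_measurable borel" for e
    unfolding D_def[abs_def]
    by (intro borel_measurable_continuous_onI continuous_on_inner continuous_on_const test_function_facts(3) \<phi>(1))
  have der: "((\<lambda>x. \<phi> x \<bullet> e) has_derivative (\<lambda>h. frechet_derivative \<phi> (at x) h \<bullet> e)) (at x)" for x e
    by (intro has_derivative_inner_left test_function_facts(1) \<phi>(1))
  have supp: "compact (closure {x. \<phi> x \<bullet> e \<noteq> 0})" for e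
  proof -
    have "closure {x. \<phi> x \<bullet> e \<noteq> 0} \<subseteq> closure {x. \<phi> x \<noteq> 0}" by (intro closure_mono) auto
    then have "closure {x. \<phi> x \<bullet> e \<noteq> 0} = closure {x. \<phi> x \<noteq> 0} \<inter> closure {x. \<phi> x \<bullet> e \<noteq> 0}" by blast
    also have "compact \<dots>" by (intro compact_Int_closed test_function_facts(4) \<phi>(1)) simp
    finally show ?thesis .
  qed
  define t where "t m = 1 / real (Suc m)" for m
  have t: "t m > 0" "t m \<le> 1" for m by (auto simp: t_def)
  have t0: "t \<longlonglongrightarrow> 0" unfolding t_def using LIMSEQ_inverse_real_of_nat by (simp add: inverse_eq_divide)
  have D_le: "\<bar>\<integral>x. v x * D e x \<partial>lborel\<bar> \<le> B" if e: "e \<in> Basis" for e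
  proof -
    have "(\<lambda>m. \<integral>x. (v (x + t m *\<^sub>R e) - v x) / t m * (\<phi> x \<bullet> e) \<partial>lborel) \<longlonglongrightarrow> - (\<integral>x. v x * D e x \<partial>lborel)"
      unfolding D_def
      by (rule difference_quotient_tendsto_weak_derivative[OF v order_refl vint der _ supp t t0])
        (intro continuous_on_inner continuous_on_const test_function_facts(3) \<phi>(1))
    then have "(\<lambda>m. \<bar>\<integral>x. (v (x + t m *\<^sub>R e) - v x) / t m * (\<phi> x \<bullet> e) \<partial>lborel\<bar>) \<longlonglongrightarrow> \<bar>- (\<integral>x. v x * D e x \<partial>lborel)\<bar>"
      by (rule tendsto_rabs)
    moreover have "\<bar>\<integral>x. (v (x + t m *\<^sub>R e) - v x) / t m * (\<phi> x \<bullet> e) \<partial>lborel\<bar> \<le> B" for m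
    proof -
      define q where "q x = (v (x + t m *\<^sub>R e) - v x) / t m * (\<phi> x \<bullet> e)" for x
      \<comment> \<open>If \<open>q\<close> were not integrable, its Bochner integral would be
        \<open>0\<close> and the inequality trivial.\<close>
      have "ennreal \<bar>\<integral>x. q x \<partial>lborel\<bar> \<le> (\<integral>\<^sup>+x. ennreal \<bar>q x\<bar> \<partial>lborel)"
        using integral_norm_bound_ennreal[of lborel q]
        by (cases "integrable lborel q") (simp_all add: not_integrable_integral_eq)
      also have "\<dots> \<le> (\<integral>\<^sup>+x. ennreal (1 / t m) * ennreal (\<bar>v (x + t m *\<^sub>R e) - v x\<bar> powr 1) \<partial>lborel)"
      proof (rule nn_integral_mono)
        fix x
        have "\<bar>\<phi> x \<bullet> e\<bar> \<le> 1" using Basis_le_norm[OF e, of "\<phi> x"] \<phi>(2)[of x] by linarith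
        then have "\<bar>v (x + t m *\<^sub>R e) - v x\<bar> * \<bar>\<phi> x \<bullet> e\<bar> \<le> \<bar>v (x + t m *\<^sub>R e) - v x\<bar> * 1"
          by (intro mult_left_mono) auto
        then have "\<bar>q x\<bar> \<le> 1 / t m * \<bar>v (x + t m *\<^sub>R e) - v x\<bar>"
          using t(1)[of m] by (simp add: q_def abs_mult divide_right_mono)
        then have "ennreal \<bar>q x\<bar> \<le> ennreal (1 / t m * \<bar>v (x + t m *\<^sub>R e) - v x\<bar>)" by (rule ennreal_leI)
        then show "ennreal \<bar>q x\<bar> \<le> ennreal (1 / t m) * ennreal (\<bar>v (x + t m *\<^sub>R e) - v x\<bar> powr 1)"
          using t(1)[of m] by (subst ennreal_mult[symmetric]) simp_all
      qed
      also have "\<dots> = ennreal (1 / t m) * (\<integral>\<^sup>+x. ennreal (\<bar>v (x + t m *\<^sub>R e) - v x\<bar> powr 1) \<partial>lborel)"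
        by (intro nn_integral_cmult) measurable
      also have "\<dots> \<le> ennreal (1 / t m) * ennreal (B * t m)" by (intro mult_left_mono diff e t) simp
      also have "\<dots> = ennreal B" using t(1)[of m] B by (subst ennreal_mult[symmetric]) simp_all
      finally have "\<bar>\<integral>x. q x \<partial>lborel\<bar> \<le> B" using B by simp
      then show ?thesis by (simp only: q_def)
    qed
    ultimately have "\<bar>- (\<integral>x. v x * D e x \<partial>lborel)\<bar> \<le> B" by (intro LIMSEQ_le_const2) auto
    then show ?thesis by simp
  qed
  have int: "integrable lborel (\<lambda>x. v x * D e x)" for e
  proof -
    obtain R where R: "R > 0" "\<And>x. norm x > R \<Longrightarrow> \<phi> x \<bullet> e = 0"
      using supp by (rule bounded_support_of_compact) blast
    have supp': "D e x = 0" if "norm x > R" for x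
      unfolding D_def using derivative_bounded_support[OF der R(2) that] .
    have cont: "continuous_on UNIV (D e)" unfolding D_def[abs_def]
      by (intro continuous_on_inner continuous_on_const test_function_facts(3) \<phi>(1))
    obtain M where M: "\<And>x. \<bar>D e x\<bar> \<le> M"
      using continuous_bounded_support_bounded[OF cont supp'] by blast
    show ?thesis by (rule integrable_mult_bounded_support[OF v Dm order_refl vint M supp'])
  qed
  have "(LINT x|lebesgue. u x * divergence \<phi> x) = (LINT x|lborel. v x * (\<Sum>e\<in>Basis. D e x))"
  proof (rule integral_lebesgue_eq_lborel)
    have "(\<lambda>x. \<Sum>e\<in>Basis. D e x) \<in> borel_measurable borel" by (intro borel_measurable_sum Dm)
    then show "(\<lambda>x. v x * (\<Sum>e\<in>Basis. D e x)) \<in> borel_measurable borel"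
      using v by (intro borel_measurable_times)
    have "(\<lambda>x. \<Sum>e\<in>Basis. D e x) \<in> borel_measurable lebesgue"
      by (rule measurable_completion) (simp add: \<open>(\<lambda>x. \<Sum>e\<in>Basis. D e x) \<in> borel_measurable borel\<close>)
    then show "(\<lambda>x. u x * divergence \<phi> x) \<in> borel_measurable lebesgue"
      unfolding divergence_def D_def[symmetric] using u by (intro borel_measurable_times)
    show "AE x in lborel. u x * divergence \<phi> x = v x * (\<Sum>e\<in>Basis. D e x)"
      using uv by eventually_elim (simp add: divergence_def D_def)
  qed
  also have "\<dots> = (\<Sum>e\<in>Basis. \<integral>x. v x * D e x \<partial>lborel)"
    unfolding sum_distrib_left by (intro Bochner_Integration.integral_sum int)
  also have "\<bar>\<dots>\<bar> \<le> (\<Sum>e\<in>(Basis :: 'a set). B)"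
    by (intro order.trans[OF sum_abs] sum_mono D_le)
  finally show "ennreal \<bar>LINT x|lebesgue. u x * divergence \<phi> x\<bar> \<le> ennreal (real DIM('a) * B)"
    by (intro ennreal_leI) simp
qed

text \<open>The scaling \<open>\<tau> powr p\<close> of the increments bounds the difference
  quotients uniformly in \<open>Lp\<close>; their weak limit acts on test functions as the
  distributional derivative and keeps the bound \<open>B\<close>.\<close>

lemma exists_weak_partial_derivative:
  fixes v :: "'a::euclidean_space \<Rightarrow> real"
  assumes p: "p > 1" and v [measurable]: "v \<in> borel_measurable borel"
    and vint: "integrable lborel (\<lambda>x. \<bar>v x\<bar> powr p)" and B: "B \<ge> 0"
    and diff: "\<And>\<tau>. \<tau> > 0 \<Longrightarrow>
      (\<integral>\<^sup>+x. ennreal (\<bar>v (x + \<tau> *\<^sub>R e) - v x\<bar> powr p) \<partial>lborel) \<le> ennreal (B * \<tau> powr p)"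
  obtains g where "g \<in> borel_measurable borel" "integrable lborel (\<lambda>x. \<bar>g x\<bar> powr p)"
    "(\<integral>x. \<bar>g x\<bar> powr p \<partial>lborel) \<le> B"
    "\<And>\<phi>. \<phi> \<in> test_functions \<Longrightarrow>
      (\<integral>x. g x * \<phi> x \<partial>lborel) = - (\<integral>x. v x * frechet_derivative \<phi> (at x) e \<partial>lborel)"
proof -
  define t where "t m = 1 / real (Suc m)" for m
  have t: "t m > 0" "t m \<le> 1" for m by (auto simp: t_def)
  have t0: "t \<longlonglongrightarrow> 0" unfolding t_def using LIMSEQ_inverse_real_of_nat by (simp add: inverse_eq_divide)
  define q where "q m x = (v (x + t m *\<^sub>R e) - v x) / t m" for m x
  have qm [measurable]: "q m \<in> borel_measurable borel" for m unfolding q_def[abs_def] by measurable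
  have q_nn: "(\<integral>\<^sup>+x. ennreal (\<bar>q m x\<bar> powr p) \<partial>lborel) \<le> ennreal B" for m
  proof -
    have eq: "\<bar>q m x\<bar> powr p = 1 / t m powr p * \<bar>v (x + t m *\<^sub>R e) - v x\<bar> powr p" for x
      using t(1)[of m] by (simp add: q_def powr_divide abs_divide)
    have "(\<integral>\<^sup>+x. ennreal (\<bar>q m x\<bar> powr p) \<partial>lborel)
        = (\<integral>\<^sup>+x. ennreal (1 / t m powr p) * ennreal (\<bar>v (x + t m *\<^sub>R e) - v x\<bar> powr p) \<partial>lborel)"
      unfolding eq by (intro nn_integral_cong) (subst ennreal_mult[symmetric], simp_all)
    also have "\<dots> = ennreal (1 / t m powr p) * (\<integral>\<^sup>+x. ennreal (\<bar>v (x + t m *\<^sub>R e) - v x\<bar> powr p) \<partial>lborel)"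
      by (intro nn_integral_cmult) measurable
    also have "\<dots> \<le> ennreal (1 / t m powr p) * ennreal (B * t m powr p)"
      by (intro mult_left_mono diff t) simp
    also have "\<dots> = ennreal B" using t(1)[of m] B by (subst ennreal_mult[symmetric]) simp_all
    finally show ?thesis .
  qed
  have qp: "(\<lambda>x. \<bar>q m x\<bar> powr p) \<in> borel_measurable lborel" for m by measurable
  have q_int: "integrable lborel (\<lambda>x. \<bar>q m x\<bar> powr p)" for m
  proof (rule integrableI_nonneg[OF qp])
    show "(\<integral>\<^sup>+x. ennreal (\<bar>q m x\<bar> powr p) \<partial>lborel) < \<infinity>" using q_nn[of m] by (rule order.strict_trans1) simp
  qed simp
  have q_B: "(\<integral>x. \<bar>q m x\<bar> powr p \<partial>lborel) \<le> B" for m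
    using q_nn[of m] B unfolding nn_integral_eq_integral[OF q_int AE_I2[OF powr_ge_zero]] by simp
  define T where "T \<phi> = - (\<integral>x. v x * frechet_derivative \<phi> (at x) e \<partial>lborel)" for \<phi> :: "'a \<Rightarrow> real"
  obtain g where g: "g \<in> borel_measurable borel" "integrable lborel (\<lambda>x. \<bar>g x\<bar> powr p)"
    "(\<integral>x. \<bar>g x\<bar> powr p \<partial>lborel) \<le> B" "\<And>\<phi>. \<phi> \<in> test_functions \<Longrightarrow> (\<integral>x. g x * \<phi> x \<partial>lborel) = T \<phi>"
  proof (rule weak_limit_of_Lp_bounded_sequence[OF p qm q_int q_B, where F = test_functions and T = T])
    fix \<phi> :: "'a \<Rightarrow> real" assume \<phi>: "\<phi> \<in> test_functions"
    show "\<phi> \<in> borel_measurable borel"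
      using test_function_facts(2)[OF \<phi>] by (rule borel_measurable_continuous_onI)
    obtain R where R: "R > 0" "\<And>x. norm x > R \<Longrightarrow> \<phi> x = 0"
      using test_function_facts(4)[OF \<phi>] by (rule bounded_support_of_compact) blast
    then show "\<exists>R. \<forall>x. norm x > R \<longrightarrow> \<phi> x = 0" by blast
    show "\<exists>M. \<forall>x. \<bar>\<phi> x\<bar> \<le> M"
      using continuous_bounded_support_bounded[OF test_function_facts(2)[OF \<phi>] R(2)] by blast
    show "(\<lambda>m. \<integral>x. q m x * \<phi> x \<partial>lborel) \<longlonglongrightarrow> T \<phi>"
      unfolding q_def T_def
      by (rule difference_quotient_tendsto_weak_derivative[OF v less_imp_le[OF p] vint test_function_facts(1)[OF \<phi>]
            test_function_facts(3)[OF \<phi>] test_function_facts(4)[OF \<phi>] t t0])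
  qed blast
  show ?thesis by (rule that[OF g(1-3)]) (simp only: g(4) T_def)
qed

lemma integrable_on_ball_if_powr_integrable:
  fixes f :: "'a::euclidean_space \<Rightarrow> real"
  assumes "f \<in> borel_measurable borel" "1 \<le> p" "integrable lborel (\<lambda>x. \<bar>f x\<bar> powr p)"
  shows "integrable lborel (\<lambda>x. f x * indicator (cball 0 R) x)"
proof (rule integrable_mult_bounded_support[OF assms(1) _ assms(2,3), where M = 1 and R = R])
  show "(indicator (cball 0 R) :: 'a \<Rightarrow> real) \<in> borel_measurable borel"
    by (intro borel_measurable_indicator) simp
qed (simp_all split: split_indicator)

lemma AE_eq_if_same_weak_action:
  fixes f g :: "'a::euclidean_space \<Rightarrow> real"
  assumes f: "f \<in> borel_measurable borel" "integrable lborel (\<lambda>x. \<bar>f x\<bar> powr p)"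
    and g: "g \<in> borel_measurable borel" "integrable lborel (\<lambda>x. \<bar>g x\<bar> powr p)" and p: "1 \<le> p"
    and eq: "\<And>\<phi>. \<phi> \<in> test_functions \<Longrightarrow> (\<integral>x. f x * \<phi> x \<partial>lborel) = (\<integral>x. g x * \<phi> x \<partial>lborel)"
  shows "AE x in lborel. f x = g x"
proof -
  have "AE x in lborel. f x - g x = 0"
  proof (rule AE_zero_if_test_integrals_zero)
    show "(\<lambda>x. f x - g x) \<in> borel_measurable borel" using f(1) g(1) by (rule borel_measurable_diff)
    show "integrable lborel (\<lambda>x. (f x - g x) * indicator (cball 0 R) x)" for R
      unfolding left_diff_distrib
      by (intro Bochner_Integration.integrable_diff integrable_on_ball_if_powr_integrable[OF _ p] f g)
    fix \<phi> :: "'a \<Rightarrow> real" assume \<phi>: "\<phi> \<in> test_functions"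
    obtain R where R: "R > 0" "\<And>x. norm x > R \<Longrightarrow> \<phi> x = 0"
      using test_function_facts(4)[OF \<phi>] by (rule bounded_support_of_compact) blast
    obtain M where M: "\<And>x. \<bar>\<phi> x\<bar> \<le> M"
      using continuous_bounded_support_bounded[OF test_function_facts(2)[OF \<phi>] R(2)] by blast
    have \<phi>m: "\<phi> \<in> borel_measurable borel"
      using test_function_facts(2)[OF \<phi>] by (rule borel_measurable_continuous_onI)
    have "integrable lborel (\<lambda>x. f x * \<phi> x)"
      by (rule integrable_mult_bounded_support[OF f(1) \<phi>m p f(2) M R(2)])
    moreover have "integrable lborel (\<lambda>x. g x * \<phi> x)"
      by (rule integrable_mult_bounded_support[OF g(1) \<phi>m p g(2) M R(2)])
    ultimately show "(\<integral>x. (f x - g x) * \<phi> x \<partial>lborel) = 0"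
      using eq[OF \<phi>] by (simp add: left_diff_distrib)
  qed
  then show ?thesis by eventually_elim simp
qed

lemma norm_powr_le_sum:
  fixes y :: "'a::euclidean_space"
  assumes "p \<ge> 0"
  shows "norm y powr p \<le> real DIM('a) powr p * (\<Sum>i\<in>Basis. \<bar>y \<bullet> i\<bar> powr p)"
proof -
  define m where "m = Max ((\<lambda>i. \<bar>y \<bullet> i\<bar>) ` Basis)"
  have "m \<in> (\<lambda>i. \<bar>y \<bullet> i\<bar>) ` Basis" unfolding m_def by (intro Max_in) auto
  then obtain j where j: "j \<in> Basis" "m = \<bar>y \<bullet> j\<bar>" by auto
  have le: "\<bar>y \<bullet> i\<bar> \<le> m" if "i \<in> Basis" for i unfolding m_def using that by (intro Max_ge) auto
  have "norm y \<le> (\<Sum>i\<in>Basis. \<bar>y \<bullet> i\<bar>)" by (rule norm_le_l1)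
  also have "\<dots> \<le> (\<Sum>i\<in>(Basis :: 'a set). m)" by (intro sum_mono le)
  finally have "norm y \<le> real DIM('a) * m" by simp
  then have "norm y powr p \<le> (real DIM('a) * m) powr p" using assms by (intro powr_mono2) auto
  also have "\<dots> = real DIM('a) powr p * \<bar>y \<bullet> j\<bar> powr p" using j by (simp add: powr_mult)
  also have "\<dots> \<le> real DIM('a) powr p * (\<Sum>i\<in>Basis. \<bar>y \<bullet> i\<bar> powr p)"
    using j by (intro mult_left_mono member_le_sum) auto
  finally show ?thesis .
qed

text \<open>The weak partial derivatives assemble to one weak gradient \<open>G\<close>. The second
  claim concerns the one selected by \<open>SOME\<close>, so it rests on uniqueness: both act alike
  on test functions, hence agree almost everywhere, component by component.\<close>

lemma W1p_if_increments_bounded: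
  fixes u v :: "'a::euclidean_space \<Rightarrow> real"
  assumes p: "p > 1" and uLp: "u \<in> Lp p" and v [measurable]: "v \<in> borel_measurable borel"
    and uv: "AE x in lborel. u x = v x" and vint: "integrable lborel (\<lambda>x. \<bar>v x\<bar> powr p)"
    and B: "B \<ge> 0" and diff: "\<And>e \<tau>. e \<in> Basis \<Longrightarrow> \<tau> > 0 \<Longrightarrow>
      (\<integral>\<^sup>+x. ennreal (\<bar>v (x + \<tau> *\<^sub>R e) - v x\<bar> powr p) \<partial>lborel) \<le> ennreal (B * \<tau> powr p)"
  shows "u \<in> W1p p"
    and "(\<integral>\<^sup>+x. ennreal (norm (weak_gradient p u x) powr p) \<partial>lebesgue) \<le> ennreal (real DIM('a) powr (p + 1) * B)"
proof -
  have u: "u \<in> borel_measurable lebesgue" using uLp by (simp add: Lp_def)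
  define Q where "Q e g \<longleftrightarrow> g \<in> borel_measurable borel \<and> integrable lborel (\<lambda>x. \<bar>g x\<bar> powr p) \<and>
    (\<integral>x. \<bar>g x\<bar> powr p \<partial>lborel) \<le> B \<and> (\<forall>\<phi>\<in>test_functions.
      (\<integral>x. g x * \<phi> x \<partial>lborel) = - (\<integral>x. v x * frechet_derivative \<phi> (at x) e \<partial>lborel))" for e g
  have "\<forall>e\<in>Basis. \<exists>g. Q e g"
  proof
    fix e :: 'a assume e: "e \<in> Basis"
    show "\<exists>g. Q e g"
    proof (rule exists_weak_partial_derivative[OF p v vint B diff[OF e]])
      fix g :: "'a \<Rightarrow> real"
      assume "g \<in> borel_measurable borel" "integrable lborel (\<lambda>x. \<bar>g x\<bar> powr p)"
        "(\<integral>x. \<bar>g x\<bar> powr p \<partial>lborel) \<le> B" "\<And>\<phi>. \<phi> \<in> test_functions \<Longrightarrow>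
          (\<integral>x. g x * \<phi> x \<partial>lborel) = - (\<integral>x. v x * frechet_derivative \<phi> (at x) e \<partial>lborel)"
      then have "Q e g" unfolding Q_def by (intro conjI ballI)
      then show "\<exists>g. Q e g" by blast
    qed
  qed
  from bchoice[OF this] obtain g where Q: "\<And>e. e \<in> Basis \<Longrightarrow> Q e (g e)" by blast
  then have g: "\<And>e. e \<in> Basis \<Longrightarrow> g e \<in> borel_measurable borel"
    "\<And>e. e \<in> Basis \<Longrightarrow> integrable lborel (\<lambda>x. \<bar>g e x\<bar> powr p)"
    "\<And>e. e \<in> Basis \<Longrightarrow> (\<integral>x. \<bar>g e x\<bar> powr p \<partial>lborel) \<le> B"
    unfolding Q_def by blast+
  have gw: "(\<integral>x. g e x * \<phi> x \<partial>lborel) = - (\<integral>x. v x * frechet_derivative \<phi> (at x) e \<partial>lborel)"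
    if "e \<in> Basis" "\<phi> \<in> test_functions" for e \<phi>
    using Q[OF that(1)] that(2) unfolding Q_def by blast
  define G where "G x = (\<Sum>e\<in>Basis. g e x *\<^sub>R e)" for x
  have G_e: "G x \<bullet> e = g e x" if "e \<in> Basis" for x e unfolding G_def using that by simp
  have Gm: "G \<in> borel_measurable borel" unfolding G_def[abs_def]
    by (intro borel_measurable_sum borel_measurable_scaleR g borel_measurable_const)
  have test_m: "\<phi> \<in> borel_measurable borel" "(\<lambda>x. frechet_derivative \<phi> (at x) e) \<in> borel_measurable borel"
    if "\<phi> \<in> test_functions" for \<phi> :: "'a \<Rightarrow> real" and e
    by (rule borel_measurable_continuous_onI[OF test_function_facts(2)[OF that]] borel_measurable_continuous_onI[OF test_function_facts(3)[OF that]])+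
  have to_leb: "f \<in> borel_measurable lebesgue" if "f \<in> borel_measurable borel" for f :: "'a \<Rightarrow> real"
    using that by (intro measurable_completion) simp
  have LHS: "(LINT x|lebesgue. u x * frechet_derivative \<phi> (at x) e) = (\<integral>x. v x * frechet_derivative \<phi> (at x) e \<partial>lborel)"
    if \<phi>: "\<phi> \<in> test_functions" for \<phi> :: "'a \<Rightarrow> real" and e
  proof (rule integral_lebesgue_eq_lborel)
    show "(\<lambda>x. u x * frechet_derivative \<phi> (at x) e) \<in> borel_measurable lebesgue"
      by (intro borel_measurable_times u to_leb test_m \<phi>)
    show "(\<lambda>x. v x * frechet_derivative \<phi> (at x) e) \<in> borel_measurable borel"
      by (intro borel_measurable_times v test_m \<phi>)
    show "AE x in lborel. u x * frechet_derivative \<phi> (at x) e = v x * frechet_derivative \<phi> (at x) e"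
      using uv by eventually_elim simp
  qed
  have bound: "(\<integral>\<^sup>+x. ennreal (norm (G x) powr p) \<partial>lborel) \<le> ennreal (real DIM('a) powr (p + 1) * B)"
  proof -
    \<comment> \<open>The power \<open>p + 1\<close> of the dimension arises as
      \<open>N powr p\<close> from comparing the norm with the coordinates, times \<open>N\<close>
      coordinates, each contributing at most \<open>B\<close>.\<close>
    define N where "N = real DIM('a)"
    have N: "N > 0" by (simp add: N_def)
    have gm: "(\<lambda>x. ennreal (\<bar>g e x\<bar> powr p)) \<in> borel_measurable lborel" if "e \<in> Basis" for e
      using borel_measurable_integrable[OF g(2)[OF that]] by measurable
    have "(\<integral>\<^sup>+x. ennreal (norm (G x) powr p) \<partial>lborel)
        \<le> (\<integral>\<^sup>+x. ennreal (N powr p) * (\<Sum>e\<in>Basis. ennreal (\<bar>g e x\<bar> powr p)) \<partial>lborel)"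
    proof (rule nn_integral_mono)
      fix x
      have "norm (G x) powr p \<le> N powr p * (\<Sum>e\<in>Basis. \<bar>G x \<bullet> e\<bar> powr p)"
        unfolding N_def using p by (intro norm_powr_le_sum) simp
      also have "(\<Sum>e\<in>Basis. \<bar>G x \<bullet> e\<bar> powr p) = (\<Sum>e\<in>Basis. \<bar>g e x\<bar> powr p)"
        by (intro sum.cong) (simp_all add: G_e)
      finally have "ennreal (norm (G x) powr p) \<le> ennreal (N powr p * (\<Sum>e\<in>Basis. \<bar>g e x\<bar> powr p))"
        by (rule ennreal_leI)
      also have "\<dots> = ennreal (N powr p) * (\<Sum>e\<in>Basis. ennreal (\<bar>g e x\<bar> powr p))"
        by (subst ennreal_mult) (simp_all add: sum_nonneg)
      finally show "ennreal (norm (G x) powr p) \<le> ennreal (N powr p) * (\<Sum>e\<in>Basis. ennreal (\<bar>g e x\<bar> powr p))" .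
    qed
    also have "\<dots> = ennreal (N powr p) * (\<integral>\<^sup>+x. (\<Sum>e\<in>Basis. ennreal (\<bar>g e x\<bar> powr p)) \<partial>lborel)"
      by (intro nn_integral_cmult borel_measurable_sum gm)
    also have "(\<integral>\<^sup>+x. (\<Sum>e\<in>Basis. ennreal (\<bar>g e x\<bar> powr p)) \<partial>lborel)
        = (\<Sum>e\<in>Basis. \<integral>\<^sup>+x. ennreal (\<bar>g e x\<bar> powr p) \<partial>lborel)"
      by (intro nn_integral_sum gm)
    also have "ennreal (N powr p) * (\<Sum>e\<in>Basis. \<integral>\<^sup>+x. ennreal (\<bar>g e x\<bar> powr p) \<partial>lborel)
        \<le> ennreal (N powr p) * (\<Sum>e\<in>(Basis :: 'a set). ennreal B)"
    proof (intro mult_left_mono sum_mono)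
      fix e :: 'a assume e: "e \<in> Basis"
      show "(\<integral>\<^sup>+x. ennreal (\<bar>g e x\<bar> powr p) \<partial>lborel) \<le> ennreal B"
        unfolding nn_integral_eq_integral[OF g(2)[OF e] AE_I2[OF powr_ge_zero]] by (rule ennreal_leI[OF g(3)[OF e]])
    qed simp
    also have "\<dots> = ennreal (N powr p * (N * B))"
      using B by (simp add: N_def ennreal_mult ennreal_of_nat_eq_real_of_nat)
    also have "N powr p * (N * B) = N powr (p + 1) * B" using N by (simp add: powr_add)
    finally show ?thesis by (simp only: N_def)
  qed
  have G_int: "integrable lborel (\<lambda>x. norm (G x) powr p)"
  proof (rule integrableI_nonneg)
    show "(\<lambda>x. norm (G x) powr p) \<in> borel_measurable lborel" using Gm by measurable
    show "(\<integral>\<^sup>+x. ennreal (norm (G x) powr p) \<partial>lborel) < \<infinity>" using bound by (rule order.strict_trans1) simp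
  qed simp
  have G_Lp: "G \<in> Lp p"
  proof -
    have "G \<in> borel_measurable lebesgue" using Gm by (intro measurable_completion) simp
    moreover have "integrable lebesgue (\<lambda>x. norm (G x) powr p)"
      using G_int by (subst integrable_completion) auto
    ultimately show ?thesis by (simp add: Lp_def)
  qed
  have G_weak: "is_weak_gradient u G"
    unfolding is_weak_gradient_def
  proof (intro ballI)
    fix \<phi> :: "'a \<Rightarrow> real" and e :: 'a assume \<phi>: "\<phi> \<in> test_functions" and e: "e \<in> Basis"
    have "(LINT x|lebesgue. G x \<bullet> e * \<phi> x) = (\<integral>x. g e x * \<phi> x \<partial>lborel)"
      unfolding G_e[OF e] by (intro integral_completion) (use g(1)[OF e] test_m(1)[OF \<phi>] in simp)
    then show "(LINT x|lebesgue. u x * frechet_derivative \<phi> (at x) e) = - (LINT x|lebesgue. G x \<bullet> e * \<phi> x)"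
      unfolding LHS[OF \<phi>] using gw[OF e \<phi>] by simp
  qed
  show "u \<in> W1p p" unfolding W1p_def using uLp G_Lp G_weak by blast
  define H where "H = weak_gradient p u"
  have "H \<in> Lp p \<and> is_weak_gradient u H"
    unfolding H_def weak_gradient_def by (rule someI[where x = G]) (intro conjI G_Lp G_weak)
  then have H: "H \<in> Lp p" "is_weak_gradient u H" by simp_all
  have H_e: "AE x in lborel. H x \<bullet> e = g e x" if e: "e \<in> Basis" for e
  proof -
    have Hm: "H \<in> borel_measurable lebesgue" and Hi: "integrable lebesgue (\<lambda>x. norm (H x) powr p)"
      using H(1) by (simp_all add: Lp_def)
    have He: "(\<lambda>x. H x \<bullet> e) \<in> borel_measurable lebesgue"
      using Hm by (intro borel_measurable_inner borel_measurable_const)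
    have "integrable lebesgue (\<lambda>x. \<bar>H x \<bullet> e\<bar> powr p)"
    proof (rule Bochner_Integration.integrable_bound[OF Hi])
      show "(\<lambda>x. \<bar>H x \<bullet> e\<bar> powr p) \<in> borel_measurable lebesgue" using He by measurable
      have "\<bar>H x \<bullet> e\<bar> powr p \<le> norm (H x) powr p" for x
        using Basis_le_norm[OF e] p by (intro powr_mono2) auto
      then show "AE x in lebesgue. norm (\<bar>H x \<bullet> e\<bar> powr p) \<le> norm (norm (H x) powr p)" by simp
    qed
    then obtain h where h: "h \<in> borel_measurable borel" "AE x in lborel. H x \<bullet> e = h x"
      "integrable lborel (\<lambda>x. \<bar>h x\<bar> powr p)" using Lp_borel_representative[OF He] by blast
    have "AE x in lborel. h x = g e x"
    proof (rule AE_eq_if_same_weak_action[OF h(1,3) g(1,2)[OF e]])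
      fix \<phi> :: "'a \<Rightarrow> real" assume \<phi>: "\<phi> \<in> test_functions"
      have "(LINT x|lebesgue. H x \<bullet> e * \<phi> x) = (\<integral>x. h x * \<phi> x \<partial>lborel)"
      proof (rule integral_lebesgue_eq_lborel)
        show "(\<lambda>x. H x \<bullet> e * \<phi> x) \<in> borel_measurable lebesgue"
          by (intro borel_measurable_times He to_leb test_m(1) \<phi>)
        show "(\<lambda>x. h x * \<phi> x) \<in> borel_measurable borel" by (intro borel_measurable_times h test_m(1) \<phi>)
        show "AE x in lborel. H x \<bullet> e * \<phi> x = h x * \<phi> x" using h(2) by eventually_elim simp
      qed
      moreover have "(LINT x|lebesgue. u x * frechet_derivative \<phi> (at x) e) = - (LINT x|lebesgue. H x \<bullet> e * \<phi> x)"
        using H(2) \<phi> e unfolding is_weak_gradient_def by blast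
      ultimately show "(\<integral>x. h x * \<phi> x \<partial>lborel) = (\<integral>x. g e x * \<phi> x \<partial>lborel)"
        unfolding LHS[OF \<phi>] using gw[OF e \<phi>] by simp
    qed (use p in simp)
    with h(2) show ?thesis by eventually_elim simp
  qed
  have "AE x in lborel. \<forall>e\<in>Basis. H x \<bullet> e = g e x" by (rule AE_finite_allI[OF finite_Basis H_e])
  then have "AE x in lborel. H x = G x"
  proof eventually_elim
    case (elim x)
    show ?case by (rule euclidean_eqI) (use elim in \<open>simp add: G_e\<close>)
  qed
  then have "AE x in lborel. ennreal (norm (H x) powr p) = ennreal (norm (G x) powr p)" by eventually_elim simp
  then have "(\<integral>\<^sup>+x. ennreal (norm (H x) powr p) \<partial>lborel) = (\<integral>\<^sup>+x. ennreal (norm (G x) powr p) \<partial>lborel)"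
    by (rule nn_integral_cong_AE)
  with bound show "(\<integral>\<^sup>+x. ennreal (norm (weak_gradient p u x) powr p) \<partial>lebesgue) \<le> ennreal (real DIM('a) powr (p + 1) * B)"
    unfolding H_def[symmetric] nn_integral_completion by simp
qed

section \<open>From the lower limit to the gradient bound\<close>

lemma less_Liminf_obtain_sequence:
  fixes F :: "real \<Rightarrow> ennreal" and d :: "nat \<Rightarrow> real"
  assumes "Liminf (at_right 0) F < A" and "\<And>j. d j > 0"
  obtains l where "\<And>j. 0 < l j" "\<And>j. l j \<le> d j" "\<And>j. F (l j) \<le> A"
proof -
  have "\<exists>x. 0 < x \<and> x \<le> d j \<and> F x \<le> A" for j
  proof (rule ccontr)
    \<comment> \<open>Otherwise \<open>F\<close> would exceed \<open>A\<close> on a whole right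
      neighbourhood of \<open>0\<close>, and so would its lower limit be at least \<open>A\<close>.
      The bound \<open>d j\<close> later prescribes the quadratic decay of the sequence.\<close>
    assume none: "\<not> ?thesis"
    have "\<forall>\<^sub>F x in at_right 0. x \<in> {0<..<d j}"
      by (rule eventually_at_right_real) (rule assms(2))
    then have "\<forall>\<^sub>F x in at_right 0. A \<le> F x"
    proof eventually_elim
      case (elim x)
      then have "\<not> F x \<le> A" using none by auto
      then show ?case by simp
    qed
    then have "A \<le> Liminf (at_right 0) F" by (rule Liminf_bounded)
    with assms(1) show False by simp
  qed
  then obtain l where "\<And>j. 0 < l j \<and> l j \<le> d j \<and> F (l j) \<le> A" by metis
  then show ?thesis by (intro that[of l]) simp_all
qed

definition gradient_constant :: "'a::euclidean_space itself \<Rightarrow> real \<Rightarrow> real" where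
  "gradient_constant _ p = real DIM('a) powr (p + 1) * (384 / density_threshold TYPE('a) * 32 powr (p - 1))"

lemma gradient_constant_pos: "gradient_constant TYPE('a::euclidean_space) p > 0"
  using density_threshold_pos[where 'a='a] by (simp add: gradient_constant_def)

text \<open>A strict upper bound \<open>A\<close> of the lower limit is attained or undercut along a
  sequence tending to \<open>0\<close> as fast as desired, which is the form in which the increment
  estimate consumes the energy.\<close>

lemma Phi_le_if_Liminf_less:
  fixes u :: "'a::euclidean_space \<Rightarrow> real"
  assumes p: "1 \<le> p" "- p \<le> \<gamma>" "\<gamma> \<le> -1" and u: "u \<in> Lp p" and A: "A \<ge> 0"
    and less: "Liminf (at_right 0) (\<lambda>l. Phi_lambda p \<gamma> l u) < ennreal A"
  shows "Phi p u \<le> ennreal (gradient_constant TYPE('a) p * A)"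
    and "1 < p \<Longrightarrow> u \<in> W1p p" and "p = 1 \<Longrightarrow> u \<in> BV"
proof -
  have um: "u \<in> borel_measurable lebesgue" and ui: "integrable lebesgue (\<lambda>x. \<bar>u x\<bar> powr p)"
    using u by (simp_all add: Lp_def)
  obtain v where v: "v \<in> borel_measurable borel" "AE x in lborel. u x = v x"
    "integrable lborel (\<lambda>x. \<bar>v x\<bar> powr p)"
    using Lp_borel_representative[OF um ui] by blast
  have pos: "0 < 1 / real (Suc j) ^ 2" for j by (intro divide_pos_pos zero_less_power) simp_all
  obtain l where l: "\<And>j. 0 < l j" "\<And>j. l j \<le> 1 / real (Suc j) ^ 2" "\<And>j. Phi_lambda p \<gamma> (l j) u \<le> ennreal A"
    using less_Liminf_obtain_sequence[where d = "\<lambda>j. 1 / real (Suc j) ^ 2", OF less pos] by metis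
  have lv: "Phi_lambda p \<gamma> (l j) v \<le> ennreal A" for j
    using l(3)[of j] by (simp only: Phi_lambda_cong_AE[OF v(2)])
  define c where "c = 384 / density_threshold TYPE('a) * 32 powr (p - 1)"
  have c: "c > 0" using density_threshold_pos[where 'a='a] by (simp add: c_def)
  have cA: "c * A \<ge> 0" using c A by simp
  have incr: "(\<integral>\<^sup>+x. ennreal (\<bar>v (x + \<tau> *\<^sub>R e) - v x\<bar> powr p) \<partial>lborel) \<le> ennreal (c * A * \<tau> powr p)"
    if e: "e \<in> Basis" and \<tau>: "\<tau> > 0" for e \<tau>
  proof -
    have "(\<integral>\<^sup>+x. ennreal (\<bar>v (x + \<tau> *\<^sub>R e) - v x\<bar> powr p) \<partial>lborel) \<le> ennreal (c * \<tau> powr p) * ennreal A"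
      unfolding c_def
      by (rule integral_increment_powr_le[OF v(1) p l(1,2) _ lv norm_Basis[OF e] \<tau>]) simp
    also have "\<dots> = ennreal (c * A * \<tau> powr p)"
      using A c by (subst ennreal_mult[symmetric]) (simp_all add: ac_simps)
    finally show ?thesis .
  qed
  have const: "gradient_constant TYPE('a) p * A = real DIM('a) powr (p + 1) * (c * A)"
    by (simp only: gradient_constant_def c_def mult.assoc)
  have one: "total_variation u \<le> ennreal (real DIM('a) * (c * A))" if "p = 1"
  proof (rule total_variation_le[OF um v(1,2) v(3)[unfolded that] cA])
    fix e :: 'a and \<tau> :: real assume "e \<in> Basis" "\<tau> > 0"
    then show "(\<integral>\<^sup>+x. ennreal (\<bar>v (x + \<tau> *\<^sub>R e) - v x\<bar> powr 1) \<partial>lborel) \<le> ennreal (c * A * \<tau>)"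
      using incr[of e \<tau>] that by simp
  qed
  show "u \<in> BV" if "p = 1"
  proof -
    have "total_variation u < \<infinity>" using one[OF that] by (rule order.strict_trans1) simp
    then show ?thesis using u that by (simp add: BV_def)
  qed
  show W: "u \<in> W1p p" if "1 < p" by (rule W1p_if_increments_bounded(1)[OF that u v cA incr])
  show "Phi p u \<le> ennreal (gradient_constant TYPE('a) p * A)"
  proof (cases "p = 1")
    case True
    \<comment> \<open>The total variation bound carries only one factor of the dimension; it is
      enlarged to the power \<open>p + 1\<close> so that one constant serves all
      \<open>p\<close>.\<close>
    have "real DIM('a) powr 1 \<le> real DIM('a) powr (p + 1)"
      using p(1) by (intro powr_mono) (simp_all add: Suc_leI)
    then have "real DIM('a) * (c * A) \<le> real DIM('a) powr (p + 1) * (c * A)"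
      using cA by (intro mult_right_mono) simp_all
    from order.trans[OF one[OF True] ennreal_leI[OF this]] show ?thesis
      unfolding const Phi_def if_P[OF True] .
  next
    case False
    then have p1: "1 < p" using p by simp
    show ?thesis
      unfolding const Phi_def if_not_P[OF False] if_P[OF W[OF p1]]
      by (rule W1p_if_increments_bounded(2)[OF p1 u v cA incr])
  qed
qed

theorem theorem2p2:
  fixes p :: real
  assumes "1 \<le> p"
  shows "\<exists>C>0. \<forall>\<gamma>. - p \<le> \<gamma> \<and> \<gamma> \<le> - 1 \<longrightarrow>
    (\<forall>u :: real ^ 'n \<Rightarrow> real. u \<in> Lp p \<longrightarrow>
       ennreal C * Phi p u \<le> Liminf (at_right 0) (\<lambda>l. Phi_lambda p \<gamma> l u) \<and>
       (Liminf (at_right 0) (\<lambda>l. Phi_lambda p \<gamma> l u) < \<infinity> \<longrightarrow>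
          (1 < p \<longrightarrow> u \<in> W1p p) \<and> (p = 1 \<longrightarrow> u \<in> BV)))"
proof (intro exI[of _ "1 / gradient_constant TYPE(real ^ 'n) p"] conjI allI impI; (elim conjE)?)
  define D where "D = gradient_constant TYPE(real ^ 'n) p"
  have D: "D > 0" unfolding D_def by (rule gradient_constant_pos)
  then show "0 < 1 / gradient_constant TYPE(real ^ 'n) p" by (simp add: D_def)
  fix \<gamma> and u :: "real ^ 'n \<Rightarrow> real"
  assume \<gamma>: "- p \<le> \<gamma>" "\<gamma> \<le> - 1" and u: "u \<in> Lp p"
  define L where "L = Liminf (at_right 0) (\<lambda>l. Phi_lambda p \<gamma> l u)"
  \<comment> \<open>The preceding bound asks for a real number strictly above \<open>L\<close>,
    hence the margin \<open>\<epsilon>\<close>, removed at the end by letting it tend to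
    \<open>0\<close>.\<close>
  have above: "\<exists>r\<ge>0. L = ennreal r \<and> (\<forall>\<epsilon>>0. L < ennreal (r + \<epsilon>))" if fin: "L < \<infinity>"
  proof -
    obtain r where r: "L = ennreal r" "r \<ge> 0" using fin by (cases L) simp_all
    then show ?thesis by (intro exI[of _ r]) (simp add: ennreal_less_iff)
  qed
  note core = Phi_le_if_Liminf_less[OF assms \<gamma> u, folded L_def]
  show "ennreal (1 / gradient_constant TYPE(real ^ 'n) p) * Phi p u \<le> Liminf (at_right 0) (\<lambda>l. Phi_lambda p \<gamma> l u)"
  proof (cases "L < \<infinity>")
    case True
    from above[OF this] obtain r where r: "r \<ge> 0" "L = ennreal r" "\<And>\<epsilon>. \<epsilon> > 0 \<Longrightarrow> L < ennreal (r + \<epsilon>)" by blast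
    have "ennreal (1 / D) * Phi p u \<le> L"
    proof (rule ennreal_le_epsilon)
      fix \<epsilon> :: real assume \<epsilon>: "\<epsilon> > 0"
      have "Phi p u \<le> ennreal (D * (r + \<epsilon>))" unfolding D_def using core(1)[OF _ r(3)[OF \<epsilon>]] r(1) \<epsilon> by simp
      then have "ennreal (1 / D) * Phi p u \<le> ennreal (1 / D) * ennreal (D * (r + \<epsilon>))" by (rule mult_left_mono) simp
      also have "\<dots> = ennreal (r + \<epsilon>)" using D r(1) \<epsilon> by (subst ennreal_mult[symmetric]) simp_all
      also have "\<dots> = L + ennreal \<epsilon>" using r(1,2) \<epsilon> by simp
      finally show "ennreal (1 / D) * Phi p u \<le> L + ennreal \<epsilon>" .
    qed
    then show ?thesis by (simp only: D_def L_def)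
  next
    case False
    then have "L = \<infinity>" by (simp add: less_top[symmetric])
    then show ?thesis by (simp add: L_def)
  qed
  assume "Liminf (at_right 0) (\<lambda>l. Phi_lambda p \<gamma> l u) < \<infinity>"
  then have "L < \<infinity>" by (simp only: L_def)
  \<comment> \<open>For mere membership in the function space any finite strict bound will do, so
    the margin is \<open>1\<close>.\<close>
  from above[OF this] obtain r where r: "r \<ge> 0" "L < ennreal (r + 1)" by (metis zero_less_one)
  show "u \<in> W1p p" if "1 < p" using core(2)[OF _ r(2)] r(1) that by simp
  show "u \<in> BV" if "p = 1" using core(3)[OF _ r(2)] r(1) that by simp
qed

end
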